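(* Let $k,i,n$ be integers with $1<k<n$, $k<i<2k$ and $i\le n$. If $i=n$, then $$\pi_2(\mathcal{F}_2^{n}(k,n))\cong\mathbb{Z}^2,$$ while if $i<n$, then $$\pi_2(\mathcal{F}_2^{i}(k,n))\cong\mathbb{Z}^3 .$$
   Context: For $0<k<n$, $Gr(k,n)$ denotes the Grassmannian manifold of $k$-dimensional complex linear subspaces of $\mathbb{C}^n$. $\mathcal{F}_2^i(k,n)$ is the space of all ordered pairs $(H_1,H_2)$ of distinct points of $Gr(k,n)$ such that $\dim(H_1+H_2)=i$ (equivalently $\dim(H_1\cap H_2)=2k-i$), topologized as a subspace of $Gr(k,n)^2$. *)

theory Defs
  imports "HOL-Analysis.Analysis" "HOL-Algebra.Elementary_Groups"
begin

definition grassmannian :: "nat \<Rightarrow> (complex ^ 'n) set set" where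
  "grassmannian k = {H. vec.subspace H \<and> vec.dim H = k}"

text \<open>Functions in the product topology over \<open>{..<k}\<close> are extensional, so a frame is exactly
  a linearly independent \<open>k\<close>-tuple of vectors.\<close>

definition frames :: "nat \<Rightarrow> (nat \<Rightarrow> complex ^ 'n) topology" where
  "frames k = subtopology (product_topology (\<lambda>_. euclidean) {..<k})
     {v. inj_on v {..<k} \<and> vec.independent (v ` {..<k})}"

definition frame_span :: "nat \<Rightarrow> (nat \<Rightarrow> complex ^ 'n) \<Rightarrow> (complex ^ 'n) set" where
  "frame_span k v = vec.span (v ` {..<k})"

text \<open>The manifold topology of the Grassmannian, as the quotient of the non-compact Stiefel
  manifold by the action of the general linear group; see \<open>quotient_map_frame_span\<close>.\<close>

definition grassmann_top :: "nat \<Rightarrow> (complex ^ 'n) set topology" where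
  "grassmann_top k = topology (\<lambda>U. U \<subseteq> grassmannian k \<and>
     openin (frames k) {v \<in> topspace (frames k). frame_span k v \<in> U})"

lemma openin_grassmann_top:
  fixes U :: "(complex ^ 'n) set set"
  shows "openin (grassmann_top k) U \<longleftrightarrow> U \<subseteq> grassmannian k \<and>
     openin (frames k) {v \<in> topspace (frames k). frame_span k v \<in> U}"
proof -
  let ?L = "\<lambda>U :: (complex ^ 'n) set set. U \<subseteq> grassmannian k \<and>
     openin (frames k) {v \<in> topspace (frames k). frame_span k v \<in> U}"
  have "istopology ?L"
    unfolding istopology_def
  proof (intro conjI allI impI)
    fix S T assume S: "?L S" and T: "?L T"
    show "S \<inter> T \<subseteq> grassmannian k" using S by blast
    have "{v \<in> topspace (frames k). frame_span k v \<in> S \<inter> T} =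
      {v \<in> topspace (frames k). frame_span k v \<in> S} \<inter>
      {v \<in> topspace (frames k). frame_span k v \<in> T}" by blast
    then show "openin (frames k) {v \<in> topspace (frames k). frame_span k v \<in> S \<inter> T}"
      using S T by (simp only: openin_Int)
  next
    fix K assume K: "\<forall>U\<in>K. ?L U"
    show "\<Union>K \<subseteq> grassmannian k" using K by blast
    have "{v \<in> topspace (frames k). frame_span k v \<in> \<Union>K} =
      \<Union> ((\<lambda>U. {v \<in> topspace (frames k). frame_span k v \<in> U}) ` K)" by blast
    then show "openin (frames k) {v \<in> topspace (frames k). frame_span k v \<in> \<Union>K}"
      using K by (simp only:) (blast intro: openin_Union)
  qed
  then show ?thesis
    by (simp add: grassmann_top_def)
qed

lemma frame_span_image: "frame_span k ` topspace (frames k) = grassmannian k"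
proof (intro equalityI subsetI)
  fix H :: "(complex ^ 'n) set"
  assume "H \<in> frame_span k ` topspace (frames k)"
  then obtain v where H: "H = vec.span (v ` {..<k})"
    and v: "inj_on v {..<k}" "vec.independent (v ` {..<k})"
    by (auto simp: frames_def frame_span_def)
  then show "H \<in> grassmannian k"
    by (simp add: grassmannian_def vec.subspace_span vec.dim_eq_card_independent card_image)
next
  fix H :: "(complex ^ 'n) set"
  assume "H \<in> grassmannian k"
  then have H: "vec.subspace H" "vec.dim H = k" by (auto simp: grassmannian_def)
  obtain B where B: "B \<subseteq> H" "vec.independent B" "H \<subseteq> vec.span B" "card B = k"
    using vec.basis_exists[of H] H by blast
  have "finite B" using B(2) vec.finiteI_independent by blast
  then obtain f where f: "bij_betw f {..<k} B"
    using B(4) by (metis atLeast0LessThan ex_bij_betw_nat_finite)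
  define v where "v = restrict f {..<k}"
  have im: "v ` {..<k} = B" and inj: "inj_on v {..<k}"
    using f unfolding v_def bij_betw_def by (simp_all add: inj_on_restrict_eq)
  have "v \<in> topspace (frames k)"
    using im inj B(2) by (simp add: frames_def v_def)
  moreover have "frame_span k v = H"
    unfolding frame_span_def im using B(3) vec.span_minimal[OF B(1) H(1)] by (rule subset_antisym[rotated])
  ultimately show "H \<in> frame_span k ` topspace (frames k)" by blast
qed

lemma topspace_grassmann_top:
  "topspace (grassmann_top k) = (grassmannian k :: (complex ^ 'n) set set)"
proof -
  let ?G = "grassmannian k :: (complex ^ 'n) set set"
  have "{v \<in> topspace (frames k). frame_span k v \<in> ?G} = topspace (frames k)"
    using frame_span_image by blast
  then have "openin (grassmann_top k) ?G"
    unfolding openin_grassmann_top by (simp only: openin_topspace subset_refl simp_thms)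
  moreover have "topspace (grassmann_top k) \<subseteq> ?G"
    using openin_topspace[of "grassmann_top k"] unfolding openin_grassmann_top by (rule conjunct1)
  ultimately show ?thesis
    by (simp add: openin_subset subset_antisym)
qed

lemma quotient_map_frame_span: "quotient_map (frames k) (grassmann_top k) (frame_span k)"
  by (simp add: quotient_map_def frame_span_image topspace_grassmann_top openin_grassmann_top)

definition F2 :: "nat \<Rightarrow> nat \<Rightarrow> ((complex ^ 'n) set \<times> (complex ^ 'n) set) set" where
  "F2 i k = {(H1, H2). H1 \<in> grassmannian k \<and> H2 \<in> grassmannian k \<and> H1 \<noteq> H2 \<and>
     vec.dim {x + y |x y. x \<in> H1 \<and> y \<in> H2} = i}"

definition F2_top :: "nat \<Rightarrow> nat \<Rightarrow> ((complex ^ 'n) set \<times> (complex ^ 'n) set) topology" where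
  "F2_top i k = subtopology (prod_topology (grassmann_top k) (grassmann_top k)) (F2 i k)"

lemma topspace_F2_top: "topspace (F2_top i k) = F2 i k"
  by (auto simp: F2_top_def F2_def topspace_grassmann_top)


definition unit_square :: "(real \<times> real) set" where
  "unit_square = {0..1} \<times> {0..1}"

text \<open>Spheroids are determined by their values on the square only; values elsewhere are
  irrelevant, also for \<open>spheroid_rel\<close>.\<close>

definition spheroids :: "'a topology \<Rightarrow> 'a \<Rightarrow> (real \<times> real \<Rightarrow> 'a) set" where
  "spheroids X p = {f. continuous_map (top_of_set unit_square) X f \<and>
     (\<forall>s \<in> frontier unit_square. f s = p)}"

definition spheroid_rel ::
    "'a topology \<Rightarrow> 'a \<Rightarrow> ((real \<times> real \<Rightarrow> 'a) \<times> (real \<times> real \<Rightarrow> 'a)) set" where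
  "spheroid_rel X p = {(f, g). f \<in> spheroids X p \<and> g \<in> spheroids X p \<and>
     homotopic_with (\<lambda>h. \<forall>s \<in> frontier unit_square. h s = p) (top_of_set unit_square) X f g}"

definition spheroid_join ::
    "(real \<times> real \<Rightarrow> 'a) \<Rightarrow> (real \<times> real \<Rightarrow> 'a) \<Rightarrow> real \<times> real \<Rightarrow> 'a" where
  "spheroid_join f g = (\<lambda>(s, t). if s \<le> 1/2 then f (2 * s, t) else g (2 * s - 1, t))"

definition pi2 :: "'a topology \<Rightarrow> 'a \<Rightarrow> (real \<times> real \<Rightarrow> 'a) set monoid" where
  "pi2 X p = \<lparr>carrier = spheroids X p // spheroid_rel X p,
     mult = (\<lambda>A B. \<Union>f\<in>A. \<Union>g\<in>B. spheroid_rel X p `` {spheroid_join f g}),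
     one = spheroid_rel X p `` {\<lambda>_. p}\<rparr>"

end

(* Splitting C^n along A = H1 \<inter> H2, the complements of A in H1 and H2 and the complement of
   H1 + H2 attaches to each pair a decomposition of the identity into r = 3 (if i = n) or r = 4
   idempotents, continuously. A spheroid therefore lifts to the square as a family of invertible
   matrices that is trivial on three sides and block diagonal on the fourth; the winding numbers
   of the r block determinants along that side add up to zero and classify the spheroid, giving
   Z^(r-1). The classification needs that pi_1 of GL is detected by the determinant and that
   pi_2 of GL vanishes. Both follow from one argument over a compact convex domain of dimension
   at most two: a column of a family of matrices can be moved off a half line by general position
   and then contracted to a basis vector, so the family reduces to diagonal form. *)

theory Submission
  imports Defs
begin

section \<open>Complex matrices\<close>

text \<open>The orbit map from GL to the pairs has block triangular fibres. Taking orthogonal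
  complements reduces these to block diagonal ones, but the resulting idempotents are equivariant
  only under unitary matrices. Homotopies are therefore built by applying the orbit map to arbitrary
  invertible matrices, while spheroids of prescribed class come from unitary families. The
  complements vary continuously because the dimensions of sum and intersection are constant on the
  space. The bounds k < i < 2k make the first three blocks nonempty, and i < n is what creates the
  fourth. Lifting rests on an explicit matrix that intertwines two nearby families of idempotents;
  products of such matrices over a fine subdivision replace a covering homotopy theorem. The winding
  numbers do not depend on the lift, since two lifts differ by block diagonal matrices over the
  whole square.\<close>

lemma matrix_diff_ldistrib: "(A::complex^'n^'m) ** (B - C) = A ** B - A ** C"
  by (simp add: matrix_matrix_mult_def vec_eq_iff algebra_simps sum_subtractf)

lemma matrix_diff_rdistrib: "(B - C) ** (A::complex^'n^'m) = B ** A - C ** A"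
  by (simp add: matrix_matrix_mult_def vec_eq_iff algebra_simps sum_subtractf)

lemma matrix_add_rdistrib: "(B + C) ** (A::complex^'n^'m) = B ** A + C ** A"
  by (simp add: matrix_matrix_mult_def vec_eq_iff algebra_simps sum.distrib)

lemma matrix_sum_ldistrib: "(A::complex^'n^'m) ** (\<Sum>i\<in>S. B i) = (\<Sum>i\<in>S. A ** B i)"
  by (induction S rule: infinite_finite_induct) (simp_all add: matrix_add_ldistrib)

lemma matrix_sum_rdistrib: "(\<Sum>i\<in>S. B i) ** (A::complex^'n^'m) = (\<Sum>i\<in>S. B i ** A)"
  by (induction S rule: infinite_finite_induct) (simp_all add: matrix_add_rdistrib)

lemmas matrix_ring = matrix_add_ldistrib matrix_add_rdistrib matrix_diff_ldistrib matrix_diff_rdistrib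
  matrix_mul_assoc

lemma continuous_on_matrix_mult [continuous_intros]:
  fixes f g :: "'a::topological_space \<Rightarrow> complex^'n^'n"
  assumes "continuous_on S f" "continuous_on S g"
  shows "continuous_on S (\<lambda>x. f x ** g x)"
  unfolding matrix_matrix_mult_def by (intro continuous_intros assms)

lemma continuous_on_matrix_vector_mult [continuous_intros]:
  fixes f :: "'a::topological_space \<Rightarrow> complex^'n^'n"
  assumes "continuous_on S f" "continuous_on S g"
  shows "continuous_on S (\<lambda>x. f x *v g x)"
  unfolding matrix_vector_mult_def by (intro continuous_intros assms)

lemma continuous_on_det [continuous_intros]:
  fixes f :: "'a::topological_space \<Rightarrow> complex^'n^'n"
  assumes "continuous_on S f"
  shows "continuous_on S (\<lambda>x. det (f x))"
  unfolding det_def by (intro continuous_intros assms)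

lemma matrix_inv_mult:
  fixes A :: "complex^'n^'n"
  assumes "invertible A"
  shows matrix_inv_right: "A ** matrix_inv A = mat 1" and matrix_inv_left: "matrix_inv A ** A = mat 1"
proof -
  have "\<exists>B. A ** B = mat 1 \<and> B ** A = mat 1" using assms by (simp add: invertible_def)
  from someI_ex[OF this] show "A ** matrix_inv A = mat 1" "matrix_inv A ** A = mat 1"
    unfolding matrix_inv_def by auto
qed

lemma invertible_1 [simp]: "invertible (mat 1 :: complex^'n^'n)"
  by (simp add: invertible_det_nz)

lemma matrix_inv_1 [simp]: "matrix_inv (mat 1) = (mat 1 :: complex^'n^'n)"
  using matrix_inv_right[OF invertible_1] by simp

lemma invertible_matrix_inv: "invertible (A :: complex^'n^'n) \<Longrightarrow> invertible (matrix_inv A)"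
  using matrix_inv_mult invertible_def by blast

text \<open>Exhibits the entries of the inverse as quotients of determinants, from which continuity
  of inversion is read off.\<close>

lemma matrix_inv_cramer:
  fixes A :: "complex^'n^'n"
  assumes "invertible A"
  shows "matrix_inv A = (\<chi> k l. det (\<chi> i j. if j = k then (mat 1 :: complex^'n^'n)$i$l else A$i$j) / det A)"
proof -
  have *: "column l (matrix_inv A) = (\<chi> k. det (\<chi> i j. if j = k then (mat 1 :: complex^'n^'n)$i$l else A$i$j) / det A)" for l
  proof -
    have "A *v column l (matrix_inv A) = (\<chi> i. (mat 1 :: complex^'n^'n)$i$l)"
      using matrix_inv_right[OF assms] unfolding vec_eq_iff
      by (simp add: matrix_vector_mult_def matrix_matrix_mult_def column_def)
    then show ?thesis
      by (subst (asm) cramer) (use assms in \<open>simp_all add: invertible_det_nz column_def cong: if_cong\<close>)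
  qed
  show ?thesis
    unfolding vec_eq_iff
  proof (intro allI)
    fix k l
    show "matrix_inv A $ k $ l = (\<chi> k l. det (\<chi> i j. if j = k then (mat 1 :: complex^'n^'n)$i$l else A$i$j) / det A) $ k $ l"
      using arg_cong[OF *[of l], of "\<lambda>v. v $ k"] by (simp add: column_def)
  qed
qed

lemma continuous_on_matrix_inv [continuous_intros]:
  fixes f :: "'a::topological_space \<Rightarrow> complex^'n^'n"
  assumes "continuous_on S f" and inv: "\<And>x. x \<in> S \<Longrightarrow> invertible (f x)"
  shows "continuous_on S (\<lambda>x. matrix_inv (f x))"
proof -
  have "continuous_on S (\<lambda>x. (\<chi> k l. det (\<chi> i j. if j = k then (mat 1 :: complex^'n^'n)$i$l else f x$i$j) / det (f x)) :: complex^'n^'n)"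
  proof (intro continuous_on_vec_lambda continuous_on_divide continuous_on_det assms(1))
    fix k l i j
    show "continuous_on S (\<lambda>x. if j = k then (mat 1 :: complex^'n^'n)$i$l else f x$i$j)"
      by (cases "j = k") (auto intro!: continuous_intros assms(1))
  qed (use inv in \<open>auto simp: invertible_det_nz\<close>)
  then show ?thesis
    by (rule continuous_on_eq) (simp add: inv matrix_inv_cramer)
qed

subsection \<open>Adjoints and rank one matrices\<close>

definition adj :: "complex^'n^'n \<Rightarrow> complex^'n^'n" where
  "adj A = (\<chi> i j. cnj (A $ j $ i))"

lemma adj_mult: "adj (A ** B) = adj B ** adj A"
  by (simp add: adj_def matrix_matrix_mult_def vec_eq_iff cnj_sum mult.commute)

lemma adj_adj [simp]: "adj (adj A) = A"
  by (simp add: adj_def vec_eq_iff)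

lemma adj_zero [simp]: "adj 0 = 0"
  by (simp add: adj_def vec_eq_iff)

lemma adj_add [simp]: "adj (A + B) = adj A + adj B"
  by (simp add: adj_def vec_eq_iff)

lemma adj_diff [simp]: "adj (A - B) = adj A - adj B"
  by (simp add: adj_def vec_eq_iff)

lemma adj_mat_1 [simp]: "adj (mat 1) = mat 1"
  by (auto simp: adj_def vec_eq_iff mat_def)

text \<open>The standard Hermitian inner product, conjugate linear in the first argument.\<close>

definition hip :: "complex^'n \<Rightarrow> complex^'n \<Rightarrow> complex" where
  "hip x y = (\<Sum>i\<in>UNIV. cnj (x $ i) * y $ i)"

lemma hip_self: "hip x x = of_real ((norm x)\<^sup>2)"
proof -
  have "hip x x = (\<Sum>i\<in>UNIV. of_real ((norm (x$i))\<^sup>2))"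
    unfolding hip_def by (intro sum.cong refl) (metis complex_norm_square mult.commute)
  also have "\<dots> = of_real (\<Sum>i\<in>UNIV. (norm (x$i))\<^sup>2)" by simp
  also have "(\<Sum>i\<in>UNIV. (norm (x$i))\<^sup>2) = (norm x)\<^sup>2"
    by (simp add: norm_vec_def L2_set_def sum_nonneg)
  finally show ?thesis .
qed

lemma hip_self_eq_0 [simp]: "hip x x = 0 \<longleftrightarrow> x = 0"
  by (simp add: hip_self)

lemma hip_adj: "hip x (A *v y) = hip (adj A *v x) y"
proof -
  have "hip x (A *v y) = (\<Sum>i\<in>UNIV. \<Sum>j\<in>UNIV. cnj (x$i) * (A$i$j * y$j))"
    by (simp add: hip_def matrix_vector_mult_def sum_distrib_left)
  also have "\<dots> = (\<Sum>j\<in>UNIV. \<Sum>i\<in>UNIV. cnj (x$i) * (A$i$j * y$j))"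
    by (rule sum.swap)
  also have "\<dots> = hip (adj A *v x) y"
    by (simp add: hip_def matrix_vector_mult_def adj_def sum_distrib_left sum_distrib_right cnj_sum mult_ac)
  finally show ?thesis .
qed

lemma hip_add_right: "hip x (y + z) = hip x y + hip x z"
  by (simp add: hip_def algebra_simps sum.distrib)

lemma hip_scale_right: "hip x (k *s y) = k * hip x y"
  by (simp add: hip_def sum_distrib_left mult_ac)

lemma hip_zero [simp]: "hip 0 y = 0" "hip x 0 = 0"
  by (simp_all add: hip_def)

lemma continuous_on_hip [continuous_intros]:
  "continuous_on S f \<Longrightarrow> continuous_on S g \<Longrightarrow> continuous_on S (\<lambda>x. hip (f x) (g x))"
  unfolding hip_def by (intro continuous_intros)

text \<open>The outer product of x with the conjugate of y; for a unit vector w,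
  \<open>rk1 w w\<close> is the orthogonal projection onto its line.\<close>

definition rk1 :: "complex^'n \<Rightarrow> complex^'n \<Rightarrow> complex^'n^'n" where
  "rk1 x y = (\<chi> i j. x $ i * cnj (y $ j))"

lemma rk1_vec: "rk1 x y *v z = hip y z *s x"
  by (simp add: rk1_def hip_def matrix_vector_mult_def vec_eq_iff sum_distrib_left mult_ac)

lemma adj_rk1 [simp]: "adj (rk1 x y) = rk1 y x"
  by (simp add: adj_def rk1_def vec_eq_iff mult.commute)

lemma rk1_mult: "rk1 x y ** rk1 z w = rk1 (hip y z *s x) w"
  by (simp add: rk1_def hip_def matrix_matrix_mult_def vec_eq_iff sum_distrib_left sum_distrib_right mult_ac)

lemma mult_rk1: "A ** rk1 x y = rk1 (A *v x) y"
  by (simp add: rk1_def matrix_vector_mult_def matrix_matrix_mult_def vec_eq_iff sum_distrib_left sum_distrib_right mult_ac)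

lemma trace_rk1: "trace (rk1 x y) = hip y x"
  by (simp add: trace_def rk1_def hip_def mult.commute)

lemma continuous_on_rk1 [continuous_intros]:
  "continuous_on S f \<Longrightarrow> continuous_on S g \<Longrightarrow> continuous_on S (\<lambda>x. rk1 (f x) (g x))"
  unfolding rk1_def by (intro continuous_intros)

text \<open>The norm of a matrix is the Frobenius norm, so estimates for projections become
  identities between traces.\<close>

lemma norm_matrix_trace: "complex_of_real ((norm A)\<^sup>2) = trace (adj A ** A)"
proof -
  have "(norm A)\<^sup>2 = (\<Sum>i\<in>UNIV. \<Sum>j\<in>UNIV. (norm (A$i$j))\<^sup>2)"
    by (simp add: norm_vec_def L2_set_def sum_nonneg)
  then have "complex_of_real ((norm A)\<^sup>2) = (\<Sum>i\<in>UNIV. \<Sum>j\<in>UNIV. cnj (A$i$j) * A$i$j)"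
    by (simp only: of_real_sum complex_norm_square mult.commute)
  also have "\<dots> = trace (adj A ** A)"
    unfolding trace_def adj_def matrix_matrix_mult_def by simp (rule sum.swap)
  finally show ?thesis .
qed

section \<open>Orthogonal projections\<close>

definition is_proj :: "complex^'n^'n \<Rightarrow> (complex^'n) set \<Rightarrow> bool" where
  "is_proj P H \<longleftrightarrow> adj P = P \<and> P ** P = P \<and> range ((*v) P) = H"

lemma is_proj_fixes: "is_proj P H \<Longrightarrow> x \<in> H \<longleftrightarrow> P *v x = x"
  unfolding is_proj_def by (metis (no_types, lifting) image_iff matrix_vector_mul_assoc rangeI)

lemma is_proj_mult_eq:
  assumes "is_proj P H" "is_proj Q K" "K \<subseteq> H"
  shows "P ** Q = Q" "Q ** P = Q"
proof -
  show *: "P ** Q = Q"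
    unfolding matrix_eq matrix_vector_mul_assoc[symmetric]
    using assms(2,3) is_proj_fixes[OF assms(1)] by (auto simp: is_proj_def)
  have "adj (P ** Q) = Q ** P"
    using assms by (simp add: adj_mult is_proj_def)
  then show "Q ** P = Q"
    using * assms(2) by (simp add: is_proj_def)
qed

lemma is_proj_unique: "is_proj P H \<Longrightarrow> is_proj Q H \<Longrightarrow> P = Q"
  using is_proj_mult_eq[of P H Q H] is_proj_mult_eq[of Q H P H] by simp

text \<open>Gram-Schmidt: a new vector b contributes the rank one projection \<open>R\<close> onto
  the line of \<open>w\<close>, the component of b orthogonal to the span so far. The trace grows by
  1 exactly when the dimension does.\<close>

lemma is_proj_span_exists:
  assumes "finite (B :: (complex^'n) set)"
  shows "\<exists>P. is_proj P (vec.span B) \<and> trace P = of_nat (vec.dim B)"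
  using assms
proof (induction B rule: finite_induct)
  case empty
  have "is_proj (0 :: complex^'n^'n) (vec.span {})"
    by (auto simp: is_proj_def image_def)
  then show ?case by (intro exI[of _ 0]) (simp add: trace_def)
next
  case (insert b B)
  then obtain P where P: "is_proj P (vec.span B)" "trace P = of_nat (vec.dim B)" by blast
  show ?case
  proof (cases "b \<in> vec.span B")
    case True
    then have "vec.span (insert b B) = vec.span B" by (simp add: vec.span_redundant)
    then show ?thesis using P True by (metis vec.dim_span)
  next
    case False
    define w where "w = b - P *v b"
    have PP: "adj P = P" "P ** P = P" "range ((*v) P) = vec.span B" using P by (auto simp: is_proj_def)
    have Pw: "P *v w = 0"
      by (simp add: w_def matrix_vector_mult_diff_distrib matrix_vector_mul_assoc PP)
    have w0: "w \<noteq> 0"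
      using False is_proj_fixes[OF P(1), of b] by (auto simp: w_def)
    define c where "c = hip w w"
    have c0: "c \<noteq> 0" using w0 by (simp add: c_def)
    have cr: "cnj c = c" by (simp add: c_def hip_self)
    define R where "R = rk1 ((1/c) *s w) w"
    have Radj: "adj R = R"
      using cr by (simp add: R_def rk1_def adj_def vec_eq_iff)
    have RR: "R ** R = R"
      using c0 by (simp add: R_def rk1_mult hip_scale_right flip: c_def)
    have PR: "P ** R = 0"
      unfolding R_def mult_rk1 vector_scalar_commute Pw by (simp add: rk1_def vec_eq_iff)
    have RP: "R ** P = 0"
      using arg_cong[OF PR, of adj] by (simp add: adj_mult Radj PP)
    have wb: "hip w b = c"
      using hip_adj[of w P b] Pw by (simp add: c_def w_def hip_add_right[of _ "b - P *v b" "P *v b", simplified] PP)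
    have rng: "range ((*v) (P + R)) = vec.span (insert b B)"
    proof (intro equalityI subsetI)
      fix y assume "y \<in> range ((*v) (P + R))"
      then obtain x where y: "y = P *v x + R *v x" by (auto simp: matrix_vector_mult_add_rdistrib)
      have sub: "vec.span B \<subseteq> vec.span (insert b B)" by (simp add: vec.span_mono subset_insertI)
      have "P *v x \<in> vec.span B" "P *v b \<in> vec.span B" using PP by auto
      moreover have "b \<in> vec.span (insert b B)" by (simp add: vec.span_base)
      ultimately have "P *v x \<in> vec.span (insert b B)" "w \<in> vec.span (insert b B)"
        using sub unfolding w_def by (auto intro!: vec.span_diff)
      then show "y \<in> vec.span (insert b B)"
        unfolding y R_def rk1_vec by (intro vec.span_add vec.span_scale)
    next
      fix y assume "y \<in> vec.span (insert b B)"
      then obtain k where "y - k *s b \<in> vec.span B"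
        by (auto simp: vec.span_insert)
      then have 1: "P *v (y - k *s b) = y - k *s b" using is_proj_fixes[OF P(1)] by blast
      have "R *v (y - k *s b) = 0"
        by (metis (no_types) "1" RP matrix_vector_mul_assoc matrix_vector_mult_0)
      then have "(P + R) *v (y - k *s b) = y - k *s b" using 1 by (simp add: matrix_vector_mult_add_rdistrib)
      moreover have "(P + R) *v b = b"
        using c0 by (simp add: matrix_vector_mult_add_rdistrib R_def rk1_vec wb) (simp add: w_def)
      ultimately have "(P + R) *v y = y"
        by (metis (no_types, lifting) diff_add_cancel matrix_vector_right_distrib vector_scalar_commute)
      then show "y \<in> range ((*v) (P + R))" by (metis rangeI)
    qed
    have "is_proj (P + R) (vec.span (insert b B))"
      using rng by (simp add: is_proj_def PP Radj RR PR RP matrix_ring)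
    moreover have "trace (P + R) = of_nat (vec.dim (insert b B))"
    proof -
      have "trace R = 1" using c0 by (simp add: R_def trace_rk1 hip_scale_right flip: c_def)
      then show ?thesis using P(2) False by (simp add: trace_add vec.dim_insert)
    qed
    ultimately show ?thesis by blast
  qed
qed

definition proj :: "(complex^'n) set \<Rightarrow> complex^'n^'n" where
  "proj H = (THE P. is_proj P H)"

lemma proj_eqI: "is_proj P H \<Longrightarrow> proj H = P"
  unfolding proj_def using is_proj_unique by blast

lemma
  assumes "vec.subspace (H :: (complex^'n) set)"
  shows is_proj_proj: "is_proj (proj H) H" and trace_proj: "trace (proj H) = of_nat (vec.dim H)"
proof -
  obtain B where B: "B \<subseteq> H" "vec.independent B" "H \<subseteq> vec.span B" "card B = vec.dim H"
    using vec.basis_exists by blast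
  have "finite B" using B(2) vec.finiteI_independent by blast
  moreover have "vec.span B = H" using B(1,3) assms vec.span_minimal by blast
  ultimately obtain P where "is_proj P H" "trace P = of_nat (vec.dim H)"
    using is_proj_span_exists by (metis vec.dim_span)
  then show "is_proj (proj H) H" "trace (proj H) = of_nat (vec.dim H)"
    using proj_eqI by auto
qed

text \<open>In terms of traces the left side is tr P + tr Q - 2 tr PQ, and the squared norm on the
  right is tr Q - tr PQ; equal traces give the factor 2.\<close>

lemma norm_proj_diff:
  fixes P Q :: "complex^'n^'n"
  assumes "adj P = P" "P ** P = P" "adj Q = Q" "Q ** Q = Q" "trace P = trace Q"
  shows "(norm (P - Q))\<^sup>2 = 2 * (norm (Q - P ** Q))\<^sup>2"
proof -
  have QPQ: "trace (Q ** P ** Q) = trace (P ** Q)"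
    by (metis assms(4) matrix_mul_assoc trace_mul_sym)
  have "Q ** P ** P ** Q = Q ** P ** Q" by (metis assms(2) matrix_mul_assoc)
  moreover have "P ** P ** Q = P ** Q" by (simp add: assms)
  ultimately have "complex_of_real ((norm (P - Q))\<^sup>2) = complex_of_real (2 * (norm (Q - P ** Q))\<^sup>2)"
    using assms QPQ trace_mul_sym[of P Q]
    by (simp only: norm_matrix_trace of_real_mult adj_diff adj_mult matrix_ring trace_sub trace_add) simp
  then show ?thesis by (simp only: of_real_eq_iff)
qed

text \<open>Pythagoras for the orthogonal parts \<open>P ** R\<close> and
  \<open>R - P ** R\<close>.\<close>

lemma norm_proj_complement_le:
  fixes P R :: "complex^'n^'n"
  assumes "adj P = P" "P ** P = P"
  shows "norm (R - P ** R) \<le> norm R"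
proof -
  have 1: "adj (P ** R) ** (P ** R) = adj R ** P ** R"
    by (metis (no_types, lifting) assms adj_mult matrix_mul_assoc)
  have 2: "adj R ** P ** P ** R = adj R ** P ** R"
    by (metis (no_types, lifting) assms matrix_mul_assoc)
  have "complex_of_real ((norm (R - P ** R))\<^sup>2 + (norm (P ** R))\<^sup>2) = complex_of_real ((norm R)\<^sup>2)"
    unfolding of_real_add norm_matrix_trace 1
    by (simp add: adj_mult matrix_ring trace_sub trace_add assms 2)
  then have "(norm (R - P ** R))\<^sup>2 + (norm (P ** R))\<^sup>2 = (norm R)\<^sup>2"
    by (simp only: of_real_eq_iff)
  then have "(norm (R - P ** R))\<^sup>2 \<le> (norm R)\<^sup>2" by (smt (verit) zero_le_power2)
  then show ?thesis by (simp add: power2_le_iff_abs_le)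
qed

text \<open>A family of subspaces of constant dimension is continuous as soon as it is lower
  semicontinuous: for projections of equal rank \<open>\<parallel>P - Q\<parallel>\<close> is controlled by \<open>\<parallel>(1 - P) Q\<parallel>\<close> alone,
  because the Frobenius norms of \<open>(1 - P) Q\<close> and \<open>(1 - Q) P\<close> agree.\<close>

lemma continuous_map_proj:
  fixes S :: "'x \<Rightarrow> (complex^'n) set"
  assumes sub: "\<And>x. x \<in> topspace X \<Longrightarrow> vec.subspace (S x) \<and> vec.dim (S x) = m"
    and ext: "\<And>x y. x \<in> topspace X \<Longrightarrow> y \<in> S x \<Longrightarrow>
        \<exists>b. continuous_map X euclidean b \<and> b x = y \<and> (\<forall>z\<in>topspace X. b z \<in> S z)"
  shows "continuous_map X euclidean (\<lambda>x. proj (S x))"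
  unfolding mtopology_is_euclidean[symmetric] Met_TC.continuous_map_to_metric
proof (intro ballI allI impI)
  fix x and e :: real assume x: "x \<in> topspace X" and e: "e > 0"
  define Q where "Q = proj (S x)"
  have Q: "is_proj Q (S x)" "trace Q = of_nat m"
    using sub[OF x] is_proj_proj trace_proj unfolding Q_def by auto
  have "\<forall>l. \<exists>b. continuous_map X euclidean b \<and> b x = Q *v axis l 1 \<and> (\<forall>z\<in>topspace X. b z \<in> S z)"
    using Q(1) by (intro allI ext x) (auto simp: is_proj_def)
  then obtain b where b: "\<And>l. continuous_map X euclidean (b l)" "\<And>l. b l x = Q *v axis l 1"
      "\<And>l z. z \<in> topspace X \<Longrightarrow> b l z \<in> S z" by metis
  \<comment> \<open>A continuous matrix function whose columns at z lie in \<open>S z\<close> and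
    which equals the projection \<open>Q\<close> at x.\<close>
  define B where "B z = (\<Sum>l\<in>UNIV. rk1 (b l z) (axis l 1))" for z
  have contB: "continuous_map X euclidean B"
    unfolding B_def
  proof (intro continuous_map_sum)
    fix l :: 'n
    have "continuous_map euclidean euclidean (\<lambda>v. rk1 v (axis l 1) :: complex^'n^'n)"
      by (simp add: continuous_on_rk1)
    from continuous_map_compose[OF b(1)[of l] this]
    show "continuous_map X euclidean (\<lambda>z. rk1 (b l z) (axis l 1))" by (simp add: o_def)
  qed simp
  have ax: "(\<Sum>l\<in>UNIV. rk1 (axis l 1) (axis l 1)) = (mat 1 :: complex^'n^'n)"
  proof -
    have "rk1 (axis l 1) (axis l 1) $ i $ j = (if l = i then if i = j then 1 else 0 else (0::complex))" for l i j :: 'n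
      by (auto simp: rk1_def axis_def)
    then show ?thesis by (simp add: vec_eq_iff mat_def)
  qed
  have Bx: "B x = Q"
    by (simp add: B_def b(2) mult_rk1[symmetric] matrix_sum_ldistrib[symmetric] ax)
  define U where "U = {z \<in> topspace X. B z \<in> ball Q (e/2)}"
  have "openin X U"
    unfolding U_def by (rule openin_continuous_map_preimage[OF contB]) simp
  moreover have "x \<in> U" using x e Bx by (simp add: U_def)
  moreover have "proj (S z) \<in> Met_TC.mball (proj (S x)) e" if z: "z \<in> U" for z
  proof -
    have zX: "z \<in> topspace X" using z by (simp add: U_def)
    define P where "P = proj (S z)"
    have P: "is_proj P (S z)" "trace P = of_nat m"
      using sub[OF zX] is_proj_proj trace_proj unfolding P_def by auto
    have "P ** B z = B z"
      using b(3)[OF zX] is_proj_fixes[OF P(1)] by (simp add: B_def matrix_sum_ldistrib mult_rk1)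
    \<comment> \<open>\<open>P\<close> fixes the columns of \<open>B z\<close>, so the complement of
      \<open>P\<close> annihilates \<open>B z\<close> and \<open>Q\<close> may be replaced by the
      small difference \<open>Q - B z\<close>.\<close>
    then have "Q - P ** Q = (Q - B z) - P ** (Q - B z)" by (simp add: matrix_ring)
    then have "norm (Q - P ** Q) \<le> norm (Q - B z)"
      using norm_proj_complement_le P(1) by (metis is_proj_def)
    also have "\<dots> < e/2" using z by (simp add: U_def dist_norm)
    finally have "norm (Q - P ** Q) < e/2" .
    then have "2 * (norm (Q - P ** Q))\<^sup>2 < 2 * (e/2)\<^sup>2"
      by (simp add: power_strict_mono)
    moreover have "(norm (P - Q))\<^sup>2 = 2 * (norm (Q - P ** Q))\<^sup>2"
      using P Q by (intro norm_proj_diff) (auto simp: is_proj_def)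
    ultimately have "(norm (P - Q))\<^sup>2 < e\<^sup>2"
      using e by (simp add: power2_eq_square)  (smt (verit) mult_pos_pos)
    then have "norm (P - Q) < e" using e by (simp add: power_less_imp_less_base)
    then show ?thesis by (simp add: P_def Q_def dist_norm norm_minus_commute)
  qed
  ultimately show "\<exists>U. openin X U \<and> x \<in> U \<and> (\<forall>y\<in>U. proj (S y) \<in> Met_TC.mball (proj (S x)) e)" by blast
qed

section \<open>Transport along a path of small steps\<close>

text \<open>Nodes are cut off at t: once a node passes t, the remaining factors are
  \<open>T z t t\<close>, which is the identity in the application. This makes the product
  continuous in t across the nodes.\<close>

primrec step_product :: "('z \<Rightarrow> real \<Rightarrow> real \<Rightarrow> complex^'n^'n) \<Rightarrow> nat \<Rightarrow> nat \<Rightarrow> 'z \<Rightarrow> real \<Rightarrow> complex^'n^'n" where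
  "step_product T N 0 z t = mat 1"
| "step_product T N (Suc j) z t =
     T z (min t (real (Suc j) / real N)) (min t (real j / real N)) ** step_product T N j z t"

text \<open>\<open>R z s t A\<close> is to be read as: A carries the data at time t to the data at
  time s. It is instantiated both for moving a vector and for intertwining idempotents. A single
  step is invertible only near the diagonal; compactness makes this uniform, so finitely many steps
  suffice for all z at once.\<close>

lemma transport:
  fixes T :: "'z::metric_space \<Rightarrow> real \<Rightarrow> real \<Rightarrow> complex^'n^'n"
  assumes Z: "compact Z"
    and cont: "continuous_on (Z \<times> {0..1} \<times> {0..1}) (\<lambda>(z,s,t). T z s t)"
    and diag: "\<And>z t. z \<in> Z \<Longrightarrow> t \<in> {0..1} \<Longrightarrow> T z t t = mat 1"
    and R_refl: "\<And>z t. z \<in> Z \<Longrightarrow> t \<in> {0..1} \<Longrightarrow> R z t t (mat 1)"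
    and R_step: "\<And>z s t. z \<in> Z \<Longrightarrow> s \<in> {0..1} \<Longrightarrow> t \<in> {0..1} \<Longrightarrow> R z s t (T z s t)"
    and R_trans: "\<And>z s t u A B. z \<in> Z \<Longrightarrow> s \<in> {0..1} \<Longrightarrow> t \<in> {0..1} \<Longrightarrow> u \<in> {0..1} \<Longrightarrow>
        R z s t A \<Longrightarrow> R z t u B \<Longrightarrow> R z s u (A ** B)"
  obtains g where "continuous_on (Z \<times> {0..1}) (\<lambda>(z,t). g z t)"
    "\<And>z t. z \<in> Z \<Longrightarrow> t \<in> {0..1} \<Longrightarrow> invertible (g z t)"
    "\<And>z. z \<in> Z \<Longrightarrow> g z 0 = mat 1"
    "\<And>z t. z \<in> Z \<Longrightarrow> t \<in> {0..1} \<Longrightarrow> R z t 0 (g z t)"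
proof -
  let ?K = "Z \<times> {0..1::real} \<times> {0..1::real}"
  have "compact ?K" by (intro compact_Times Z compact_Icc)
  moreover have "continuous_on ?K (\<lambda>p. det ((\<lambda>(z,s,t). T z s t) p))"
    by (rule continuous_on_det[OF cont])
  ultimately have "uniformly_continuous_on ?K (\<lambda>p. det ((\<lambda>(z,s,t). T z s t) p))"
    by (rule compact_uniformly_continuous[rotated])
  then obtain d where d: "d > 0" "\<And>p q. p \<in> ?K \<Longrightarrow> q \<in> ?K \<Longrightarrow> dist q p < d \<Longrightarrow>
      dist (det ((\<lambda>(z,s,t). T z s t) q)) (det ((\<lambda>(z,s,t). T z s t) p)) < 1"
    unfolding uniformly_continuous_on_def by (metis zero_less_one)
  have small: "invertible (T z s t)" if "z \<in> Z" "s \<in> {0..1}" "t \<in> {0..1}" "\<bar>s - t\<bar> < d" for z s t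
  proof -
    have "dist (z,s,t) (z,t,t) < d" using that by (simp add: dist_Pair_Pair dist_real_def)
    then have "dist (det (T z s t)) (det (T z t t)) < 1" using d(2)[of "(z,t,t)" "(z,s,t)"] that by simp
    then have "dist (det (T z s t)) 1 < 1" using diag that by simp
    then show ?thesis unfolding invertible_det_nz by auto
  qed
  obtain N where N: "N > 0" "inverse (real N) < d"
    using d(1) by (metis ex_inverse_of_nat_less)
  define m where "m t j = min t (real j / real N)" for t j
  have m01: "m t j \<in> {0..1}" if "t \<in> {0..1}" for t j using that by (auto simp: m_def)
  have mstep: "\<bar>m t (Suc j) - m t j\<bar> < d" for t j
  proof -
    have "real (Suc j) / real N = real j / real N + inverse (real N)"
      by (simp add: add_divide_distrib inverse_eq_divide)
    then show ?thesis using N(2) d(1) N(1) unfolding m_def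
      by (smt (verit) inverse_nonnegative_iff_nonnegative of_nat_0_le_iff)
  qed
  define g where "g = step_product T N"
  have g_simps: "g 0 z t = mat 1" "g (Suc j) z t = T z (m t (Suc j)) (m t j) ** g j z t" for j z t
    by (simp_all add: g_def m_def)
  have contg: "continuous_on (Z \<times> {0..1}) (\<lambda>(z,t). g j z t)" for j
  proof (induction j)
    case 0 show ?case by (simp add: g_simps case_prod_unfold)
  next
    case (Suc j)
    have "continuous_on (Z \<times> {0..1}) (\<lambda>p. (\<lambda>(z,s,t). T z s t) (fst p, m (snd p) (Suc j), m (snd p) j))"
    proof (rule continuous_on_compose2[OF cont])
      show "continuous_on (Z \<times> {0..1}) (\<lambda>p. (fst p, m (snd p) (Suc j), m (snd p) j))"
        unfolding m_def by (intro continuous_intros)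
      show "(\<lambda>p. (fst p, m (snd p) (Suc j), m (snd p) j)) ` (Z \<times> {0..1}) \<subseteq> ?K"
        using m01 by auto
    qed
    from continuous_on_matrix_mult[OF this Suc] show ?case
      by (simp add: g_simps case_prod_unfold)
  qed
  have invg: "invertible (g j z t)" if "z \<in> Z" "t \<in> {0..1}" for j z t
  proof (induction j)
    case 0 show ?case using matrix_left_right_inverse by (auto simp: g_simps invertible_def)
  next
    case (Suc j) then show ?case
      unfolding g_simps by (intro invertible_mult small that m01 mstep)
  qed
  have Rg: "R z (m t j) 0 (g j z t)" if z: "z \<in> Z" and t: "t \<in> {0..1}" for j z t
  proof (induction j)
    case 0
    have "m t 0 = 0" using t by (simp add: m_def)
    then show ?case using R_refl[OF z, of 0] by (simp add: g_simps)
  next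
    case (Suc j) 
    show ?case unfolding g_simps
      by (rule R_trans[OF z m01[OF t] m01[OF t] _ R_step[OF z m01[OF t] m01[OF t]] Suc]) simp
  qed
  have g0: "g j z 0 = mat 1" if "z \<in> Z" for j z
  proof (induction j)
    case 0 show ?case by (simp add: g_simps)
  next
    case (Suc j)
    have "m 0 i = 0" for i by (simp add: m_def)
    then show ?case using Suc diag[OF that, of 0] by (simp add: g_simps)
  qed
  have mN: "m t N = t" if "t \<in> {0..1}" for t using that N(1) by (simp add: m_def)
  show thesis
    by (rule that[of "g N", OF contg invg g0]) (use Rg[of _ _ N] mN in auto)
qed

section \<open>Homotopies relative to a subset\<close>

abbreviation rel_homotopic ::
    "'a::topological_space set \<Rightarrow> 'b::topological_space \<Rightarrow> 'a set \<Rightarrow> 'b set \<Rightarrow> ('a \<Rightarrow> 'b) \<Rightarrow> ('a \<Rightarrow> 'b) \<Rightarrow> bool" where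
  "rel_homotopic B c D Y f g \<equiv> homotopic_with (\<lambda>k. \<forall>x\<in>B. k x = c) (top_of_set D) (top_of_set Y) f g"

lemma rel_homotopicI:
  fixes h :: "real \<times> 'a::topological_space \<Rightarrow> 'b::topological_space"
  assumes "continuous_on ({0..1} \<times> D) h" "\<And>t x. t \<in> {0..1} \<Longrightarrow> x \<in> D \<Longrightarrow> h (t,x) \<in> Y"
    "\<And>x. x \<in> D \<Longrightarrow> h (0,x) = f x" "\<And>x. x \<in> D \<Longrightarrow> h (1,x) = g x"
    "\<And>t x. t \<in> {0..1} \<Longrightarrow> x \<in> B \<Longrightarrow> h (t,x) = c" "B \<subseteq> D"
  shows "rel_homotopic B c D Y f g"
proof (subst homotopic_with)
  fix k l :: "'a \<Rightarrow> 'b"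
  assume "\<And>x. x \<in> topspace (top_of_set D) \<Longrightarrow> k x = l x"
  then show "(\<forall>x\<in>B. k x = c) = (\<forall>x\<in>B. l x = c)" using assms(6) by (metis subsetD topspace_euclidean_subtopology)
next
  show "\<exists>h. continuous_map (prod_topology (top_of_set {0..1::real}) (top_of_set D)) (top_of_set Y) h \<and>
      (\<forall>x\<in>topspace (top_of_set D). h (0, x) = f x) \<and> (\<forall>x\<in>topspace (top_of_set D). h (1, x) = g x) \<and>
      (\<forall>t\<in>{0..1}. \<forall>x\<in>B. h (t, x) = c)"
    using assms by (intro exI[of _ h]) (auto simp: continuous_map_in_subtopology)
qed

lemma rel_homotopicE:
  fixes f :: "'a::topological_space \<Rightarrow> 'b::topological_space"
  assumes "rel_homotopic B c D Y f g"
  obtains h :: "real \<times> 'a \<Rightarrow> 'b" where "continuous_on ({0..1} \<times> D) h" "\<And>t x. t \<in> {0..1} \<Longrightarrow> x \<in> D \<Longrightarrow> h (t,x) \<in> Y"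
    "\<And>x. h (0,x) = f x" "\<And>x. h (1,x) = g x"
    "\<And>t x. t \<in> {0..1} \<Longrightarrow> x \<in> B \<Longrightarrow> h (t,x) = c"
proof -
  obtain h :: "real \<times> 'a \<Rightarrow> 'b" where "continuous_on ({0..1} \<times> D) h" "h \<in> {0..1} \<times> D \<rightarrow> Y"
    "\<forall>x. h (0,x) = f x" "\<forall>x. h (1,x) = g x" "\<forall>t\<in>{0..1}. \<forall>x\<in>B. h (t,x) = c"
    using assms unfolding homotopic_with_def by (auto simp: continuous_map_in_subtopology)
  then show thesis by (intro that[of h]) auto
qed

lemma rel_homotopic_linear:
  fixes f g :: "'a::topological_space \<Rightarrow> 'b::real_normed_vector"
  assumes "continuous_on D f" "continuous_on D g" "B \<subseteq> D"
    "\<And>x. x \<in> B \<Longrightarrow> f x = c" "\<And>x. x \<in> B \<Longrightarrow> g x = c"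
    "\<And>t x. t \<in> {0..1} \<Longrightarrow> x \<in> D \<Longrightarrow> (1 - t) *\<^sub>R f x + t *\<^sub>R g x \<in> Y"
  shows "rel_homotopic B c D Y f g"
proof (rule rel_homotopicI[where h = "\<lambda>p. (1 - fst p) *\<^sub>R f (snd p) + fst p *\<^sub>R g (snd p)"])
  show "continuous_on ({0..1} \<times> D) (\<lambda>p. (1 - fst p) *\<^sub>R f (snd p) + fst p *\<^sub>R g (snd p))"
    by (intro continuous_intros continuous_on_compose2[OF assms(1)] continuous_on_compose2[OF assms(2)]) auto
qed (use assms in \<open>auto simp: scaleR_left_distrib[symmetric]\<close>)

section \<open>Maps of surfaces into punctured complex space\<close>

text \<open>A polynomial approximation maps the lower dimensional source to a null set, so an
  arbitrarily small translation frees the image from the origin.\<close>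

lemma perturb_avoid_origin:
  fixes q :: "'a::euclidean_space \<Rightarrow> 'b::euclidean_space"
  assumes dim: "DIM('a) < DIM('b)" and D: "compact D" and q: "continuous_on D q" and e: "e > 0"
  obtains q' where "continuous_on D q'" "\<And>x. x \<in> D \<Longrightarrow> norm (q' x - q x) < e" "\<And>x. x \<in> D \<Longrightarrow> q' x \<noteq> 0"
proof -
  obtain p where p: "polynomial_function p" "\<And>x. x \<in> D \<Longrightarrow> norm (q x - p x) < e/2"
    using Stone_Weierstrass_polynomial_function[OF D q, of "e/2"] e by auto
  have "negligible (p ` D)"
    by (rule negligible_differentiable_image_lowdim[OF dim differentiable_on_polynomial_function[OF p(1)]])
  moreover have "\<not> negligible (ball (0::'b) (e/2))"
    using e by (intro open_not_negligible) auto
  ultimately obtain c where c: "norm c < e/2" "c \<notin> p ` D"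
    by (metis mem_ball_0 negligible_subset subsetI)
  show thesis
  proof (rule that[of "\<lambda>x. p x - c"])
    show "continuous_on D (\<lambda>x. p x - c)"
      by (intro continuous_intros continuous_on_polymonial_function p)
    show "norm (p x - c - q x) < e" if "x \<in> D" for x
      using p(2)[OF that] c(1) norm_triangle_ineq4[of "p x - q x" c] norm_minus_commute[of "q x" "p x"]
      by (simp add: algebra_simps)
  qed (use c in auto)
qed

lemma norm_axis: "norm (axis a c :: complex^'n) = norm c"
proof -
  have "(\<Sum>i\<in>UNIV. (norm (axis a c $ i))\<^sup>2) = (\<Sum>i\<in>UNIV. if a = i then (norm c)\<^sup>2 else 0)"
    by (intro sum.cong) (auto simp: axis_def)
  then show ?thesis by (simp add: norm_vec_def L2_set_def)
qed

text \<open>Real codimension three: a map of a surface can be moved off the half line opposite to the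
  base vector by perturbing the imaginary part of one coordinate and one further coordinate.\<close>

lemma punctured_space_rel_nullhomotopic:
  fixes v :: "'a::euclidean_space \<Rightarrow> complex^'n"
  assumes dim: "DIM('a) \<le> 2" and D: "compact D" and v: "continuous_on D v"
    and v0: "\<And>x. x \<in> D \<Longrightarrow> v x \<noteq> 0" and supp: "\<And>x i. x \<in> D \<Longrightarrow> i \<notin> S \<Longrightarrow> v x $ i = 0"
    and ab: "a \<in> S" "b \<in> S" "a \<noteq> b" and B: "B \<subseteq> D" "\<And>x. x \<in> B \<Longrightarrow> v x = axis a 1"
  shows "rel_homotopic B (axis a 1) D {y. y \<noteq> 0 \<and> (\<forall>i. i \<notin> S \<longrightarrow> y $ i = 0)} v (\<lambda>_. axis a 1)"
    (is "rel_homotopic _ _ _ ?Y _ _")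
proof (cases "D = {}")
  case True
  then show ?thesis using B by (intro rel_homotopic_linear) auto
next
  case False
  have "continuous_on D (\<lambda>x. norm (v x))" by (intro continuous_intros v)
  from continuous_attains_inf[OF D False this] obtain x0 where x0: "x0 \<in> D" "\<And>x. x \<in> D \<Longrightarrow> norm (v x0) \<le> norm (v x)"
    by blast
  \<comment> \<open>Half the minimal norm keeps the segment from v to its perturbation away from 0;
    1/4 keeps the perturbed value in the right half plane wherever v is within 1/4 of the base
    vector.\<close>
  define e where "e = min (1/4) (norm (v x0) / 2)"
  have e: "e > 0" "e \<le> 1/4" "\<And>x. x \<in> D \<Longrightarrow> e < norm (v x)"
  proof -
    have pos: "norm (v x0) > 0" using v0[OF x0(1)] by simp
    then show "e > 0" "e \<le> 1/4" by (simp_all add: e_def)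
    show "e < norm (v x)" if "x \<in> D" for x
      unfolding e_def min_less_iff_disj using pos x0(2)[OF that] by linarith
  qed
  \<comment> \<open>These three real coordinates vanish on the half line to be avoided, and a source
    of dimension at most two can be moved off their common zero. The tolerance \<open>e/2\<close>
    allows for adding the two components of the error.\<close>
  have "continuous_on D (\<lambda>x. (Im (v x $ a), v x $ b))" by (intro continuous_intros v)
  moreover have "DIM('a) < DIM(real \<times> complex)" using dim by simp
  moreover have "e/2 > 0" using e(1) by simp
  ultimately obtain q :: "'a \<Rightarrow> real \<times> complex" where q: "continuous_on D q"
      "\<And>x. x \<in> D \<Longrightarrow> norm (q x - (Im (v x $ a), v x $ b)) < e/2" "\<And>x. x \<in> D \<Longrightarrow> q x \<noteq> 0"
    using perturb_avoid_origin[OF _ D, of "\<lambda>x. (Im (v x $ a), v x $ b)" "e/2"] by blast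
  define d where "d x = q x - (Im (v x $ a), v x $ b)" for x
  \<comment> \<open>Cut-off factor: 0 where v is the base vector, hence on \<open>B\<close>, and 1
    at distance at least 1/4 from it.\<close>
  define phi where "phi x = min 1 (4 * norm (v x - axis a 1))" for x
  have phi: "phi x \<in> {0..1}" for x by (simp add: phi_def)
  define u where "u x = v x + phi x *\<^sub>R (axis a (\<i> * of_real (fst (d x))) + axis b (snd (d x)))" for x
  have contd: "continuous_on D d" unfolding d_def by (intro continuous_intros v q)
  have contax: "continuous_on D (\<lambda>x. axis j (f x) :: complex^'n)" if "continuous_on D f" for f j
    unfolding axis_def
  proof (intro continuous_on_vec_lambda)
    fix i show "continuous_on D (\<lambda>x. if i = j then f x else 0)" by (cases "i = j") (auto simp: that)
  qed
  have contu: "continuous_on D u"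
    unfolding u_def phi_def by (intro continuous_intros v contax contd)
  have uv: "norm (u x - v x) < e" if "x \<in> D" for x
  proof -
    have "norm (u x - v x) = phi x * norm (axis a (\<i> * of_real (fst (d x))) + axis b (snd (d x)) :: complex^'n)"
      using phi[of x] by (simp add: u_def)
    also have "\<dots> \<le> 1 * (norm (fst (d x)) + norm (snd (d x)))"
      using phi[of x] by (intro mult_mono order.trans[OF norm_triangle_ineq]) (auto simp: norm_axis norm_mult)
    also have "\<dots> \<le> norm (d x) + norm (d x)"
      using norm_fst_le[of "fst (d x)" "snd (d x)"] norm_snd_le[of "snd (d x)" "fst (d x)"]
      by simp
    also have "\<dots> < e" using q(2)[OF that] by (simp add: d_def)
    finally show ?thesis .
  qed
  have comps: "u x $ a = v x $ a + phi x *\<^sub>R (\<i> * of_real (fst (d x)))" "u x $ b = v x $ b + phi x *\<^sub>R snd (d x)" for x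
    using ab(3) by (simp_all add: u_def axis_def)
  have suppu: "u x $ i = 0" if "x \<in> D" "i \<notin> S" for x i
    using that supp ab by (auto simp: u_def axis_def)
  \<comment> \<open>Under the full perturbation the three coordinates are those of \<open>q\<close>,
    which never vanish together. Where the perturbation is cut off, v is near the base vector and
    coordinate a has positive real part.\<close>
  have u_far: "u x \<noteq> - (axis a (of_real r))" if x: "x \<in> D" and r: "r \<ge> 0" for x r
  proof (cases "phi x = 1")
    case True
    have "q x = (Im (u x $ a), u x $ b)" unfolding comps True by (simp add: d_def)
    then show ?thesis using q(3)[OF x] ab(3) by (auto simp: axis_def zero_prod_def)
  next
    case False
    then have "norm (v x - axis a 1) < 1/4" by (auto simp: phi_def min_def split: if_splits)
    then have "norm (u x - axis a 1) < 1/2"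
      using uv[OF x] e(2) norm_triangle_ineq[of "u x - v x" "v x - axis a 1"] by simp
    then have "norm ((u x - axis a 1) $ a) < 1/2"
      using component_le_norm_cart order.strict_trans1 Finite_Cartesian_Product.norm_nth_le by blast
    then have "norm (u x $ a - 1) < 1/2" by (simp add: axis_def)
    then have "\<bar>Re (u x $ a - 1)\<bar> < 1/2" using abs_Re_le_cmod order.strict_trans1 by blast
    then have "Re (u x $ a) > 0" unfolding minus_complex.sel one_complex.sel by linarith
    then show ?thesis using r by (auto simp: axis_def)
  qed
  have "rel_homotopic B (axis a 1) D ?Y v u"
  proof (rule rel_homotopic_linear[OF v contu B])
    show "u x = axis a 1" if "x \<in> B" for x
      using B(2)[OF that] by (simp add: u_def phi_def)
    fix t x assume t: "t \<in> {0..1::real}" and x: "x \<in> D"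
    have eq: "(1 - t) *\<^sub>R v x + t *\<^sub>R u x = v x + t *\<^sub>R (u x - v x)" by (simp add: algebra_simps)
    have "norm (t *\<^sub>R (u x - v x)) \<le> 1 * norm (u x - v x)"
      using t by (simp only: norm_scaleR) (intro mult_right_mono, auto)
    also have "\<dots> < norm (v x)" using uv[OF x] e(3)[OF x] by simp
    finally have "v x + t *\<^sub>R (u x - v x) \<noteq> 0"
      by (metis add_eq_0_iff norm_minus_cancel order_less_irrefl)
    then show "(1 - t) *\<^sub>R v x + t *\<^sub>R u x \<in> ?Y" using supp suppu x unfolding eq[symmetric] by auto
  qed
  \<comment> \<open>The segment from \<open>u x\<close> to the base vector could meet 0 only if
    \<open>u x\<close> lay on the opposite half line.\<close>
  also have "rel_homotopic B (axis a 1) D ?Y u (\<lambda>_. axis a 1)"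
  proof (rule rel_homotopic_linear[OF contu _ B(1)])
    show "u x = axis a 1" if "x \<in> B" for x
      using B(2)[OF that] by (simp add: u_def phi_def)
    fix t x assume t: "t \<in> {0..1::real}" and x: "x \<in> D"
    have "(1 - t) *\<^sub>R u x + t *\<^sub>R axis a 1 \<noteq> 0"
    proof (cases "t = 1")
      case True then show ?thesis by (simp add: axis_eq_0_iff)
    next
      case False
      then have t1: "1 - t \<noteq> 0" "t / (1 - t) \<ge> 0" using t by auto
      show ?thesis
      proof
        assume "(1 - t) *\<^sub>R u x + t *\<^sub>R axis a 1 = 0"
        then have "(1 - t) *\<^sub>R u x = - (t *\<^sub>R axis a 1)" by (simp add: add_eq_0_iff)
        then have "u x = (1 / (1 - t)) *\<^sub>R (- (t *\<^sub>R axis a 1))"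
          using t1(1) by (metis divide_inverse mult_1 real_vector.scale_left_imp_eq scaleR_scaleR right_inverse scaleR_one mult.commute)
        also have "\<dots> = - axis a (of_real (t / (1 - t)))"
          by (simp add: vec_eq_iff axis_def) (simp add: scaleR_conv_of_real)
        finally show False using u_far[OF x t1(2)] by simp
      qed
    qed
    then show "(1 - t) *\<^sub>R u x + t *\<^sub>R axis a 1 \<in> ?Y" using suppu[OF x] ab by (auto simp: axis_def)
  qed auto
  finally (homotopic_with_trans) show ?thesis .
qed

section \<open>Block diagonal matrices\<close>

text \<open>\<open>\<sigma>\<close> labels the blocks and T holds the indices not yet reduced. T =
  UNIV means block diagonal; if \<open>\<sigma>\<close> is injective on T the matrix is
  diagonal.\<close>

definition pattern :: "('n \<Rightarrow> nat) \<Rightarrow> 'n set \<Rightarrow> complex^'n^'n \<Rightarrow> bool" where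
  "pattern \<sigma> T A \<longleftrightarrow> (\<forall>i j. \<not> (i \<in> T \<and> j \<in> T \<and> \<sigma> i = \<sigma> j) \<longrightarrow> A $ i $ j = (mat 1 :: complex^'n^'n) $ i $ j)"

definition block_GL :: "('n \<Rightarrow> nat) \<Rightarrow> 'n set \<Rightarrow> (complex^'n^'n) set" where
  "block_GL \<sigma> T = {A. invertible A \<and> pattern \<sigma> T A}"

lemma pattern_1 [simp]: "pattern \<sigma> T (mat 1)"
  by (simp add: pattern_def)

lemma pattern_mono: "pattern \<sigma> T A \<Longrightarrow> T \<subseteq> U \<Longrightarrow> pattern \<sigma> U A"
  unfolding pattern_def by blast

lemma pattern_mult:
  fixes A B :: "complex^'n^'n"
  assumes A: "pattern \<sigma> T A" and B: "pattern \<sigma> T B"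
  shows "pattern \<sigma> T (A ** B)"
  unfolding pattern_def
proof (intro allI impI)
  fix i j assume ij: "\<not> (i \<in> T \<and> j \<in> T \<and> \<sigma> i = \<sigma> j)"
  have off: "M $ k $ l = 0" if "pattern \<sigma> T M" "k \<noteq> l" "\<not> (k \<in> T \<and> l \<in> T \<and> \<sigma> k = \<sigma> l)" for M :: "complex^'n^'n" and k l
    using that by (simp add: pattern_def mat_def)
  have "A $ i $ k * B $ k $ j = (if k = i then (mat 1 :: complex^'n^'n) $ i $ j else 0)" if "i \<notin> T" for k
    using A B ij that unfolding pattern_def by (auto simp: mat_def)
  moreover have "A $ i $ k * B $ k $ j = (if k = i then (mat 1 :: complex^'n^'n) $ i $ j else 0)"
    if "i \<in> T" "\<sigma> i \<noteq> \<sigma> j" for k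
  proof (cases "k = i")
    case True
    then show ?thesis using that off[OF B, of i j] by (auto simp: mat_def)
  next
    case False
    then have "A $ i $ k = 0 \<or> B $ k $ j = 0"
      using that off[OF A, of i k] off[OF B, of k j] by (cases "k = j"; cases "\<sigma> k = \<sigma> i") auto
    then show ?thesis using False by auto
  qed
  moreover have "A $ i $ k * B $ k $ j = (if k = j then (mat 1 :: complex^'n^'n) $ i $ j else 0)" if "j \<notin> T" for k
    using A B ij that unfolding pattern_def by (auto simp: mat_def)
  ultimately show "(A ** B) $ i $ j = (mat 1 :: complex^'n^'n) $ i $ j"
    using ij unfolding matrix_matrix_mult_def by (cases "j \<in> T"; cases "i \<in> T") simp_all
qed

lemma block_GL_mult: "A \<in> block_GL \<sigma> T \<Longrightarrow> B \<in> block_GL \<sigma> T \<Longrightarrow> A ** B \<in> block_GL \<sigma> T"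
  by (simp add: block_GL_def pattern_mult invertible_mult)

definition block_idem :: "('n \<Rightarrow> nat) \<Rightarrow> nat \<Rightarrow> complex^'n^'n" where
  "block_idem \<sigma> j = (\<chi> a b. if a = b \<and> \<sigma> a = j then 1 else 0)"

lemma mult_block_idem: "(A ** block_idem \<sigma> j) $ a $ b = (if \<sigma> b = j then A $ a $ b else 0)"
proof -
  have "A $ a $ k * block_idem \<sigma> j $ k $ b = (if k = b then if \<sigma> b = j then A $ a $ b else 0 else 0)" for k
    by (simp add: block_idem_def)
  then show ?thesis by (simp add: matrix_matrix_mult_def)
qed

lemma block_idem_mult: "(block_idem \<sigma> j ** A) $ a $ b = (if \<sigma> a = j then A $ a $ b else 0)"
proof -
  have "block_idem \<sigma> j $ a $ k * A $ k $ b = (if k = a then if \<sigma> a = j then A $ a $ b else 0 else 0)" for k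
    by (simp add: block_idem_def)
  then show ?thesis by (simp add: matrix_matrix_mult_def)
qed

lemma block_idem_mult_block_idem:
  "block_idem \<sigma> i ** block_idem \<sigma> j = (if i = j then block_idem \<sigma> j else 0)"
  by (auto simp: vec_eq_iff mult_block_idem) (auto simp: block_idem_def)

text \<open>As a commutation relation, block diagonality passes to inverses and is recognized
  directly in quotients of lifts.\<close>

lemma pattern_UNIV_iff:
  fixes A :: "complex^'n^'n"
  shows
  "pattern \<sigma> UNIV A \<longleftrightarrow> (\<forall>j. A ** block_idem \<sigma> j = block_idem \<sigma> j ** A)"
proof
  assume "pattern \<sigma> UNIV A"
  then show "\<forall>j. A ** block_idem \<sigma> j = block_idem \<sigma> j ** A"
    by (auto simp: vec_eq_iff mult_block_idem block_idem_mult pattern_def mat_def)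
next
  assume *: "\<forall>j. A ** block_idem \<sigma> j = block_idem \<sigma> j ** A"
  show "pattern \<sigma> UNIV A"
    unfolding pattern_def
  proof (intro allI impI)
    fix a b assume ab: "\<not> (a \<in> UNIV \<and> b \<in> UNIV \<and> \<sigma> a = \<sigma> b)"
    have "(A ** block_idem \<sigma> (\<sigma> b)) $ a $ b = (block_idem \<sigma> (\<sigma> b) ** A) $ a $ b" using * by simp
    then have "A $ a $ b = 0" using ab by (simp add: mult_block_idem block_idem_mult)
    then show "A $ a $ b = (mat 1 :: complex^'n^'n) $ a $ b" using ab by (auto simp: mat_def)
  qed
qed

lemma block_GL_matrix_inv:
  assumes "A \<in> block_GL \<sigma> UNIV"
  shows "matrix_inv A \<in> block_GL \<sigma> UNIV"
proof -
  have inv: "invertible A" and c: "A ** block_idem \<sigma> j = block_idem \<sigma> j ** A" for j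
    using assms by (auto simp: block_GL_def pattern_UNIV_iff)
  have "matrix_inv A ** block_idem \<sigma> j = matrix_inv A ** (block_idem \<sigma> j ** A) ** matrix_inv A" for j
    by (metis inv matrix_inv_right matrix_mul_assoc matrix_mul_rid)
  also have "\<dots> j = block_idem \<sigma> j ** matrix_inv A" for j
    by (metis c inv matrix_inv_left matrix_mul_assoc matrix_mul_lid)
  finally show ?thesis
    using invertible_matrix_inv[OF inv] by (simp add: block_GL_def pattern_UNIV_iff)
qed

text \<open>For block diagonal A this is the determinant of the j-th diagonal block, padded with the
  identity so that all matrices keep the same index type.\<close>

definition block_det :: "('n \<Rightarrow> nat) \<Rightarrow> nat \<Rightarrow> complex^'n^'n \<Rightarrow> complex" where
  "block_det \<sigma> j A = det (A ** block_idem \<sigma> j + (mat 1 - block_idem \<sigma> j))"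

lemma block_det_1 [simp]: "block_det \<sigma> j (mat 1) = 1"
  by (simp add: block_det_def)

lemma continuous_on_block_det [continuous_intros]:
  "continuous_on S f \<Longrightarrow> continuous_on S (\<lambda>x. block_det \<sigma> j (f x))"
  unfolding block_det_def by (intro continuous_intros)

text \<open>With D the j-th idempotent, B commutes with D, so the cross terms in (AD + 1 - D)(BD + 1
  - D) vanish and ABD + 1 - D remains.\<close>

lemma block_det_mult:
  fixes A B :: "complex^'n^'n"
  assumes "pattern \<sigma> UNIV B"
  shows "block_det \<sigma> j (A ** B) = block_det \<sigma> j A * block_det \<sigma> j B"
proof -
  let ?D = "block_idem \<sigma> j"
  have DD: "?D ** ?D = ?D" "M ** ?D ** ?D = M ** ?D" for M :: "complex^'n^'n"
    by (simp_all add: block_idem_mult_block_idem flip: matrix_mul_assoc)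
  have BD: "?D ** B = B ** ?D" "M ** ?D ** B = M ** B ** ?D" for M :: "complex^'n^'n"
    using assms by (simp_all add: pattern_UNIV_iff flip: matrix_mul_assoc)
  have "(A ** ?D + (mat 1 - ?D)) ** (B ** ?D + (mat 1 - ?D)) = A ** B ** ?D + (mat 1 - ?D)"
    by (simp add: matrix_ring DD BD)
  then show ?thesis unfolding block_det_def det_mul[symmetric] by simp
qed

lemma block_det_nonzero:
  assumes "A \<in> block_GL \<sigma> UNIV"
  shows "block_det \<sigma> j A \<noteq> 0"
proof -
  have "block_det \<sigma> j A * block_det \<sigma> j (matrix_inv A) = block_det \<sigma> j (A ** matrix_inv A)"
    using block_GL_matrix_inv[OF assms] by (simp add: block_det_mult block_GL_def)
  also have "\<dots> = 1" using assms by (simp add: matrix_inv_right block_GL_def)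
  finally show ?thesis by auto
qed

definition diag_mat :: "('n \<Rightarrow> complex) \<Rightarrow> complex^'n^'n" where
  "diag_mat d = (\<chi> a b. if a = b then d a else 0)"

lemma det_diag_mat: "det (diag_mat d) = (\<Prod>a\<in>UNIV. d a)"
  by (subst det_diagonal) (auto simp: diag_mat_def)

lemma block_det_diag_mat: "block_det \<sigma> j (diag_mat d) = (\<Prod>a\<in>UNIV. if \<sigma> a = j then d a else 1)"
proof -
  have "diag_mat d ** block_idem \<sigma> j + (mat 1 - block_idem \<sigma> j) = diag_mat (\<lambda>a. if \<sigma> a = j then d a else 1)"
    by (auto simp: vec_eq_iff mult_block_idem) (auto simp: diag_mat_def mat_def block_idem_def)
  then show ?thesis by (simp add: block_det_def det_diag_mat)
qed

lemma diag_mat_in_block_GL: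
  assumes "\<And>a. d a \<noteq> 0" "\<And>a. a \<notin> T \<Longrightarrow> d a = 1"
  shows "diag_mat d \<in> block_GL \<sigma> T"
proof -
  have "invertible (diag_mat d)" using assms(1) by (simp add: invertible_det_nz det_diag_mat)
  then show ?thesis using assms(2) by (auto simp: block_GL_def pattern_def diag_mat_def mat_def)
qed

text \<open>Blocks are peeled off one at a time: with A acting on the first m blocks and the
  identity elsewhere, multiplying by the padded block m extends the range by one. The bound r makes
  all idempotents below r sum to the identity.\<close>

lemma det_eq_prod_block_det:
  fixes A :: "complex^'n^'n"
  assumes A: "pattern \<sigma> UNIV A" and r: "\<And>a. \<sigma> a < r"
  shows "det A = (\<Prod>j<r. block_det \<sigma> j A)"
proof -
  let ?S = "\<lambda>m. \<Sum>j<m. block_idem \<sigma> j"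
  have SD: "?S m ** block_idem \<sigma> m = 0" for m
    by (simp add: matrix_sum_rdistrib block_idem_mult_block_idem)
  have AD: "block_idem \<sigma> j ** A = A ** block_idem \<sigma> j" for j
    using A by (simp add: pattern_UNIV_iff)
  have AS: "?S m ** A = A ** ?S m" for m
    by (simp add: matrix_sum_rdistrib matrix_sum_ldistrib AD)
  have "det (A ** ?S m + (mat 1 - ?S m)) = (\<Prod>j<m. block_det \<sigma> j A)" for m
  proof (induction m)
    case 0 then show ?case by simp
  next
    case (Suc m)
    have z: "A ** ?S m ** A ** block_idem \<sigma> m = 0" "A ** ?S m ** block_idem \<sigma> m = 0" "?S m ** A ** block_idem \<sigma> m = 0"
      by (metis AS SD matrix_mul_assoc times0_right)+
    have "(A ** ?S m + (mat 1 - ?S m)) ** (A ** block_idem \<sigma> m + (mat 1 - block_idem \<sigma> m)) =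
      A ** ?S (Suc m) + (mat 1 - ?S (Suc m))"
      by (simp add: matrix_ring z SD)
    from arg_cong[OF this, of det] show ?case
      unfolding det_mul Suc prod.lessThan_Suc by (simp only: block_det_def)
  qed
  moreover have "?S r = mat 1"
    using r by (auto simp: vec_eq_iff block_idem_def mat_def)
  ultimately show ?thesis by (metis add_0_right cancel_comm_monoid_add_class.diff_cancel matrix_mul_rid)
qed

section \<open>Reduction of families of block matrices to diagonal form\<close>

lemma continuous_on_vector_scalar_mult [continuous_intros]:
  fixes f :: "'a::topological_space \<Rightarrow> complex^'n"
  shows "continuous_on S c \<Longrightarrow> continuous_on S f \<Longrightarrow> continuous_on S (\<lambda>x. c x *s f x)"
  unfolding vector_scalar_mult_def by (intro continuous_intros)

text \<open>Column a is a nonzero vector supported on the active indices of its block, of which b is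
  a second one, so it contracts to the basis vector. Transport along this contraction turns the
  motion of the vector into one of the whole matrix.\<close>

lemma column_homotopic_to_axis:
  fixes g :: "'a::euclidean_space \<Rightarrow> complex^'n^'n"
  assumes dim: "DIM('a) \<le> 2" and D: "compact D" and g: "continuous_on D g"
    and gT: "\<And>x. x \<in> D \<Longrightarrow> g x \<in> block_GL \<sigma> T"
    and B: "B \<subseteq> D" "\<And>x. x \<in> B \<Longrightarrow> g x = mat 1"
    and ab: "a \<in> T" "b \<in> T" "a \<noteq> b" "\<sigma> a = \<sigma> b"
  shows "\<exists>g'. rel_homotopic B (mat 1) D (block_GL \<sigma> T) g g' \<and>
    (\<forall>x\<in>D. g' x *v axis a 1 = axis a 1)"
proof -
  define S where "S = {i \<in> T. \<sigma> i = \<sigma> a}"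
  define v where "v x = g x *v axis a 1" for x
  have v_nth: "v x $ i = g x $ i $ a" for x i
    unfolding v_def by (simp add: matrix_vector_mult_def axis_def if_distrib cong: if_cong)
  have inv: "invertible (g x)" if "x \<in> D" for x using gT[OF that] by (simp add: block_GL_def)
  have v0: "v x \<noteq> 0" if "x \<in> D" for x
  proof
    assume "v x = 0"
    then have "axis a 1 = (0 :: complex^'n)"
      unfolding v_def by (metis inv[OF that] matrix_inv_left matrix_vector_mul_assoc matrix_vector_mul_lid matrix_vector_mult_0_right)
    then show False by (simp add: axis_eq_0_iff)
  qed
  have supp: "v x $ i = 0" if "x \<in> D" "i \<notin> S" for x i
    using gT[OF that(1)] that(2) ab by (auto simp: v_nth block_GL_def pattern_def S_def mat_def)
  have vB: "v x = axis a 1" if "x \<in> B" for x using B(2)[OF that] by (simp add: v_def)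
  have "a \<in> S" "b \<in> S" using ab by (auto simp: S_def)
  have contv: "continuous_on D v" unfolding v_def by (intro continuous_intros g)
  have H: "rel_homotopic B (axis a 1) D {y. y \<noteq> 0 \<and> (\<forall>i. i \<notin> S \<longrightarrow> y $ i = 0)} v (\<lambda>_. axis a 1)"
    by (rule punctured_space_rel_nullhomotopic[where b = b])
      (use dim D contv v0 supp \<open>a \<in> S\<close> \<open>b \<in> S\<close> ab(3) B(1) vB in auto)
  obtain w :: "real \<times> 'a \<Rightarrow> complex^'n" where w: "continuous_on ({0..1} \<times> D) w"
    "\<And>t x. t \<in> {0..1} \<Longrightarrow> x \<in> D \<Longrightarrow> w (t,x) \<in> {y. y \<noteq> 0 \<and> (\<forall>i. i \<notin> S \<longrightarrow> y $ i = 0)}"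
    "\<And>x. w (0,x) = v x" "\<And>x. w (1,x) = axis a 1"
    "\<And>t x. t \<in> {0..1} \<Longrightarrow> x \<in> B \<Longrightarrow> w (t,x) = axis a 1"
    by (rule rel_homotopicE[OF H], rule that)
  \<comment> \<open>The rank one change of the identity that sends \<open>w (t,x)\<close> to
    \<open>w (s,x)\<close> and fixes the orthogonal complement of \<open>w (t,x)\<close>. Both
    vectors are supported in one block, so the pattern is kept.\<close>
  define X where "X x s t = mat 1 + rk1 ((1 / hip (w (t,x)) (w (t,x))) *s (w (s,x) - w (t,x))) (w (t,x))" for x s t
  \<comment> \<open>The last clause makes the resulting homotopy relative to \<open>B\<close>, where
    the vector stands still.\<close>
  define R where "R x s t A \<longleftrightarrow> pattern \<sigma> T A \<and> A *v w (t,x) = w (s,x) \<and> (x \<in> B \<longrightarrow> A = mat 1)" for x s t A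
  have contw: "continuous_on K (\<lambda>p. w (f p, e p))" if "continuous_on K f" "continuous_on K e" "\<And>p. p \<in> K \<Longrightarrow> f p \<in> {0..1} \<and> e p \<in> D"
    for K f and e :: "'k::topological_space \<Rightarrow> 'a"
    by (rule continuous_on_compose2[OF w(1)]) (use that in \<open>auto intro!: continuous_intros\<close>)
  have contX: "continuous_on (D \<times> {0..1} \<times> {0..1}) (\<lambda>(x,s,t). X x s t)"
    unfolding X_def case_prod_unfold
  proof (intro continuous_intros contw)
    show "\<forall>x\<in>D \<times> {0..1} \<times> {0..1}. hip (w (snd (snd x), fst x)) (w (snd (snd x), fst x)) \<noteq> 0"
      using w(2) by auto
  qed auto
  have X_diag: "X x t t = mat 1" for x t
    by (simp add: X_def rk1_def vec_eq_iff)
  have R_step: "R x s t (X x s t)" if "x \<in> D" "s \<in> {0..1}" "t \<in> {0..1}" for x s t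
  proof -
    have wz: "w (u,x) $ l = 0" if "l \<notin> S" "u \<in> {0..1}" for l u
      using w(2)[OF that(2) \<open>x \<in> D\<close>] that(1) by blast
    have "pattern \<sigma> T (X x s t)"
      unfolding pattern_def
    proof (intro allI impI)
      fix i j assume "\<not> (i \<in> T \<and> j \<in> T \<and> \<sigma> i = \<sigma> j)"
      then have "i \<notin> S \<or> j \<notin> S" unfolding S_def by auto
      then have "w (s,x) $ i = 0 \<and> w (t,x) $ i = 0 \<or> w (t,x) $ j = 0" using wz that by blast
      then show "X x s t $ i $ j = (mat 1 :: complex^'n^'n) $ i $ j"
        by (elim disjE conjE) (simp_all add: X_def rk1_def)
    qed
    moreover have "X x s t *v w (t,x) = w (s,x)"
      using w(2)[of t x] that by (simp add: X_def matrix_vector_mult_add_rdistrib rk1_vec)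
    moreover have "X x s t = mat 1" if "x \<in> B"
      using w(5)[of _ x] that \<open>s \<in> {0..1}\<close> \<open>t \<in> {0..1}\<close> by (simp add: X_def rk1_def vec_eq_iff)
    ultimately show ?thesis by (simp add: R_def)
  qed
  obtain \<tau> where \<tau>: "continuous_on (D \<times> {0..1}) (\<lambda>(x,t). \<tau> x t)"
    "\<And>x t. x \<in> D \<Longrightarrow> t \<in> {0..1} \<Longrightarrow> invertible (\<tau> x t)"
    "\<And>x. x \<in> D \<Longrightarrow> \<tau> x 0 = mat 1"
    "\<And>x t. x \<in> D \<Longrightarrow> t \<in> {0..1} \<Longrightarrow> R x t 0 (\<tau> x t)"
  proof (rule transport[where Z = D and T = X and R = R])
    show "R x t t (mat 1)" for x t by (simp add: R_def)
    show "R z s u (A ** B)" if "R z s t A" "R z t u B" for z s t u A B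
      using that by (auto simp: R_def pattern_mult simp flip: matrix_vector_mul_assoc)
  qed (use D contX X_diag R_step in auto)
  define h where "h p = \<tau> (snd p) (fst p) ** g (snd p)" for p :: "real \<times> 'a"
  have "rel_homotopic B (mat 1) D (block_GL \<sigma> T) g (\<lambda>x. h (1,x))"
  proof (rule rel_homotopicI[where h = h])
    have "continuous_on ({0..1} \<times> D) (\<lambda>p. (\<lambda>(x,t). \<tau> x t) (snd p, fst p))"
      by (rule continuous_on_compose2[OF \<tau>(1)]) (auto intro!: continuous_intros)
    then have "continuous_on ({0..1} \<times> D) (\<lambda>p. \<tau> (snd p) (fst p))" by simp
    then show "continuous_on ({0..1} \<times> D) h"
      unfolding h_def by (intro continuous_intros continuous_on_compose2[OF g]) auto
    show "h (t,x) \<in> block_GL \<sigma> T" if "t \<in> {0..1}" "x \<in> D" for t x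
      unfolding h_def using gT[OF that(2)] \<tau>(2)[OF that(2,1)] \<tau>(4)[OF that(2,1)]
      by (intro block_GL_mult) (auto simp: block_GL_def R_def)
    show "h (t,x) = mat 1" if "t \<in> {0..1}" "x \<in> B" for t x
      using \<tau>(4)[of x t] that B by (auto simp: h_def R_def)
  qed (use \<tau>(3) B in \<open>auto simp: h_def\<close>)
  moreover have "h (1,x) *v axis a 1 = axis a 1" if "x \<in> D" for x
    using \<tau>(4)[OF that, of 1] w(3,4) by (simp add: h_def R_def v_def flip: matrix_vector_mul_assoc)
  ultimately show ?thesis by blast
qed

text \<open>With column a in place, g fixes the basis vector, so multiplying by
  \<open>mat 1 - N\<close> only subtracts multiples of the rest of row a. \<open>N\<close> squares
  to zero, hence every stage is invertible.\<close>

lemma row_homotopic_to_axis: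
  fixes g :: "'a::euclidean_space \<Rightarrow> complex^'n^'n"
  assumes g: "continuous_on D g" and gT: "\<And>x. x \<in> D \<Longrightarrow> g x \<in> block_GL \<sigma> T"
    and B: "B \<subseteq> D" "\<And>x. x \<in> B \<Longrightarrow> g x = mat 1"
    and col: "\<And>x. x \<in> D \<Longrightarrow> g x *v axis a 1 = axis a 1"
  shows "\<exists>g'. rel_homotopic B (mat 1) D (block_GL \<sigma> T) g g' \<and>
    (\<forall>x\<in>D. g' x \<in> block_GL \<sigma> (T - {a}))"
proof -
  \<comment> \<open>Conjugated because \<open>rk1\<close> conjugates its second argument; omitting
    entry a is what makes \<open>N\<close> nilpotent.\<close>
  define n where "n x = (\<chi> j. if j = a then 0 else cnj (g x $ a $ j))" for x
  define N where "N t x = rk1 (axis a 1) (complex_of_real t *s n x)" for t x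
  define h where "h p = g (snd p) ** (mat 1 - N (fst p) (snd p))" for p
  have NN: "N t x ** N t x = 0" for t x
  proof -
    have "hip (complex_of_real t *s n x) (axis a 1) = 0"
      by (simp add: hip_def n_def axis_def if_distrib cong: if_cong)
    then show ?thesis by (simp add: N_def rk1_mult) (simp add: rk1_def vec_eq_iff)
  qed
  have "(mat 1 - N t x) ** (mat 1 + N t x) = mat 1" for t x
    by (simp add: matrix_ring NN)
  then have invN: "invertible (mat 1 - N t x)" for t x
    using invertible_right_inverse by blast
  have gN: "g x ** N t x = N t x" if "x \<in> D" for t x
    using col[OF that] by (simp add: N_def mult_rk1)
  have h_eq: "h (t,x) = g x - N t x" if "x \<in> D" for t x
    using gN[OF that] by (simp add: h_def matrix_ring)
  have N_nth: "N t x $ i $ j = (if i = a \<and> j \<noteq> a then of_real t * g x $ a $ j else 0)" for t x i j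
    by (simp add: N_def rk1_def n_def axis_def)
  have colg: "g x $ i $ a = (if i = a then 1 else 0)" if "x \<in> D" for x i
    using arg_cong[OF col[OF that], of "\<lambda>v. v $ i"]
    by (simp add: matrix_vector_mult_def axis_def if_distrib cong: if_cong)
  have contn: "continuous_on D n"
    unfolding n_def
  proof (intro continuous_on_vec_lambda)
    fix j show "continuous_on D (\<lambda>x. if j = a then 0 else cnj (g x $ a $ j))"
      by (cases "j = a") (auto intro!: continuous_intros g)
  qed
  have inv: "invertible (h (t,x))" if "x \<in> D" for t x
    unfolding h_def using gT[OF that] invN by (auto intro!: invertible_mult simp: block_GL_def)
  have "rel_homotopic B (mat 1) D (block_GL \<sigma> T) g (\<lambda>x. h (1,x))"
  proof (rule rel_homotopicI[where h = h])
    show "continuous_on ({0..1} \<times> D) h"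
      unfolding h_def N_def
      by (intro continuous_intros continuous_on_compose2[OF g] continuous_on_compose2[OF contn]) auto
    show "h (t,x) \<in> block_GL \<sigma> T" if "t \<in> {0..1}" "x \<in> D" for t x
      using inv[OF that(2)] gT[OF that(2)]
      by (auto simp: block_GL_def pattern_def h_eq[OF that(2)] N_nth mat_def)
    show "h (t,x) = mat 1" if "t \<in> {0..1}" "x \<in> B" for t x
      using that B(1) B(2)[of x] by (auto simp: h_eq vec_eq_iff N_nth mat_def)
    show "h (0,x) = g x" if "x \<in> D" for x
      using that by (auto simp: h_eq vec_eq_iff N_nth)
  qed (use B in auto)
  moreover have "h (1,x) \<in> block_GL \<sigma> (T - {a})" if "x \<in> D" for x
  proof -
    have "pattern \<sigma> (T - {a}) (h (1,x))"
      unfolding pattern_def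
    proof (intro allI impI)
      fix i j assume ij: "\<not> (i \<in> T - {a} \<and> j \<in> T - {a} \<and> \<sigma> i = \<sigma> j)"
      consider "i = a" | "j = a" | "\<not> (i \<in> T \<and> j \<in> T \<and> \<sigma> i = \<sigma> j)" "i \<noteq> a" using ij by blast
      then show "h (1,x) $ i $ j = (mat 1 :: complex^'n^'n) $ i $ j"
      proof cases
        case 1
        then show ?thesis using colg[OF that, of a] by (auto simp: h_eq[OF that] N_nth mat_def)
      next
        case 3
        then have "g x $ i $ j = (mat 1 :: complex^'n^'n) $ i $ j"
          using gT[OF that] unfolding block_GL_def pattern_def by blast
        then show ?thesis using 3 by (simp add: h_eq[OF that] N_nth)
      qed (simp_all add: h_eq[OF that] N_nth colg[OF that] mat_def)
    qed
    then show ?thesis using inv[OF that] by (simp add: block_GL_def)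
  qed
  ultimately show ?thesis by blast
qed

text \<open>As long as two active indices share a block, one of them can be cleared, first its
  column and then its row. At the end each block has at most one active index.\<close>

lemma homotopic_to_inj_pattern:
  fixes g :: "'a::euclidean_space \<Rightarrow> complex^'n^'n"
  assumes dim: "DIM('a) \<le> 2" and D: "compact D" and B: "B \<subseteq> D"
    and g: "continuous_on D g" and gT: "\<And>x. x \<in> D \<Longrightarrow> g x \<in> block_GL \<sigma> T"
    and gB: "\<And>x. x \<in> B \<Longrightarrow> g x = mat 1"
  shows "\<exists>T' g'. inj_on \<sigma> T' \<and>
    rel_homotopic B (mat 1) D (block_GL \<sigma> UNIV) g g' \<and>
    (\<forall>x\<in>D. g' x \<in> block_GL \<sigma> T')"
  using g gT gB
proof (induction "card T" arbitrary: T g rule: less_induct)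
  case less
  let ?h = "rel_homotopic B (mat 1) D"
  have mono: "block_GL \<sigma> U \<subseteq> block_GL \<sigma> UNIV" for U :: "'n set"
    by (auto simp: block_GL_def intro: pattern_mono)
  show ?case
  proof (cases "inj_on \<sigma> T")
    case True
    have "?h (block_GL \<sigma> UNIV) g g"
      by (subst homotopic_with_refl) (use less.prems mono in \<open>auto simp: continuous_map_in_subtopology\<close>)
    then show ?thesis using True less.prems(2) by blast
  next
    case False
    then obtain a b where ab: "a \<in> T" "b \<in> T" "a \<noteq> b" "\<sigma> a = \<sigma> b" by (auto simp: inj_on_def)
    from column_homotopic_to_axis[OF dim D less.prems(1,2) B less.prems(3) ab]
    obtain g1 where g1: "?h (block_GL \<sigma> T) g g1" "\<And>x. x \<in> D \<Longrightarrow> g1 x *v axis a 1 = axis a 1" by blast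
    have g1': "continuous_on D g1" "\<And>x. x \<in> D \<Longrightarrow> g1 x \<in> block_GL \<sigma> T" "\<And>x. x \<in> B \<Longrightarrow> g1 x = mat 1"
      using homotopic_with_imp_continuous_maps[OF g1(1)] homotopic_with_imp_property[OF g1(1)]
      by (auto simp: continuous_map_in_subtopology)
    from row_homotopic_to_axis[OF g1'(1,2) B g1'(3) g1(2)]
    obtain g2 where g2: "?h (block_GL \<sigma> T) g1 g2" "\<And>x. x \<in> D \<Longrightarrow> g2 x \<in> block_GL \<sigma> (T - {a})" by blast
    have g2': "continuous_on D g2" "\<And>x. x \<in> B \<Longrightarrow> g2 x = mat 1"
      using homotopic_with_imp_continuous_maps[OF g2(1)] homotopic_with_imp_property[OF g2(1)]
      by (auto simp: continuous_map_in_subtopology)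
    have "card (T - {a}) < card T" using ab(1) by (intro psubset_card_mono) auto
    from less.hyps[OF this g2'(1) g2(2) g2'(2)] obtain T' g' where T': "inj_on \<sigma> T'"
      "?h (block_GL \<sigma> UNIV) g2 g'" "\<forall>x\<in>D. g' x \<in> block_GL \<sigma> T'" by blast
    have "?h (block_GL \<sigma> UNIV) g g2"
      using homotopic_with_trans[OF g1(1) g2(1)] mono homotopic_with_subset_right by blast
    from homotopic_with_trans[OF this T'(2)] T'(1,3) show ?thesis by blast
  qed
qed

section \<open>Logarithms vanishing on a subset\<close>

text \<open>Such a logarithm can be scaled down to 0, which contracts f in the punctured plane
  relative to B.\<close>

definition rel_log :: "'a::topological_space set \<Rightarrow> 'a set \<Rightarrow> ('a \<Rightarrow> complex) \<Rightarrow> bool" where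
  "rel_log D B f \<longleftrightarrow> (\<exists>L. continuous_on D L \<and> (\<forall>x\<in>D. exp (L x) = f x) \<and> (\<forall>x\<in>B. L x = 0))"

text \<open>The values of L lie in the multiples of 2 pi i, which are at distance at least 2 pi from
  each other.\<close>

lemma exp_eq_1_constant:
  fixes L :: "'a::topological_space \<Rightarrow> complex"
  assumes S: "connected S" and L: "continuous_on S L" "\<And>x. x \<in> S \<Longrightarrow> exp (L x) = 1"
    and xy: "x \<in> S" "y \<in> S"
  shows "L x = L y"
proof -
  have "L constant_on S"
  proof (rule continuous_discrete_range_constant[OF S L(1)])
    fix x assume x: "x \<in> S"
    show "\<exists>e>0. \<forall>y. y \<in> S \<and> L y \<noteq> L x \<longrightarrow> e \<le> cmod (L y - L x)"
    proof (intro exI[of _ "2 * pi"] conjI allI impI)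
      fix y assume y: "y \<in> S \<and> L y \<noteq> L x"
      then have "exp (L y - L x) = 1" using L(2) x by (simp add: exp_diff)
      then obtain n :: int where n: "Re (L y - L x) = 0" "Im (L y - L x) = of_int (2 * n) * pi"
        by (auto simp: exp_eq_1)
      with y have "n \<noteq> 0" by (auto simp: complex_eq_iff)
      then have "1 \<le> \<bar>real_of_int n\<bar>" by linarith
      then have "2 * pi * 1 \<le> 2 * pi * \<bar>real_of_int n\<bar>" by (intro mult_left_mono) auto
      also have "\<dots> = \<bar>Im (L y - L x)\<bar>" unfolding n by (simp add: abs_mult)
      also have "\<dots> \<le> cmod (L y - L x)" by (rule abs_Im_le_cmod)
      finally show "2 * pi \<le> cmod (L y - L x)" by simp
    qed simp
  qed
  then show ?thesis using xy by (auto simp: constant_on_def)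
qed

text \<open>The cylinder over a convex set is contractible, so h has a logarithm on it. It differs
  at time 0 from the given one by a constant, and over a point of B it does not change with time
  because h stays 1 there.\<close>

lemma rel_log_homotopy:
  fixes h :: "real \<times> 'a::euclidean_space \<Rightarrow> complex"
  assumes D: "convex D" and B: "B \<subseteq> D" and h: "continuous_on ({0..1} \<times> D) h"
    and h0: "\<And>t x. t \<in> {0..1} \<Longrightarrow> x \<in> D \<Longrightarrow> h (t,x) \<noteq> 0"
    and hB: "\<And>t x. t \<in> {0..1} \<Longrightarrow> x \<in> B \<Longrightarrow> h (t,x) = 1"
    and log: "rel_log D B (\<lambda>x. h (0,x))"
  shows "rel_log D B (\<lambda>x. h (1,x))"
proof (cases "D = {}")
  case True then show ?thesis using B by (simp add: rel_log_def)
next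
  case False
  then obtain x0 where x0: "x0 \<in> D" by blast
  have "contractible ({0..1::real} \<times> D)" by (intro convex_imp_contractible convex_Times D) auto
  then obtain L where L: "continuous_on ({0..1} \<times> D) L" "\<And>p. p \<in> {0..1} \<times> D \<Longrightarrow> h p = exp (L p)"
    using continuous_logarithm_on_contractible[OF h] h0 by (metis SigmaE)
  obtain L0 where L0: "continuous_on D L0" "\<And>x. x \<in> D \<Longrightarrow> exp (L0 x) = h (0,x)" "\<And>x. x \<in> B \<Longrightarrow> L0 x = 0"
    using log by (auto simp: rel_log_def)
  have contL: "continuous_on D (\<lambda>x. L (t,x))" if "t \<in> {0..1}" for t
    by (rule continuous_on_compose2[OF L(1)]) (use that in \<open>auto intro!: continuous_intros\<close>)
  define c where "c = L (0,x0) - L0 x0"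
  have "exp (L (0,x) - L0 x) = 1" if "x \<in> D" for x
    using L(2)[of "(0,x)"] L0(2)[of x] that h0[of 0 x] by (simp add: exp_diff)
  then have c: "L (0,x) - L0 x = c" if "x \<in> D" for x
    using exp_eq_1_constant[of D "\<lambda>x. L (0,x) - L0 x" x x0] that x0 contL[of 0] L0(1) convex_connected[OF D]
    using continuous_on_diff[OF contL[of 0] L0(1)] by (auto simp: c_def)
  have expc: "exp c = 1"
    using L(2)[of "(0,x0)"] L0(2)[of x0] x0 h0[of 0 x0] by (simp add: c_def exp_diff)
  show ?thesis
    unfolding rel_log_def
  proof (intro exI[of _ "\<lambda>x. L (1,x) - c"] conjI ballI)
    show "continuous_on D (\<lambda>x. L (1,x) - c)" using contL[of 1] by (intro continuous_intros) auto
    show "exp (L (1,x) - c) = h (1,x)" if "x \<in> D" for x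
      using L(2)[of "(1,x)"] that expc by (simp add: exp_diff)
    show "L (1,x) - c = 0" if x: "x \<in> B" for x
    proof -
      have "continuous_on {0..1::real} (\<lambda>t. L (t,x))"
        by (rule continuous_on_compose2[OF L(1)]) (use x B in \<open>auto intro!: continuous_intros\<close>)
      moreover have "exp (L (t,x)) = 1" if "t \<in> {0..1}" for t
        using L(2)[of "(t,x)"] hB[OF that x] that x B by auto
      ultimately have "L (1,x) = L (0,x)"
        by (intro exp_eq_1_constant[of "{0..1::real}" "\<lambda>t. L (t,x)"]) auto
      then show ?thesis using c[of x] L0(3)[OF x] x B by auto
    qed
  qed
qed

section \<open>Null homotopic families of block matrices\<close>

text \<open>The reduction to diagonal form preserves the relative logarithms of the block
  determinants, and for the reduced family these are logarithms of the remaining diagonal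
  entries.\<close>

lemma block_GL_rel_nullhomotopic:
  fixes g :: "'a::euclidean_space \<Rightarrow> complex^'n^'n"
  assumes dim: "DIM('a) \<le> 2" and D: "compact D" "convex D" and B: "B \<subseteq> D"
    and g: "continuous_on D g" and gT: "\<And>x. x \<in> D \<Longrightarrow> g x \<in> block_GL \<sigma> UNIV"
    and gB: "\<And>x. x \<in> B \<Longrightarrow> g x = mat 1"
    and log: "\<And>a. rel_log D B (\<lambda>x. block_det \<sigma> (\<sigma> a) (g x))"
  shows "rel_homotopic B (mat 1) D (block_GL \<sigma> UNIV) g (\<lambda>_. mat 1)"
proof -
  obtain T g' where T: "inj_on \<sigma> T" and
    hom: "rel_homotopic B (mat 1) D (block_GL \<sigma> UNIV) g g'"
    and g'T: "\<And>x. x \<in> D \<Longrightarrow> g' x \<in> block_GL \<sigma> T"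
    using homotopic_to_inj_pattern[OF dim D(1) B g gT gB] by blast
  have g'B: "g' x = mat 1" if "x \<in> B" for x
    using homotopic_with_imp_property[OF hom] that by auto
  obtain h :: "real \<times> 'a \<Rightarrow> complex^'n^'n" where h: "continuous_on ({0..1} \<times> D) h"
    "\<And>t x. t \<in> {0..1} \<Longrightarrow> x \<in> D \<Longrightarrow> h (t,x) \<in> block_GL \<sigma> UNIV"
    "\<And>x. h (0,x) = g x" "\<And>x. h (1,x) = g' x" "\<And>t x. t \<in> {0..1} \<Longrightarrow> x \<in> B \<Longrightarrow> h (t,x) = mat 1"
    by (rule rel_homotopicE[OF hom], rule that)
  have "rel_log D B (\<lambda>x. block_det \<sigma> (\<sigma> a) (h (1,x)))" for a
  proof (rule rel_log_homotopy[OF D(2) B])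
    show "continuous_on ({0..1} \<times> D) (\<lambda>p. block_det \<sigma> (\<sigma> a) (h p))" by (intro continuous_intros h)
    show "block_det \<sigma> (\<sigma> a) (h (t,x)) \<noteq> 0" if "t \<in> {0..1}" "x \<in> D" for t x
      by (rule block_det_nonzero[OF h(2)[OF that]])
  qed (use h log in auto)
  then have log': "rel_log D B (\<lambda>x. block_det \<sigma> (\<sigma> a) (g' x))" for a by (simp add: h(4))
  have diag: "g' x = diag_mat (\<lambda>a. if a \<in> T then g' x $ a $ a else 1)" if "x \<in> D" for x
    unfolding vec_eq_iff
  proof (intro allI)
    fix i j
    show "g' x $ i $ j = diag_mat (\<lambda>a. if a \<in> T then g' x $ a $ a else 1) $ i $ j"
    proof (cases "i = j \<and> i \<in> T")
      case False
      then have "\<not> (i \<in> T \<and> j \<in> T \<and> \<sigma> i = \<sigma> j)" using T by (auto simp: inj_on_def)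
      then have "g' x $ i $ j = (mat 1 :: complex^'n^'n) $ i $ j"
        using g'T[OF that] unfolding block_GL_def pattern_def by blast
      then show ?thesis using False by (auto simp: diag_mat_def mat_def)
    qed (auto simp: diag_mat_def)
  qed
  \<comment> \<open>Each label occurs at most once in \<open>T\<close>, so the block determinant is
    the single active entry of the block.\<close>
  have entry: "block_det \<sigma> (\<sigma> a) (g' x) = g' x $ a $ a" if "x \<in> D" "a \<in> T" for x a
  proof -
    have "block_det \<sigma> (\<sigma> a) (g' x) = (\<Prod>b\<in>UNIV. if \<sigma> b = \<sigma> a then if b \<in> T then g' x $ b $ b else 1 else 1)"
      by (subst diag[OF that(1)]) (rule block_det_diag_mat)
    also have "\<dots> = (\<Prod>b\<in>UNIV. if b = a then g' x $ a $ a else 1)"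
      using T that(2) by (intro prod.cong) (auto simp: inj_on_def)
    finally show ?thesis by simp
  qed
  have "\<forall>a. \<exists>L. continuous_on D L \<and> (\<forall>x\<in>D. exp (L x) = block_det \<sigma> (\<sigma> a) (g' x)) \<and> (\<forall>x\<in>B. L x = 0)"
    using log' by (simp add: rel_log_def)
  then obtain L where L: "\<And>a. continuous_on D (L a)" "\<And>a x. x \<in> D \<Longrightarrow> exp (L a x) = block_det \<sigma> (\<sigma> a) (g' x)"
     "\<And>a x. x \<in> B \<Longrightarrow> L a x = 0" by metis
  \<comment> \<open>Scaling the logarithms to 0 contracts all entries to 1; on \<open>B\<close> they
    are 0 throughout.\<close>
  define k where "k p = diag_mat (\<lambda>a. if a \<in> T then exp (of_real (1 - fst p) * L a (snd p)) else 1)" for p :: "real \<times> 'a"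
  have one: "diag_mat (\<lambda>_. 1) = (mat 1 :: complex^'n^'n)" by (simp add: diag_mat_def mat_def)
  have "rel_homotopic B (mat 1) D (block_GL \<sigma> UNIV) g' (\<lambda>_. mat 1)"
  proof (rule rel_homotopicI[where h = k])
    show "continuous_on ({0..1} \<times> D) k"
      unfolding k_def diag_mat_def
    proof (intro continuous_on_vec_lambda)
      fix i j
      show "continuous_on ({0..1} \<times> D) (\<lambda>p. if i = j then if i \<in> T then exp (of_real (1 - fst p) * L i (snd p)) else 1 else 0)"
        by (cases "i = j"; cases "i \<in> T") (auto intro!: continuous_intros continuous_on_compose2[OF L(1)])
    qed
    show "k (t,x) \<in> block_GL \<sigma> UNIV" for t x
      unfolding k_def by (intro diag_mat_in_block_GL) auto
    show "k (0,x) = g' x" if "x \<in> D" for x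
    proof -
      have "k (0,x) = diag_mat (\<lambda>a. if a \<in> T then g' x $ a $ a else 1)"
        by (auto simp: k_def L(2)[OF that] entry[OF that] intro!: arg_cong[of _ _ diag_mat])
      then show ?thesis by (simp only: diag[OF that, symmetric])
    qed
    show "k (1,x) = mat 1" for x
      by (simp add: k_def one cong: if_cong)
    show "k (t,x) = mat 1" if "x \<in> B" for t x
      using that by (simp add: k_def L(3) one cong: if_cong)
  qed (rule B)
  from homotopic_with_trans[OF hom this] show ?thesis .
qed

section \<open>Degrees of loops\<close>

text \<open>The winding number of a loop based at 1, normalized by a logarithm that starts at
  0.\<close>

definition has_degree :: "(real \<Rightarrow> complex) \<Rightarrow> int \<Rightarrow> bool" where
  "has_degree f d \<longleftrightarrow> (\<exists>L. continuous_on {0..1} L \<and> L 0 = 0 \<and> L 1 = 2 * pi * \<i> * of_int d \<and>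
     (\<forall>s\<in>{0..1}. exp (L s) = f s))"

lemma has_degree_exists:
  assumes f: "continuous_on {0..1} f" "\<And>s. s \<in> {0..1} \<Longrightarrow> f s \<noteq> 0" and f01: "f 0 = 1" "f 1 = 1"
  shows "\<exists>d. has_degree f d"
proof -
  have "contractible {0..1::real}" by (intro convex_imp_contractible) auto
  then obtain L where L: "continuous_on {0..1} L" "\<And>s. s \<in> {0..1} \<Longrightarrow> f s = exp (L s)"
    using continuous_logarithm_on_contractible[OF f(1)] f(2) by metis
  have e0: "exp (L 0) = 1" and e1: "exp (L 1) = 1" using L(2)[of 0] L(2)[of 1] f01 by auto
  then have "exp (L 1 - L 0) = 1" by (simp add: exp_diff)
  then obtain d :: int where "Re (L 1 - L 0) = 0" "Im (L 1 - L 0) = of_int (2 * d) * pi"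
    by (auto simp: exp_eq_1)
  then have "L 1 - L 0 = 2 * pi * \<i> * of_int d" by (auto simp: complex_eq_iff)
  then have "has_degree f d"
    unfolding has_degree_def
    by (intro exI[of _ "\<lambda>s. L s - L 0"]) (auto intro!: continuous_intros L simp: exp_diff e0 L(2))
  then show ?thesis ..
qed

lemma has_degree_unique:
  assumes "has_degree f d" "has_degree f e"
  shows "d = e"
proof -
  obtain L M where L: "continuous_on {0..1} L" "L 0 = 0" "L 1 = 2 * pi * \<i> * of_int d" "\<And>s. s \<in> {0..1} \<Longrightarrow> exp (L s) = f s"
    and M: "continuous_on {0..1} M" "M 0 = 0" "M 1 = 2 * pi * \<i> * of_int e" "\<And>s. s \<in> {0..1} \<Longrightarrow> exp (M s) = f s"
    using assms by (auto simp: has_degree_def)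
  have "L 1 - M 1 = L 0 - M 0"
  proof (rule exp_eq_1_constant[of "{0..1::real}" "\<lambda>s. L s - M s"])
    show "exp (L s - M s) = 1" if "s \<in> {0..1}" for s
      using L(4)[OF that] M(4)[OF that] by (metis divide_self exp_diff exp_not_eq_zero)
  qed (auto intro!: continuous_intros L M)
  then show ?thesis using L(2,3) M(2,3) by simp
qed

lemma has_degree_mult:
  assumes "has_degree f d" "has_degree g e"
  shows "has_degree (\<lambda>s. f s * g s) (d + e)"
proof -
  obtain L M where L: "continuous_on {0..1} L" "L 0 = 0" "L 1 = 2 * pi * \<i> * of_int d" "\<And>s. s \<in> {0..1} \<Longrightarrow> exp (L s) = f s"
    and M: "continuous_on {0..1} M" "M 0 = 0" "M 1 = 2 * pi * \<i> * of_int e" "\<And>s. s \<in> {0..1} \<Longrightarrow> exp (M s) = g s"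
    using assms by (auto simp: has_degree_def)
  show ?thesis
    unfolding has_degree_def
    by (intro exI[of _ "\<lambda>s. L s + M s"]) (auto intro!: continuous_intros L M simp: L M exp_add algebra_simps)
qed

lemma has_degree_1: "has_degree (\<lambda>_. 1) 0"
  unfolding has_degree_def by (intro exI[of _ "\<lambda>_. 0"]) auto

lemma has_degree_prod:
  "(\<And>j. j < m \<Longrightarrow> has_degree (f j) (d j)) \<Longrightarrow> has_degree (\<lambda>s. \<Prod>j<m. f j s) (\<Sum>j<m. d j)" for m :: nat
  by (induction m) (auto intro: has_degree_mult has_degree_1)

lemma has_degree_cong: "has_degree f d \<Longrightarrow> (\<And>s. s \<in> {0..1} \<Longrightarrow> f s = g s) \<Longrightarrow> has_degree g d"
  unfolding has_degree_def by auto

lemma has_degree_join: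
  assumes "has_degree f d" "has_degree g e"
  shows "has_degree (\<lambda>s. if s \<le> 1/2 then f (2 * s) else g (2 * s - 1)) (d + e)"
proof -
  obtain L M where L: "continuous_on {0..1} L" "L 0 = 0" "L 1 = 2 * pi * \<i> * of_int d" "\<And>s. s \<in> {0..1} \<Longrightarrow> exp (L s) = f s"
    and M: "continuous_on {0..1} M" "M 0 = 0" "M 1 = 2 * pi * \<i> * of_int e" "\<And>s. s \<in> {0..1} \<Longrightarrow> exp (M s) = g s"
    using assms by (auto simp: has_degree_def)
  have e: "exp (2 * pi * \<i> * of_int d) = 1"
    using exp_eq_1[of "2 * pi * \<i> * of_int d"] by auto
  \<comment> \<open>The shift by \<open>L 1\<close> glues the two logarithms; being a multiple of 2
    pi i, it is invisible after exponentiation.\<close>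
  define N where "N s = (if s \<le> 1/2 then L (2 * s) else M (2 * s - 1) + L 1)" for s
  have "continuous_on {0..1} N"
    unfolding N_def
  proof (rule continuous_on_cases_le)
    show "continuous_on {t \<in> {0..1}. t \<le> 1/2} (\<lambda>s. L (2 * s))"
      by (rule continuous_on_compose2[OF L(1)]) (auto intro!: continuous_intros)
    have "continuous_on {t \<in> {0..1}. 1/2 \<le> t} (\<lambda>s. M (2 * s - 1))"
      by (rule continuous_on_compose2[OF M(1)]) (auto intro!: continuous_intros)
    then show "continuous_on {t \<in> {0..1}. 1/2 \<le> t} (\<lambda>s. M (2 * s - 1) + L 1)"
      by (intro continuous_intros)
    show "L (2 * s) = M (2 * s - 1) + L 1" if "s \<in> {0..1}" "s = 1/2" for s
      unfolding that(2) using M(2) by simp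
  qed (auto simp: continuous_on_id)
  then show ?thesis
    unfolding has_degree_def
    by (intro exI[of _ N]) (auto simp: N_def L M e exp_add algebra_simps)
qed

section \<open>Maps on the unit square and joins of spheroids\<close>

lemma mem_unit_square: "x \<in> unit_square \<longleftrightarrow> fst x \<in> {0..1} \<and> snd x \<in> {0..1}"
  by (auto simp: unit_square_def mem_Times_iff)

lemma mem_frontier: "x \<in> frontier unit_square \<longleftrightarrow>
    fst x \<in> {0..1} \<and> snd x \<in> {0..1} \<and> (fst x \<in> {0,1} \<or> snd x \<in> {0,1})"
proof -
  have "closed unit_square" unfolding unit_square_def by (intro closed_Times) auto
  then show ?thesis
    by (auto simp: frontier_def unit_square_def interior_Times mem_Times_iff)
qed

text \<open>The bottom side connects the two vertical sides, so a logarithm that is 0 at the corner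
  stays 0 along all three; the top side is left free.\<close>

lemma square_logarithm:
  fixes f :: "real \<times> real \<Rightarrow> complex"
  assumes f: "continuous_on unit_square f" "\<And>x. x \<in> unit_square \<Longrightarrow> f x \<noteq> 0"
    and f1: "\<And>s. s \<in> {0..1} \<Longrightarrow> f (s,0) = 1 \<and> f (0,s) = 1 \<and> f (1,s) = 1"
  obtains L where "continuous_on unit_square L" "\<And>x. x \<in> unit_square \<Longrightarrow> exp (L x) = f x"
    "\<And>s. s \<in> {0..1} \<Longrightarrow> L (s,0) = 0 \<and> L (0,s) = 0 \<and> L (1,s) = 0"
proof -
  have "contractible unit_square"
    unfolding unit_square_def by (intro convex_imp_contractible convex_Times) auto
  then obtain M where M: "continuous_on unit_square M" "\<And>x. x \<in> unit_square \<Longrightarrow> f x = exp (M x)"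
    using continuous_logarithm_on_contractible[OF f(1)] f(2) by metis
  define L where "L x = M x - M (0,0)" for x
  have e: "exp (M (0,0)) = 1" using M(2)[of "(0,0)"] f1[of 0] by (simp add: unit_square_def)
  have L: "continuous_on unit_square L" unfolding L_def by (intro continuous_intros M)
  have expL: "exp (L x) = f x" if "x \<in> unit_square" for x
    using M(2)[OF that] e by (simp add: L_def exp_diff)
  have const: "L x = L y" if "convex S" "S \<subseteq> unit_square" "\<And>z. z \<in> S \<Longrightarrow> f z = 1" "x \<in> S" "y \<in> S" for S x y
  proof (rule exp_eq_1_constant[OF convex_connected[OF that(1)] continuous_on_subset[OF L that(2)] _ that(4,5)])
    show "exp (L z) = 1" if "z \<in> S" for z
      using expL[of z] \<open>S \<subseteq> unit_square\<close> \<open>\<And>z. z \<in> S \<Longrightarrow> f z = 1\<close> that by auto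
  qed
  have L0: "L (0,0) = 0" by (simp add: L_def)
  have S: "{0..1} \<times> {0} \<subseteq> unit_square" "{0} \<times> {0..1} \<subseteq> unit_square" "{1} \<times> {0..1} \<subseteq> unit_square"
    by (auto simp: unit_square_def)
  have "L (s,0) = 0" "L (0,s) = 0" if "s \<in> {0..1}" for s
    using const[OF _ S(1), of "(s,0)" "(0,0)"] const[OF _ S(2), of "(0,s)" "(0,0)"] L0 f1 that
    by (auto simp: convex_Times)
  moreover have "L (1,s) = 0" if "s \<in> {0..1}" for s
    using const[OF _ S(3), of "(1,s)" "(1,0)"] f1 that calculation(1)[of 1]
    by (auto simp: convex_Times)
  ultimately show thesis by (intro that[OF L expL]) auto
qed

text \<open>The logarithm on the square vanishes on both vertical sides, so along the top it starts
  and ends at 0.\<close>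

lemma has_degree_extends_0:
  fixes f :: "real \<times> real \<Rightarrow> complex"
  assumes f: "continuous_on unit_square f" "\<And>x. x \<in> unit_square \<Longrightarrow> f x \<noteq> 0"
    and f1: "\<And>s. s \<in> {0..1} \<Longrightarrow> f (s,0) = 1 \<and> f (0,s) = 1 \<and> f (1,s) = 1"
  shows "has_degree (\<lambda>s. f (s,1)) 0"
proof -
  obtain L where L: "continuous_on unit_square L" "\<And>x. x \<in> unit_square \<Longrightarrow> exp (L x) = f x"
    "\<And>s. s \<in> {0..1} \<Longrightarrow> L (s,0) = 0 \<and> L (0,s) = 0 \<and> L (1,s) = 0"
    using square_logarithm[OF f f1] by blast
  have "continuous_on {0..1} (\<lambda>s. L (s,1))"
    by (rule continuous_on_compose2[OF L(1)]) (auto intro!: continuous_intros simp: unit_square_def)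
  then show ?thesis
    unfolding has_degree_def using L(2) L(3)[of 1]
    by (intro exI[of _ "\<lambda>s. L (s,1)"]) (auto simp: unit_square_def)
qed

lemma rel_log_square:
  fixes f :: "real \<times> real \<Rightarrow> complex"
  assumes f: "continuous_on unit_square f" "\<And>x. x \<in> unit_square \<Longrightarrow> f x \<noteq> 0"
    and f1: "\<And>x. x \<in> frontier unit_square \<Longrightarrow> f x = 1"
  shows "rel_log unit_square (frontier unit_square) f"
proof -
  have sides: "f (s,0) = 1 \<and> f (0,s) = 1 \<and> f (1,s) = 1" if "s \<in> {0..1}" for s
    using that f1 by (auto simp: mem_frontier)
  obtain L where L: "continuous_on unit_square L" "\<And>x. x \<in> unit_square \<Longrightarrow> exp (L x) = f x"
    "\<And>s. s \<in> {0..1} \<Longrightarrow> L (s,0) = 0 \<and> L (0,s) = 0 \<and> L (1,s) = 0"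
    using square_logarithm[OF f sides] by blast
  have "L (s,1) = L (0,1)" if "s \<in> {0..1}" for s
  proof (rule exp_eq_1_constant[of "{0..1} \<times> {1}" L])
    show "continuous_on ({0..1} \<times> {1}) L"
      by (rule continuous_on_subset[OF L(1)]) (auto simp: unit_square_def)
  qed (use that L(2) f1 in \<open>auto simp: mem_unit_square mem_frontier convex_Times intro!: convex_connected\<close>)
  then show ?thesis
    unfolding rel_log_def using L
    by (intro exI[of _ L]) (auto simp: mem_frontier)
qed

text \<open>Asks only for matching vertical sides, because matrix lifts, which need not be constant
  on the top side, are joined as well.\<close>

lemma continuous_map_spheroid_join:
  assumes f: "continuous_map (top_of_set unit_square) X f" and g: "continuous_map (top_of_set unit_square) X g"
    and fg: "\<And>t. t \<in> {0..1} \<Longrightarrow> f (1,t) = g (0,t)"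
  shows "continuous_map (top_of_set unit_square) X (spheroid_join f g)"
proof -
  let ?l = "\<lambda>x::real \<times> real. (2 * fst x, snd x)" and ?r = "\<lambda>x::real \<times> real. (2 * fst x - 1, snd x)"
  have "continuous_map (top_of_set unit_square) X (\<lambda>x. if fst x \<le> 1/2 then (f \<circ> ?l) x else (g \<circ> ?r) x)"
  proof (rule continuous_map_cases_le)
    show "continuous_map (subtopology (top_of_set unit_square) {x \<in> topspace (top_of_set unit_square). fst x \<le> 1/2}) X (f \<circ> ?l)"
      by (rule continuous_map_compose[OF _ f])
        (auto simp: subtopology_subtopology continuous_map_in_subtopology unit_square_def intro!: continuous_intros)
    show "continuous_map (subtopology (top_of_set unit_square) {x \<in> topspace (top_of_set unit_square). 1/2 \<le> fst x}) X (g \<circ> ?r)"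
      by (rule continuous_map_compose[OF _ g])
        (auto simp: subtopology_subtopology continuous_map_in_subtopology unit_square_def intro!: continuous_intros)
    show "(f \<circ> ?l) x = (g \<circ> ?r) x" if "x \<in> topspace (top_of_set unit_square)" "fst x = 1/2" for x
    proof -
      have "2 * fst x = 1" "2 * fst x - 1 = 0" using that(2) by auto
      then show ?thesis using that(1) fg[of "snd x"] by (simp add: mem_unit_square)
    qed
  qed (auto intro!: continuous_intros)
  then show ?thesis by (simp only: spheroid_join_def case_prod_unfold o_def)
qed

lemma spheroid_join_in_spheroids:
  assumes "f \<in> spheroids X p" "g \<in> spheroids X p"
  shows "spheroid_join f g \<in> spheroids X p"
proof -
  have b: "f x = p" "g x = p" if "fst x \<in> {0..1} \<and> snd x \<in> {0..1}" "fst x \<in> {0,1} \<or> snd x \<in> {0,1}" for x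
    using assms that by (auto simp: spheroids_def mem_frontier)
  have "continuous_map (top_of_set unit_square) X (spheroid_join f g)"
    using assms b by (intro continuous_map_spheroid_join) (auto simp: spheroids_def unit_square_def)
  moreover have "spheroid_join f g x = p" if "x \<in> frontier unit_square" for x
    using that by (cases x) (auto simp: spheroid_join_def mem_frontier mem_unit_square intro!: b)
  ultimately show ?thesis by (auto simp: spheroids_def)
qed

text \<open>For a complete invariant c the homotopy classes are the fibres of c. Additivity under
  joins then gives both that the product of classes is well defined and that c is a
  homomorphism.\<close>

lemma pi2_iso_invariant:
  fixes c :: "(real \<times> real \<Rightarrow> 'x) \<Rightarrow> 'g"
  assumes carrier: "\<And>f. f \<in> spheroids X p \<Longrightarrow> c f \<in> carrier G"
    and surj: "\<And>y. y \<in> carrier G \<Longrightarrow> \<exists>f\<in>spheroids X p. c f = y"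
    and rel: "\<And>f g. f \<in> spheroids X p \<Longrightarrow> g \<in> spheroids X p \<Longrightarrow> (f, g) \<in> spheroid_rel X p \<longleftrightarrow> c f = c g"
    and join: "\<And>f g. f \<in> spheroids X p \<Longrightarrow> g \<in> spheroids X p \<Longrightarrow> c (spheroid_join f g) = c f \<otimes>\<^bsub>G\<^esub> c g"
  shows "pi2 X p \<cong> G"
proof -
  let ?S = "spheroids X p"
  define K where "K y = {f \<in> ?S. c f = y}" for y
  have cls: "spheroid_rel X p `` {f} = K (c f)" if "f \<in> ?S" for f
    using rel that by (auto simp: K_def spheroid_rel_def)
  have K_ne: "K y \<noteq> {}" if "y \<in> carrier G" for y using surj[OF that] by (auto simp: K_def)
  have car: "carrier (pi2 X p) = K ` carrier G"
  proof -
    have "carrier (pi2 X p) = (\<lambda>f. spheroid_rel X p `` {f}) ` ?S"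
      by (auto simp: pi2_def quotient_def)
    also have "\<dots> = (\<lambda>f. K (c f)) ` ?S" using cls by (intro image_cong) auto
    also have "\<dots> = K ` (c ` ?S)" by (simp add: image_image)
    also have "c ` ?S = carrier G" using carrier surj by force
    finally show ?thesis .
  qed
  have mult: "K y \<otimes>\<^bsub>pi2 X p\<^esub> K z = K (y \<otimes>\<^bsub>G\<^esub> z)" if "y \<in> carrier G" "z \<in> carrier G" for y z
  proof -
    have "spheroid_rel X p `` {spheroid_join f g} = K (y \<otimes>\<^bsub>G\<^esub> z)" if "f \<in> K y" "g \<in> K z" for f g
    proof -
      have fg: "f \<in> ?S" "g \<in> ?S" "c f = y" "c g = z" using that by (auto simp: K_def)
      show ?thesis
        unfolding cls[OF spheroid_join_in_spheroids[OF fg(1,2)]] join[OF fg(1,2)] fg(3,4) ..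
    qed
    then show ?thesis using K_ne[OF that(1)] K_ne[OF that(2)] by (auto simp: pi2_def)
  qed
  define \<phi> where "\<phi> A = c (SOME f. f \<in> A)" for A
  have \<phi>: "\<phi> (K y) = y" if "y \<in> carrier G" for y
    using some_in_eq[of "K y"] K_ne[OF that] by (simp add: \<phi>_def K_def)
  have "\<phi> \<in> iso (pi2 X p) G"
    unfolding iso_def hom_def bij_betw_def car
  proof (intro CollectI conjI)
    show "\<forall>x\<in>K ` carrier G. \<forall>y\<in>K ` carrier G. \<phi> (x \<otimes>\<^bsub>pi2 X p\<^esub> y) = \<phi> x \<otimes>\<^bsub>G\<^esub> \<phi> y"
    proof (intro ballI)
      fix x y assume "x \<in> K ` carrier G" "y \<in> K ` carrier G"
      then obtain u v where uv: "u \<in> carrier G" "v \<in> carrier G" "x = K u" "y = K v" by blast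
      obtain f g where fg: "f \<in> ?S" "g \<in> ?S" "c f = u" "c g = v" using surj uv by metis
      have "u \<otimes>\<^bsub>G\<^esub> v \<in> carrier G"
        using carrier[OF spheroid_join_in_spheroids[OF fg(1,2)]] join[OF fg(1,2)] fg(3,4) by simp
      then show "\<phi> (x \<otimes>\<^bsub>pi2 X p\<^esub> y) = \<phi> x \<otimes>\<^bsub>G\<^esub> \<phi> y" using uv by (simp add: mult \<phi>)
    qed
    show "inj_on \<phi> (K ` carrier G)" by (intro inj_onI) (auto simp: \<phi>)
    show "\<phi> ` K ` carrier G = carrier G" using \<phi> by (force simp: image_image)
  qed (use \<phi> in auto)
  then show ?thesis by (auto simp: is_iso_def)
qed

section \<open>The second homotopy group of a space of idempotent decompositions\<close>

text \<open>\<open>E\<close> assigns idempotents to a point and \<open>\<rho>\<close> is the orbit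
  map through p. An invertible matrix that intertwines the standard idempotents with those of x is
  sent to x; the converse is demanded for unitary matrices only, since \<open>E\<close> will be
  built from orthogonal complements.\<close>

locale decomposition_space =
  fixes X :: "'x topology" and p :: 'x and \<sigma> :: "'n::finite \<Rightarrow> nat" and r :: nat
    and E :: "'x \<Rightarrow> nat \<Rightarrow> complex^'n^'n" and \<rho> :: "complex^'n^'n \<Rightarrow> 'x"
  assumes range_\<sigma>: "range \<sigma> = {..<r}"
    and p_in: "p \<in> topspace X"
    and E_cont: "\<And>j. j < r \<Longrightarrow> continuous_map X euclidean (\<lambda>x. E x j)"
    and E_sum: "\<And>x. x \<in> topspace X \<Longrightarrow> (\<Sum>j<r. E x j) = mat 1"
    and E_mult: "\<And>x i j. x \<in> topspace X \<Longrightarrow> i < r \<Longrightarrow> j < r \<Longrightarrow> E x i ** E x j = (if i = j then E x i else 0)"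
    and E_p: "\<And>j. j < r \<Longrightarrow> E p j = block_idem \<sigma> j"
    and \<rho>_cont: "continuous_map (top_of_set {g. invertible g}) X \<rho>"
    and \<rho>_eq: "\<And>x g. x \<in> topspace X \<Longrightarrow> invertible g \<Longrightarrow> (\<And>j. j < r \<Longrightarrow> E x j ** g = g ** block_idem \<sigma> j) \<Longrightarrow> \<rho> g = x"
    and \<rho>_unitary: "\<And>g j. adj g ** g = mat 1 \<Longrightarrow> j < r \<Longrightarrow> E (\<rho> g) j ** g = g ** block_idem \<sigma> j"
begin

lemma \<rho>_comp_cont: "continuous_on S g \<Longrightarrow> (\<And>x. x \<in> S \<Longrightarrow> invertible (g x)) \<Longrightarrow> continuous_map (top_of_set S) X (\<lambda>x. \<rho> (g x))"
  using continuous_map_compose[OF _ \<rho>_cont, of "top_of_set S" g]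
  by (auto simp: continuous_map_in_subtopology o_def)

lemma E_comp_cont: "continuous_map (top_of_set S) X f \<Longrightarrow> j < r \<Longrightarrow> continuous_on S (\<lambda>x. E (f x) j)"
  using continuous_map_compose[OF _ E_cont, of "top_of_set S" f j] by (simp add: o_def)

lemma pattern_iff: "pattern \<sigma> UNIV A \<longleftrightarrow> (\<forall>j<r. block_idem \<sigma> j ** A = A ** block_idem \<sigma> j)"
proof -
  have "block_idem \<sigma> j = 0" if "\<not> j < r" for j
    using range_\<sigma> that by (auto simp: block_idem_def vec_eq_iff)
  then show ?thesis unfolding pattern_UNIV_iff by (metis times0_left times0_right)
qed

lemma \<rho>_block_GL: "A \<in> block_GL \<sigma> UNIV \<Longrightarrow> \<rho> A = p"
  by (rule \<rho>_eq[OF p_in]) (auto simp: block_GL_def pattern_iff E_p)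

text \<open>The sum over j of \<open>E\<close> at time s times \<open>E\<close> at time t
  intertwines the two decompositions and is the identity for s = t, so it serves as the single step.
  The clause about constant paths yields trivial matrices on the vertical sides of the
  square.\<close>

lemma transport_decomposition:
  fixes f :: "'z::metric_space \<times> real \<Rightarrow> 'x"
  assumes Z: "compact Z" and f: "continuous_map (top_of_set (Z \<times> {0..1})) X f"
  shows "\<exists>g. continuous_on (Z \<times> {0..1}) g \<and> (\<forall>z\<in>Z. \<forall>t\<in>{0..1}. invertible (g (z,t)) \<and>
     (\<forall>j<r. E (f (z,t)) j ** g (z,t) = g (z,t) ** E (f (z,0)) j) \<and> g (z,0) = mat 1 \<and>
     ((\<forall>t\<in>{0..1}. f (z,t) = f (z,0)) \<longrightarrow> g (z,t) = mat 1))"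
proof -
  define T where "T z s t = (\<Sum>j<r. E (f (z,s)) j ** E (f (z,t)) j)" for z s t
  define R where "R z s t A \<longleftrightarrow> (\<forall>j<r. E (f (z,s)) j ** A = A ** E (f (z,t)) j) \<and>
    ((\<forall>t\<in>{0..1}. f (z,t) = f (z,0)) \<longrightarrow> A = mat 1)" for z and s t :: real and A
  have fX: "f (z,t) \<in> topspace X" if "z \<in> Z" "t \<in> {0..1}" for z t
    using f that by (auto simp: continuous_map_def)
  have contE: "continuous_on (Z \<times> {0..1}) (\<lambda>x. E (f x) j)" if "j < r" for j
    by (rule E_comp_cont[OF f that])
  have contT: "continuous_on (Z \<times> {0..1} \<times> {0..1}) (\<lambda>(z,s,t). T z s t)"
    unfolding T_def case_prod_unfold
    by (intro continuous_on_sum continuous_on_matrix_mult continuous_on_compose2[OF contE])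
      (auto intro!: continuous_intros)
  have T_diag: "T z t t = mat 1" if "z \<in> Z" "t \<in> {0..1}" for z t
    using E_sum[OF fX[OF that]] E_mult[OF fX[OF that]] by (simp add: T_def)
  have R_step: "R z s t (T z s t)" if z: "z \<in> Z" and s: "s \<in> {0..1}" and t: "t \<in> {0..1}" for z s t
    unfolding R_def
  proof (intro conjI allI impI)
    fix j assume j: "j < r"
    have "E (f (z,s)) j ** T z s t = (\<Sum>i<r. if i = j then E (f (z,s)) j ** E (f (z,t)) j else 0)"
      unfolding T_def matrix_sum_ldistrib matrix_mul_assoc
      using E_mult[OF fX[OF z s] j] by (intro sum.cong) auto
    also have "\<dots> = (\<Sum>i<r. (E (f (z,s)) i ** E (f (z,t)) i) ** E (f (z,t)) j)"
      unfolding matrix_mul_assoc[symmetric]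
      using E_mult[OF fX[OF z t] _ j] by (intro sum.cong) auto
    also have "\<dots> = T z s t ** E (f (z,t)) j"
      unfolding T_def matrix_sum_rdistrib ..
    finally show "E (f (z,s)) j ** T z s t = T z s t ** E (f (z,t)) j" .
  next
    assume "\<forall>t\<in>{0..1}. f (z,t) = f (z,0)"
    then have "f (z,s) = f (z,0)" "f (z,t) = f (z,0)" using s t by blast+
    then have "T z s t = T z 0 0" by (simp only: T_def)
    then show "T z s t = mat 1" using T_diag[OF z, of 0] by simp
  qed
  obtain g :: "'z \<Rightarrow> real \<Rightarrow> complex^'n^'n" where "continuous_on (Z \<times> {0..1}) (\<lambda>(z,t). g z t)"
    "\<And>z t. z \<in> Z \<Longrightarrow> t \<in> {0..1} \<Longrightarrow> invertible (g z t)"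
    "\<And>z. z \<in> Z \<Longrightarrow> g z 0 = mat 1"
    "\<And>z t. z \<in> Z \<Longrightarrow> t \<in> {0..1} \<Longrightarrow> R z t 0 (g z t)"
  proof (rule transport[where Z = Z and T = T and R = R])
    show "R z t t (mat 1)" for z t by (simp add: R_def)
    show "R z s u (A ** B)" if "R z s t A" "R z t u B" for z s t u A B
      unfolding R_def
    proof (intro conjI allI impI)
      show "E (f (z,s)) j ** (A ** B) = A ** B ** E (f (z,u)) j" if "j < r" for j
        using \<open>R z s t A\<close> \<open>R z t u B\<close> that unfolding R_def by (metis matrix_mul_assoc)
      assume "\<forall>t\<in>{0..1}. f (z,t) = f (z,0)"
      then have "A = mat 1" "B = mat 1" using that unfolding R_def by blast+
      then show "A ** B = mat 1" by simp
    qed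
    show "compact Z" by (rule Z)
    show "continuous_on (Z \<times> {0..1} \<times> {0..1}) (\<lambda>(z,s,t). T z s t)" by (rule contT)
    show "T z t t = mat 1" if "z \<in> Z" "t \<in> {0..1}" for z t by (rule T_diag[OF that])
    show "R z s t (T z s t)" if "z \<in> Z" "s \<in> {0..1}" "t \<in> {0..1}" for z s t by (rule R_step[OF that])
  qed (rule that)
  then show ?thesis
    unfolding R_def by (intro exI[of _ "\<lambda>(z,t). g z t"] conjI ballI) (unfold prod.case, blast+)
qed

text \<open>Nothing is prescribed on the top side: the matrices there carry the class of the
  spheroid.\<close>

definition is_lift :: "(real \<times> real \<Rightarrow> 'x) \<Rightarrow> (real \<times> real \<Rightarrow> complex^'n^'n) \<Rightarrow> bool" where
  "is_lift f g \<longleftrightarrow> continuous_on unit_square g \<and>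
     (\<forall>x\<in>unit_square. invertible (g x) \<and> (\<forall>j<r. E (f x) j ** g x = g x ** block_idem \<sigma> j)) \<and>
     (\<forall>s\<in>{0..1}. g (s,0) = mat 1 \<and> g (0,s) = mat 1 \<and> g (1,s) = mat 1)"

text \<open>A relation, since \<open>d\<close> is determined only at indices below r.\<close>

definition has_class :: "(real \<times> real \<Rightarrow> 'x) \<Rightarrow> (nat \<Rightarrow> int) \<Rightarrow> bool" where
  "has_class f d \<longleftrightarrow> (\<exists>g. is_lift f g \<and> (\<forall>j<r. has_degree (\<lambda>s. block_det \<sigma> j (g (s,1))) (d j)))"

lemma spheroid_boundary:
  assumes "f \<in> spheroids X p" "s \<in> {0..1}"
  shows "f (s,0) = p" "f (s,1) = p" "f (0,s) = p" "f (1,s) = p"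
  using assms by (auto simp: spheroids_def mem_frontier mem_unit_square)

lemma spheroid_in: "f \<in> spheroids X p \<Longrightarrow> x \<in> unit_square \<Longrightarrow> f x \<in> topspace X"
  by (auto simp: spheroids_def continuous_map_def)

text \<open>Transport runs upwards from the bottom side, where the decomposition is the standard
  one. On the vertical sides f is constant, so nothing moves.\<close>

lemma lift_exists:
  assumes f: "f \<in> spheroids X p"
  shows "\<exists>g. is_lift f g"
proof -
  have "continuous_map (top_of_set ({0..1} \<times> {0..1})) X f"
    using f by (simp add: spheroids_def unit_square_def)
  from transport_decomposition[OF compact_Icc this] obtain g where g: "continuous_on ({0..1} \<times> {0..1}) g"
    "\<And>z t. z \<in> {0..1} \<Longrightarrow> t \<in> {0..1} \<Longrightarrow> invertible (g (z,t)) \<and>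
     (\<forall>j<r. E (f (z,t)) j ** g (z,t) = g (z,t) ** E (f (z,0)) j) \<and> g (z,0) = mat 1 \<and>
     ((\<forall>t\<in>{0..1}. f (z,t) = f (z,0)) \<longrightarrow> g (z,t) = mat 1)"
    by blast
  have "is_lift f g"
    unfolding is_lift_def
  proof (intro conjI ballI allI impI)
    show "continuous_on unit_square g" using g(1) by (simp add: unit_square_def)
    show "invertible (g x)" if "x \<in> unit_square" for x
      using that g(2)[of "fst x" "snd x"] by (auto simp: unit_square_def)
    show "E (f x) j ** g x = g x ** block_idem \<sigma> j" if "x \<in> unit_square" "j < r" for x j
      using that g(2)[of "fst x" "snd x"] spheroid_boundary(1)[OF f, of "fst x"] E_p[of j]
      by (auto simp: unit_square_def)
    show "g (s,0) = mat 1" if "s \<in> {0..1}" for s using g(2)[OF that, of 0] by simp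
    show "g (0,s) = mat 1" "g (1,s) = mat 1" if "s \<in> {0..1}" for s
      using g(2)[of 0 s] g(2)[of 1 s] that spheroid_boundary[OF f] by auto
  qed
  then show ?thesis by blast
qed

text \<open>Both lifts intertwine the standard idempotents with those of the same point, so their
  quotient commutes with the standard ones.\<close>

lemma lift_quotient:
  assumes g: "is_lift f g" and g': "is_lift f g'" and x: "x \<in> unit_square"
  shows "matrix_inv (g x) ** g' x \<in> block_GL \<sigma> UNIV"
proof -
  have inv: "invertible (g x)" "invertible (g' x)" using g g' x by (auto simp: is_lift_def)
  have "block_idem \<sigma> j ** (matrix_inv (g x) ** g' x) = matrix_inv (g x) ** g' x ** block_idem \<sigma> j" if j: "j < r" for j
  proof -
    have "block_idem \<sigma> j ** matrix_inv (g x) = matrix_inv (g x) ** (g x ** block_idem \<sigma> j) ** matrix_inv (g x)"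
      by (simp add: matrix_mul_assoc matrix_inv_left[OF inv(1)])
    also have "g x ** block_idem \<sigma> j = E (f x) j ** g x" using g x j by (simp add: is_lift_def)
    also have "matrix_inv (g x) ** (E (f x) j ** g x) ** matrix_inv (g x) = matrix_inv (g x) ** E (f x) j"
      by (simp add: matrix_inv_right[OF inv(1)] flip: matrix_mul_assoc)
    finally have "block_idem \<sigma> j ** (matrix_inv (g x) ** g' x) = matrix_inv (g x) ** (E (f x) j ** g' x)"
      by (simp add: matrix_mul_assoc)
    also have "E (f x) j ** g' x = g' x ** block_idem \<sigma> j" using g' x j by (simp add: is_lift_def)
    finally show ?thesis by (simp add: matrix_mul_assoc)
  qed
  then show ?thesis
    using inv by (simp add: block_GL_def pattern_iff invertible_mult invertible_matrix_inv)
qed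

lemma lift_top:
  assumes f: "f \<in> spheroids X p" and g: "is_lift f g" and s: "s \<in> {0..1}"
  shows "g (s,1) \<in> block_GL \<sigma> UNIV"
proof -
  have "(s,1) \<in> unit_square" using s by (simp add: unit_square_def)
  then show ?thesis
    using g spheroid_boundary(2)[OF f s] E_p unfolding is_lift_def block_GL_def pattern_iff by auto
qed

lemma lift_top_degree:
  assumes f: "f \<in> spheroids X p" and g: "is_lift f g"
  shows "\<exists>d. has_degree (\<lambda>s. block_det \<sigma> j (g (s,1))) d"
proof (rule has_degree_exists)
  have "continuous_on {0..1} (\<lambda>s. g (s,1))"
    by (rule continuous_on_compose2[of unit_square g])
      (use g in \<open>auto simp: is_lift_def unit_square_def intro!: continuous_intros\<close>)
  then show "continuous_on {0..1} (\<lambda>s. block_det \<sigma> j (g (s,1)))" by (intro continuous_intros)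
qed (use lift_top[OF f g] g in \<open>auto simp: is_lift_def block_det_nonzero\<close>)

lemma has_class_exists: "f \<in> spheroids X p \<Longrightarrow> \<exists>d. has_class f d"
  using lift_exists[of f] lift_top_degree[of f] unfolding has_class_def by metis

text \<open>Two normalized lifts differ by a family of block matrices over the whole square, so their
  top loops differ by a loop that extends over the square.\<close>

lemma lift_degree_unique:
  assumes f: "f \<in> spheroids X p" and g: "is_lift f g" and g': "is_lift f g'"
    and d: "has_degree (\<lambda>s. block_det \<sigma> j (g (s,1))) d"
  shows "has_degree (\<lambda>s. block_det \<sigma> j (g' (s,1))) d"
proof -
  define h where "h x = matrix_inv (g x) ** g' x" for x
  have h: "h x \<in> block_GL \<sigma> UNIV" if "x \<in> unit_square" for x
    unfolding h_def by (rule lift_quotient[OF g g' that])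
  have gh: "g x ** h x = g' x" if "x \<in> unit_square" for x
    using g that by (simp add: h_def is_lift_def matrix_mul_assoc matrix_inv_right)
  have "has_degree (\<lambda>s. block_det \<sigma> j (h (s,1))) 0"
  proof (rule has_degree_extends_0)
    have "continuous_on unit_square h"
      unfolding h_def using g g' by (intro continuous_intros) (auto simp: is_lift_def)
    then show "continuous_on unit_square (\<lambda>x. block_det \<sigma> j (h x))" by (intro continuous_intros)
    show "block_det \<sigma> j (h x) \<noteq> 0" if "x \<in> unit_square" for x by (rule block_det_nonzero[OF h[OF that]])
  qed (use g g' in \<open>auto simp: is_lift_def h_def\<close>)
  from has_degree_mult[OF d this]
  have "has_degree (\<lambda>s. block_det \<sigma> j (g (s,1)) * block_det \<sigma> j (h (s,1))) d" by simp
  then show ?thesis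
  proof (rule has_degree_cong)
    fix s :: real assume "s \<in> {0..1}"
    then have s: "(s,1) \<in> unit_square" by (simp add: unit_square_def)
    then show "block_det \<sigma> j (g (s,1)) * block_det \<sigma> j (h (s,1)) = block_det \<sigma> j (g' (s,1))"
      using h[OF s] gh[OF s] by (metis (no_types, lifting) block_GL_def block_det_mult mem_Collect_eq)
  qed
qed

lemma has_class_unique:
  assumes f: "f \<in> spheroids X p" and "has_class f d" "has_class f e" "j < r"
  shows "d j = e j"
  using assms lift_degree_unique[OF f] has_degree_unique unfolding has_class_def by metis

text \<open>The determinant of the lift has no zero on the square, so its degree along the top is 0;
  there it is the product of the block determinants.\<close>

lemma has_class_sum_zero:
  assumes f: "f \<in> spheroids X p" and c: "has_class f d"
  shows "(\<Sum>j<r. d j) = 0"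
proof -
  obtain g where g: "is_lift f g" "\<And>j. j < r \<Longrightarrow> has_degree (\<lambda>s. block_det \<sigma> j (g (s,1))) (d j)"
    using c by (auto simp: has_class_def)
  have "has_degree (\<lambda>s. det (g (s,1))) 0"
    by (rule has_degree_extends_0[where f = "\<lambda>x. det (g x)"])
      (use g(1) in \<open>auto simp: is_lift_def invertible_det_nz intro!: continuous_intros\<close>)
  moreover have "has_degree (\<lambda>s. det (g (s,1))) (\<Sum>j<r. d j)"
  proof (rule has_degree_cong[OF has_degree_prod[OF g(2)]])
    fix s :: real assume s: "s \<in> {0..1}"
    show "(\<Prod>j<r. block_det \<sigma> j (g (s,1))) = det (g (s,1))"
      by (rule det_eq_prod_block_det[symmetric])
        (use lift_top[OF f g(1) s] range_\<sigma> in \<open>auto simp: block_GL_def\<close>)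
  qed
  ultimately show ?thesis using has_degree_unique by blast
qed

text \<open>Transporting the whole homotopy at once gives lifts that depend continuously on the
  homotopy time, so their top loops form a homotopy in the block diagonal group and keep their
  degrees.\<close>

lemma has_class_homotopic:
  assumes ff': "(f, f') \<in> spheroid_rel X p" and c: "has_class f d"
  shows "has_class f' d"
proof -
  have f: "f \<in> spheroids X p" and f': "f' \<in> spheroids X p" using ff' by (auto simp: spheroid_rel_def)
  have pts: "top_of_set ({0..1::real} \<times> unit_square) = prod_topology (top_of_set {0..1}) (top_of_set unit_square)"
    by (simp add: prod_topology_subtopology_eu)
  obtain F where F: "continuous_map (top_of_set ({0..1::real} \<times> unit_square)) X F"
    "\<And>x. F (0,x) = f x" "\<And>x. F (1,x) = f' x"
    "\<And>t x. t \<in> {0..1} \<Longrightarrow> x \<in> frontier unit_square \<Longrightarrow> F (t,x) = p"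
    using ff' unfolding spheroid_rel_def homotopic_with_def pts by blast
  \<comment> \<open>Coordinates are regrouped: homotopy time and horizontal position become
    parameters, and the vertical coordinate is the direction of transport.\<close>
  define H where "H = (\<lambda>y :: (real \<times> real) \<times> real. F (fst (fst y), snd (fst y), snd y))"
  have "continuous_map (top_of_set (unit_square \<times> {0..1})) X H"
  proof -
    have "continuous_map (top_of_set (unit_square \<times> {0..1::real})) (top_of_set ({0..1::real} \<times> unit_square))
       (\<lambda>y. (fst (fst y), snd (fst y), snd y))"
      by (auto simp: continuous_map_in_subtopology unit_square_def intro!: continuous_intros)
    from continuous_map_compose[OF this F(1)] show ?thesis by (simp add: H_def o_def)
  qed
  moreover have "compact unit_square" unfolding unit_square_def by (intro compact_Times compact_Icc)
  ultimately obtain g where g: "continuous_on (unit_square \<times> {0..1}) g"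
    "\<And>z t. z \<in> unit_square \<Longrightarrow> t \<in> {0..1} \<Longrightarrow> invertible (g (z,t)) \<and>
     (\<forall>j<r. E (H (z,t)) j ** g (z,t) = g (z,t) ** E (H (z,0)) j) \<and> g (z,0) = mat 1 \<and>
     ((\<forall>t\<in>{0..1}. H (z,t) = H (z,0)) \<longrightarrow> g (z,t) = mat 1)"
    using transport_decomposition[of unit_square H] by blast
  have Hb: "H ((\<tau>,s),0) = p" "H ((\<tau>,s),1) = p" "H ((\<tau>,0),s) = p" "H ((\<tau>,1),s) = p"
    if "\<tau> \<in> {0..1}" "s \<in> {0..1}" for \<tau> s
    using that F(4)[of \<tau>] by (auto simp: H_def mem_frontier mem_unit_square)
  have lift: "is_lift (\<lambda>x. F (\<tau>,x)) (\<lambda>x. g ((\<tau>, fst x), snd x))" if \<tau>: "\<tau> \<in> {0..1}" for \<tau>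
    unfolding is_lift_def
  proof (intro conjI ballI allI impI)
    show "continuous_on unit_square (\<lambda>x. g ((\<tau>, fst x), snd x))"
      by (rule continuous_on_compose2[OF g(1)]) (use \<tau> in \<open>auto simp: unit_square_def intro!: continuous_intros\<close>)
    show "invertible (g ((\<tau>, fst x), snd x))" if "x \<in> unit_square" for x
      using g(2)[of "(\<tau>, fst x)" "snd x"] that \<tau> by (auto simp: unit_square_def)
    show "E (F (\<tau>,x)) j ** g ((\<tau>, fst x), snd x) = g ((\<tau>, fst x), snd x) ** block_idem \<sigma> j"
      if "x \<in> unit_square" "j < r" for x j
      using g(2)[of "(\<tau>, fst x)" "snd x"] that \<tau> Hb(1)[OF \<tau>, of "fst x"] E_p[of j]
      by (auto simp: unit_square_def H_def)
    show "g ((\<tau>, fst (s,0)), snd (s,0)) = mat 1" if "s \<in> {0..1}" for s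
      using g(2)[of "(\<tau>, s)" 0] that \<tau> by (auto simp: unit_square_def)
    show "g ((\<tau>, fst (0,s)), snd (0,s)) = mat 1" "g ((\<tau>, fst (1,s)), snd (1,s)) = mat 1" if "s \<in> {0..1}" for s
      using g(2)[of "(\<tau>, 0)" s] g(2)[of "(\<tau>, 1)" s] that \<tau> Hb[OF \<tau>] by (auto simp: unit_square_def)
  qed
  obtain g0 where g0: "is_lift f g0" "\<And>j. j < r \<Longrightarrow> has_degree (\<lambda>s. block_det \<sigma> j (g0 (s,1))) (d j)"
    using c by (auto simp: has_class_def)
  have "has_degree (\<lambda>s. block_det \<sigma> j (g ((1,s),1))) (d j)" if j: "j < r" for j
  proof -
    define k where "k \<tau> s = block_det \<sigma> j (g ((\<tau>,s),1))" for \<tau> s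
    have "is_lift f (\<lambda>x. g ((0, fst x), snd x))" using lift[of 0] F(2) by simp
    from lift_degree_unique[OF f g0(1) this g0(2)[OF j]]
    have deg0: "has_degree (\<lambda>s. k 0 s) (d j)" by (simp add: k_def)
    have k0: "k \<tau> s \<noteq> 0" if \<tau>: "\<tau> \<in> {0..1}" and "s \<in> {0..1}" for \<tau> s
    proof -
      have s1: "(s,1) \<in> unit_square" using that by (simp add: unit_square_def)
      have "F (\<tau>,(s,1)) = p" using F(4)[OF \<tau>, of "(s,1)"] that by (simp add: mem_frontier)
      moreover have "invertible (g ((\<tau>,s),1))"
          "\<forall>j<r. E (F (\<tau>,(s,1))) j ** g ((\<tau>,s),1) = g ((\<tau>,s),1) ** block_idem \<sigma> j"
        using lift[OF \<tau>] s1 unfolding is_lift_def by fastforce+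
      ultimately have "g ((\<tau>,s),1) \<in> block_GL \<sigma> UNIV"
        using E_p by (simp add: block_GL_def pattern_iff)
      then show ?thesis by (simp add: k_def block_det_nonzero)
    qed
    have k1: "k \<tau> 0 = 1" "k \<tau> 1 = 1" if "\<tau> \<in> {0..1}" for \<tau>
      using lift[OF that] by (auto simp: is_lift_def k_def)
    have contg: "continuous_on unit_square (\<lambda>x. g ((snd x, fst x), 1))" "continuous_on unit_square (\<lambda>x. g ((0, fst x), 1))"
      by (rule continuous_on_compose2[OF g(1)]; auto simp: unit_square_def intro!: continuous_intros)+
    \<comment> \<open>Dividing by the loop at time 0 gives a function on the square that is 1 on the
      bottom and the vertical sides.\<close>
    have "has_degree (\<lambda>s. (\<lambda>x. k (snd x) (fst x) / k 0 (fst x)) (s,1)) 0"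
    proof (rule has_degree_extends_0)
      show "continuous_on unit_square (\<lambda>x. k (snd x) (fst x) / k 0 (fst x))"
        unfolding k_def using k0[of 0] unfolding k_def
        by (intro continuous_intros contg) (auto simp: unit_square_def)
    qed (use k0 k1 in \<open>auto simp: unit_square_def\<close>)
    from has_degree_mult[OF deg0 this]
    have "has_degree (\<lambda>s. k 0 s * (k 1 s / k 0 s)) (d j)" by simp
    then have "has_degree (k 1) (d j)"
      by (rule has_degree_cong) (use k0[of 0] in auto)
    then show ?thesis by (simp add: k_def[abs_def])
  qed
  moreover have "is_lift f' (\<lambda>x. g ((1, fst x), snd x))" using lift[of 1] F(3) by simp
  ultimately show ?thesis unfolding has_class_def by (intro exI[of _ "\<lambda>x. g ((1, fst x), snd x)"]) simp
qed

text \<open>The lifts are the identity on the vertical sides, so they can be joined in the same way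
  as the spheroids.\<close>

lemma has_class_join:
  assumes f: "f \<in> spheroids X p" "f' \<in> spheroids X p" and c: "has_class f d" "has_class f' e"
  shows "has_class (spheroid_join f f') (\<lambda>j. d j + e j)"
proof -
  obtain g where g: "is_lift f g" "\<And>j. j < r \<Longrightarrow> has_degree (\<lambda>s. block_det \<sigma> j (g (s,1))) (d j)"
    using c by (auto simp: has_class_def)
  obtain g' where g': "is_lift f' g'" "\<And>j. j < r \<Longrightarrow> has_degree (\<lambda>s. block_det \<sigma> j (g' (s,1))) (e j)"
    using c by (auto simp: has_class_def)
  have "is_lift (spheroid_join f f') (spheroid_join g g')"
    unfolding is_lift_def
  proof (intro conjI ballI allI impI)
    have "continuous_map (top_of_set unit_square) euclidean (spheroid_join g g')"
      by (rule continuous_map_spheroid_join) (use g(1) g'(1) in \<open>auto simp: is_lift_def\<close>)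
    then show "continuous_on unit_square (spheroid_join g g')" by simp
    fix x assume x: "x \<in> unit_square"
    have l: "(2 * fst x, snd x) \<in> unit_square" if "fst x \<le> 1/2"
      using that x by (auto simp: unit_square_def)
    have rr: "(2 * fst x - 1, snd x) \<in> unit_square" if "\<not> fst x \<le> 1/2"
      using that x by (auto simp: unit_square_def)
    show "invertible (spheroid_join g g' x)"
      using l rr g(1) g'(1) by (auto simp: spheroid_join_def case_prod_unfold is_lift_def)
    show "E (spheroid_join f f' x) j ** spheroid_join g g' x = spheroid_join g g' x ** block_idem \<sigma> j" if "j < r" for j
      using l rr g(1) g'(1) that by (auto simp: spheroid_join_def case_prod_unfold is_lift_def)
  next
    fix s :: real assume s: "s \<in> {0..1}"
    show "spheroid_join g g' (s,0) = mat 1" "spheroid_join g g' (0,s) = mat 1" "spheroid_join g g' (1,s) = mat 1"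
      using s g(1) g'(1) by (auto simp: spheroid_join_def is_lift_def)
  qed
  moreover have "has_degree (\<lambda>s. block_det \<sigma> j (spheroid_join g g' (s,1))) (d j + e j)" if "j < r" for j
    by (rule has_degree_cong[OF has_degree_join[OF g(2)[OF that] g'(2)[OF that]]])
      (auto simp: spheroid_join_def)
  ultimately show ?thesis unfolding has_class_def by blast
qed

end

section \<open>Unitary families with prescribed block degrees\<close>

definition scaling :: "complex \<Rightarrow> complex^'n \<Rightarrow> complex^'n^'n" where
  "scaling z w = mat 1 + rk1 ((z - 1) *s w) w"

lemma scaling_1 [simp]: "scaling 1 w = mat 1"
  by (simp add: scaling_def rk1_def vec_eq_iff)

text \<open>For a unit vector w, \<open>scaling z w\<close> acts as z on the line of w and as the
  identity on its orthogonal complement.\<close>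

lemma scaling_mult:
  assumes "hip w w = 1"
  shows "scaling z w ** scaling z' w = scaling (z * z') w"
proof -
  have "rk1 ((z - 1) *s w) w ** rk1 ((z' - 1) *s w) w = rk1 (((z - 1) * (z' - 1)) *s w) w"
    unfolding rk1_mult hip_scale_right assms vector_smult_assoc
    by (simp only: mult_1_right mult.commute[of "z' - 1"])
  then show ?thesis
    by (simp add: scaling_def matrix_ring) (simp add: vec_eq_iff rk1_def algebra_simps)
qed

lemma adj_scaling: "adj (scaling z w) = scaling (cnj z) w"
  by (simp add: scaling_def) (simp add: rk1_def vec_eq_iff algebra_simps)

lemma scaling_unitary:
  assumes "hip w w = 1" "norm z = 1"
  shows "adj (scaling z w) ** scaling z w = mat 1"
proof -
  have "cnj z * z = 1" using assms(2) by (metis complex_norm_square mult.commute of_real_1 power_one)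
  then show ?thesis by (simp add: adj_scaling scaling_mult[OF assms(1)])
qed

lemma scaling_axis: "scaling z (axis a 1) = diag_mat (\<lambda>i. if i = a then z else 1)"
  by (auto simp: scaling_def rk1_def diag_mat_def vec_eq_iff axis_def mat_def)

lemma block_det_scaling_axis: "block_det \<sigma> j (scaling z (axis a 1)) = (if \<sigma> a = j then z else 1)"
proof -
  have "(\<Prod>i\<in>UNIV. if \<sigma> i = j then if i = a then z else 1 else 1) = (\<Prod>i\<in>UNIV. if i = a then if \<sigma> a = j then z else 1 else 1)"
    by (intro prod.cong) auto
  then show ?thesis by (simp add: scaling_axis block_det_diag_mat)
qed

lemma continuous_on_scaling [continuous_intros]:
  "continuous_on S f \<Longrightarrow> continuous_on S g \<Longrightarrow> continuous_on S (\<lambda>x. scaling (f x) (g x))"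
  unfolding scaling_def by (intro continuous_intros)

lemma unitary_mult: "adj A ** A = mat 1 \<Longrightarrow> adj B ** B = mat 1 \<Longrightarrow> adj (A ** B) ** (A ** B) = mat 1"
  by (metis (no_types, lifting) adj_mult matrix_mul_assoc matrix_mul_rid)

lemma unitary_invertible: "adj A ** A = mat 1 \<Longrightarrow> invertible (A :: complex^'n^'n)"
  using invertible_left_inverse by blast

text \<open>A null homotopy, through unitary matrices, of the loop that rotates the axes \<open>a\<close> and \<open>c\<close>
  with opposite speeds \<open>d\<close> and \<open>- d\<close>: conjugate one factor by the rotation from \<open>c\<close> to \<open>a\<close>.\<close>

definition twist :: "'n \<Rightarrow> 'n \<Rightarrow> int \<Rightarrow> real \<times> real \<Rightarrow> complex^'n^'n" where
  "twist a c d x = scaling (cis (2 * pi * of_int d * fst x))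
      (complex_of_real (cos (pi / 2 * snd x)) *s axis c 1 + complex_of_real (sin (pi / 2 * snd x)) *s axis a 1)
    ** scaling (cis (- (2 * pi * of_int d * fst x))) (axis c 1)"

lemma continuous_on_twist [continuous_intros]: "continuous_on S (twist a c d)"
  unfolding twist_def[abs_def] cis_conv_exp by (intro continuous_intros)

lemma twist_hip:
  assumes "a \<noteq> c"
  defines "w \<equiv> \<lambda>u::real. complex_of_real (cos u) *s axis c 1 + complex_of_real (sin u) *s axis a 1 :: complex^'n"
  shows "hip (w u) (w u) = 1"
proof -
  have "hip (w u) (w u) = (\<Sum>i\<in>UNIV. (if i = c then of_real ((cos u)\<^sup>2) else 0) + (if i = a then of_real ((sin u)\<^sup>2) else 0))"
    unfolding hip_def w_def using assms(1) by (intro sum.cong) (auto simp: axis_def power2_eq_square)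
  also have "\<dots> = complex_of_real ((cos u)\<^sup>2 + (sin u)\<^sup>2)"
    by (simp add: sum.distrib del: sin_cos_squared_add2)
  also have "\<dots> = 1" by (simp only: sin_cos_squared_add2 of_real_1)
  finally show ?thesis .
qed

lemma hip_axis: "hip (axis c 1) (axis c 1) = 1"
  by (simp add: hip_self norm_axis)

lemma twist_unitary: "a \<noteq> c \<Longrightarrow> adj (twist a c d x) ** twist a c d x = mat 1"
  unfolding twist_def by (intro unitary_mult scaling_unitary) (auto simp: twist_hip hip_axis)

text \<open>On the bottom both factors scale the same axis with inverse numbers; on the vertical
  sides the numbers are 1 because d is an integer.\<close>

lemma twist_boundary:
  assumes "a \<noteq> c"
  shows "twist a c d (s,0) = mat 1" "twist a c d (0,t) = mat 1" "twist a c d (1,t) = mat 1"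
proof -
  have "cis (2 * pi * of_int d) = 1" "cis (- (2 * pi * of_int d)) = 1"
    by (simp_all add: complex_eq_iff cis.ctr sin_int_2pin cos_int_2pin)
  then show "twist a c d (0,t) = mat 1" "twist a c d (1,t) = mat 1"
    by (simp_all add: twist_def)
  show "twist a c d (s,0) = mat 1"
    by (simp add: twist_def scaling_mult hip_axis cis_mult vec_eq_iff)
qed

lemma twist_top:
  "twist a c d (s,1) = scaling (cis (2 * pi * of_int d * s)) (axis a 1) ** scaling (cis (- (2 * pi * of_int d * s))) (axis c 1)"
  by (simp add: twist_def)

lemma scaling_axis_in_block_GL: "z \<noteq> 0 \<Longrightarrow> scaling z (axis a 1) \<in> block_GL \<sigma> UNIV"
  unfolding scaling_axis by (rule diag_mat_in_block_GL) auto

lemma twist_top_block_GL: "twist a c d (s,1) \<in> block_GL \<sigma> UNIV"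
  unfolding twist_top by (intro block_GL_mult scaling_axis_in_block_GL) auto

section \<open>Classification of spheroids by their degrees\<close>

context decomposition_space
begin

lemma r_pos: "r > 0"
proof -
  have "\<sigma> undefined \<in> {..<r}" unfolding range_\<sigma>[symmetric] by simp
  then show ?thesis by simp
qed

text \<open>Each block except the last is twisted against one axis of the last block. The product is
  unitary, so it is a lift of its own image under \<open>\<rho>\<close>.\<close>

lemma has_class_surj:
  assumes d: "(\<Sum>j<r. d j) = 0"
  shows "\<exists>f\<in>spheroids X p. has_class f d"
proof -
  define a where "a = inv_into UNIV \<sigma>"
  have a: "\<sigma> (a j) = j" if "j < r" for j
    unfolding a_def by (rule f_inv_into_f) (simp add: range_\<sigma> that)
  \<comment> \<open>The common axis, in the last block, that absorbs the opposite rotations.\<close>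
  define c where "c = a (r - 1)"
  have ac: "a j \<noteq> c" if "j < r - 1" for j
  proof -
    have "j < r" "r - 1 < r" using that r_pos by auto
    then have "\<sigma> (a j) \<noteq> \<sigma> c" using a[of j] a[of "r - 1"] that by (simp add: c_def)
    then show ?thesis by metis
  qed
  define g where "g = rec_nat (\<lambda>_. mat 1) (\<lambda>j G x. G x ** twist (a j) c (d j) x)"
  have g_simps: "g 0 x = mat 1" "g (Suc j) x = g j x ** twist (a j) c (d j) x" for j x
    by (simp_all add: g_def)
  have contg: "continuous_on S (g m)" for S :: "(real \<times> real) set" and m
  proof (induction m)
    case (Suc m)
    have "g (Suc m) = (\<lambda>x. g m x ** twist (a m) c (d m) x)" by (simp add: fun_eq_iff g_simps)
    then show ?case using Suc by (simp add: continuous_on_matrix_mult continuous_on_twist)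
  qed (simp add: g_def)
  have unit: "adj (g m x) ** g m x = mat 1" if "m \<le> r - 1" for m x
    using that by (induction m) (auto simp: g_simps intro!: unitary_mult twist_unitary ac)
  have bd: "g m (s,0) = mat 1" "g m (0,s) = mat 1" "g m (1,s) = mat 1" if "m \<le> r - 1" for m s
    using that by (induction m) (auto simp: g_simps twist_boundary ac)
  have top: "g m (s,1) \<in> block_GL \<sigma> UNIV" for m s
  proof (induction m)
    case 0 show ?case by (simp add: g_simps block_GL_def)
  next
    case (Suc m) then show ?case unfolding g_simps by (intro block_GL_mult twist_top_block_GL)
  qed
  have det_top: "block_det \<sigma> j (g m (s,1)) = (if j < m then cis (2 * pi * of_int (d j) * s) else 1)"
    if "m \<le> r - 1" "j < r - 1" for m s j
    using that(1)
  proof (induction m)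
    case (Suc m)
    have "block_det \<sigma> j (twist (a m) c (d m) (s,1)) = (if m = j then cis (2 * pi * of_int (d j) * s) else 1)"
    proof -
      have "pattern \<sigma> UNIV (scaling (cis (- (2 * pi * of_int (d m) * s))) (axis c 1))"
        using scaling_axis_in_block_GL[of _ c \<sigma>] by (simp add: block_GL_def)
      then show ?thesis
        using a[of m] a[of "r - 1"] Suc.prems that(2)
        by (auto simp: twist_top block_det_mult block_det_scaling_axis c_def)
    qed
    moreover have "pattern \<sigma> UNIV (twist (a m) c (d m) (s,1))"
      using twist_top_block_GL unfolding block_GL_def by blast
    ultimately show ?case using Suc by (auto simp: g_simps block_det_mult less_Suc_eq)
  qed (simp add: g_simps)
  define G where "G = g (r - 1)"
  define f where "f x = \<rho> (G x)" for x
  have invG: "invertible (G x)" for x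
    unfolding G_def by (rule unitary_invertible[OF unit]) simp
  have f: "f \<in> spheroids X p"
    unfolding spheroids_def
  proof (intro CollectI conjI ballI)
    show "continuous_map (top_of_set unit_square) X f"
      unfolding f_def using contg[of unit_square "r - 1"] invG by (intro \<rho>_comp_cont) (simp_all only: G_def)
    fix x assume "x \<in> frontier unit_square"
    then consider s where "x = (s,0)" | s where "x = (s,1)" | s where "x = (0,s)" | s where "x = (1,s)"
      by (cases x) (auto simp: mem_frontier)
    then have "G x \<in> block_GL \<sigma> UNIV"
    proof cases
      case 2 then show ?thesis using top by (simp add: G_def)
    qed (simp_all add: G_def bd block_GL_def)
    then show "f x = p" unfolding f_def by (rule \<rho>_block_GL)
  qed
  have lift: "is_lift f G"
    unfolding is_lift_def f_def using invG \<rho>_unitary unit[of "r - 1"] contg[of _ "r - 1"] bd[of "r - 1"]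
    by (auto simp: G_def)
  have deg: "has_degree (\<lambda>s. block_det \<sigma> j (G (s,1))) (d j)" if "j < r - 1" for j
    unfolding has_degree_def
  proof (intro exI[of _ "\<lambda>s. \<i> * complex_of_real (2 * pi * of_int (d j) * s)"] conjI ballI)
    show "continuous_on {0..1} (\<lambda>s. \<i> * complex_of_real (2 * pi * of_int (d j) * s))" by (intro continuous_intros)
    show "exp (\<i> * complex_of_real (2 * pi * of_int (d j) * s)) = block_det \<sigma> j (G (s,1))" for s
      unfolding G_def det_top[OF order_refl that] using that by (simp add: cis_conv_exp)
  qed auto
  \<comment> \<open>The degree of the last block is not computed from the matrices: both families of
    degrees sum to zero and agree on the other blocks.\<close>
  obtain e where e: "has_class f e" using has_class_exists[OF f] by blast
  obtain g' where g': "is_lift f g'" "\<And>j. j < r \<Longrightarrow> has_degree (\<lambda>s. block_det \<sigma> j (g' (s,1))) (e j)"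
    using e by (auto simp: has_class_def)
  have "e j = d j" if "j < r - 1" for j
    using lift_degree_unique[OF f g'(1) lift g'(2)] deg[OF that] that has_degree_unique
    by (metis less_diff_conv less_trans less_add_one add_lessD1)
  moreover have "(\<Sum>j<r. e j) = (\<Sum>j<r-1. e j) + e (r-1)" "(\<Sum>j<r. d j) = (\<Sum>j<r-1. d j) + d (r-1)"
    using r_pos by (metis Suc_pred' sum.lessThan_Suc)+
  ultimately have "e (r - 1) = d (r - 1)"
    using has_class_sum_zero[OF f e] d by simp
  then have "e j = d j" if "j < r" for j
    using that \<open>\<And>j. j < r - 1 \<Longrightarrow> e j = d j\<close> by (cases "j = r - 1") auto
  then have "has_class f d" using e by (simp add: has_class_def)
  then show ?thesis using f by blast
qed

text \<open>Equal degrees make the quotient of the two top loops contractible among block diagonal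
  matrices, and this contraction corrects the lift of f until it agrees with the lift of f' on the
  whole boundary. The quotient of the lifts is then a spheroid in GL, which contracts;
  \<open>\<rho>\<close> carries the contraction to a homotopy of spheroids.\<close>

lemma has_class_inj:
  assumes f: "f \<in> spheroids X p" "f' \<in> spheroids X p" and c: "has_class f d" "has_class f' d"
  shows "(f, f') \<in> spheroid_rel X p"
proof -
  obtain g where g: "is_lift f g" "\<And>j. j < r \<Longrightarrow> has_degree (\<lambda>s. block_det \<sigma> j (g (s,1))) (d j)"
    using c by (auto simp: has_class_def)
  obtain g' where g': "is_lift f' g'" "\<And>j. j < r \<Longrightarrow> has_degree (\<lambda>s. block_det \<sigma> j (g' (s,1))) (d j)"
    using c by (auto simp: has_class_def)
  have contg: "continuous_on unit_square g" "continuous_on unit_square g'"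
    and invg: "\<And>x. x \<in> unit_square \<Longrightarrow> invertible (g x)" "\<And>x. x \<in> unit_square \<Longrightarrow> invertible (g' x)"
    using g(1) g'(1) by (auto simp: is_lift_def)
  define \<kappa> where "\<kappa> s = matrix_inv (g (s,1)) ** g' (s,1)" for s
  have top: "g (s,1) \<in> block_GL \<sigma> UNIV" "g' (s,1) \<in> block_GL \<sigma> UNIV" if "s \<in> {0..1}" for s
    using lift_top[OF f(1) g(1) that] lift_top[OF f(2) g'(1) that] by auto
  have \<kappa>: "\<kappa> s \<in> block_GL \<sigma> UNIV" if "s \<in> {0..1}" for s
    unfolding \<kappa>_def using top[OF that] by (intro block_GL_mult block_GL_matrix_inv)
  have "rel_homotopic {0,1} (mat 1) {0..1} (block_GL \<sigma> UNIV) \<kappa> (\<lambda>_. mat 1)"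
  proof (rule block_GL_rel_nullhomotopic)
    have "continuous_on {0..1} (\<lambda>s. g (s,1))" "continuous_on {0..1} (\<lambda>s. g' (s,1))"
      by (rule continuous_on_compose2[OF contg(1)] continuous_on_compose2[OF contg(2)];
          auto simp: unit_square_def intro!: continuous_intros)+
    then show "continuous_on {0..1} \<kappa>"
      unfolding \<kappa>_def using top by (intro continuous_intros) (auto simp: block_GL_def)
    show "\<kappa> x = mat 1" if "x \<in> {0,1}" for x
      using that g(1) g'(1) by (auto simp: \<kappa>_def is_lift_def)
    show "rel_log {0..1} {0,1} (\<lambda>x. block_det \<sigma> (\<sigma> a) (\<kappa> x))" for a
    proof -
      have j: "\<sigma> a < r" using range_\<sigma> by auto
      obtain L M where L: "continuous_on {0..1} L" "L 0 = 0" "L 1 = 2 * pi * \<i> * of_int (d (\<sigma> a))"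
          "\<And>s. s \<in> {0..1} \<Longrightarrow> exp (L s) = block_det \<sigma> (\<sigma> a) (g (s,1))"
        and M: "continuous_on {0..1} M" "M 0 = 0" "M 1 = 2 * pi * \<i> * of_int (d (\<sigma> a))"
          "\<And>s. s \<in> {0..1} \<Longrightarrow> exp (M s) = block_det \<sigma> (\<sigma> a) (g' (s,1))"
        using g(2)[OF j] g'(2)[OF j] by (auto simp: has_degree_def)
      have eq: "block_det \<sigma> (\<sigma> a) (g (s,1)) * block_det \<sigma> (\<sigma> a) (\<kappa> s) = block_det \<sigma> (\<sigma> a) (g' (s,1))"
        if s: "s \<in> {0..1}" for s
      proof -
        have "g (s,1) ** \<kappa> s = g' (s,1)"
          using top[OF s] by (simp add: \<kappa>_def matrix_mul_assoc matrix_inv_right block_GL_def)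
        then show ?thesis using \<kappa>[OF s] by (metis (no_types, lifting) block_GL_def block_det_mult mem_Collect_eq)
      qed
      have "exp (M s - L s) = block_det \<sigma> (\<sigma> a) (\<kappa> s)" if "s \<in> {0..1}" for s
        using eq[OF that] L(4)[OF that] M(4)[OF that] by (metis exp_diff exp_not_eq_zero nonzero_mult_div_cancel_left)
      then show ?thesis
        unfolding rel_log_def
        by (intro exI[of _ "\<lambda>s. M s - L s"]) (auto simp: L(2,3) M(2,3) intro!: continuous_intros L(1) M(1))
    qed
  qed (use \<kappa> in auto)
  note hom = this
  obtain m :: "real \<times> real \<Rightarrow> complex^'n^'n" where m: "continuous_on ({0..1} \<times> {0..1}) m"
    "\<And>t x. t \<in> {0..1} \<Longrightarrow> x \<in> {0..1} \<Longrightarrow> m (t,x) \<in> block_GL \<sigma> UNIV"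
    "\<And>x. m (0,x) = \<kappa> x" "\<And>x. m (1,x) = mat 1" "\<And>t x. t \<in> {0..1} \<Longrightarrow> x \<in> {0,1} \<Longrightarrow> m (t,x) = mat 1"
    by (rule rel_homotopicE[OF hom], rule that)
  \<comment> \<open>The contraction \<open>m\<close> is spread over the height of the square: the
    full correction \<open>\<kappa>\<close> at the top, none at the bottom. Block diagonal factors
    leave \<open>h\<close> a lift of f.\<close>
  define h where "h x = g x ** m (1 - snd x, fst x)" for x
  have mGL: "m (1 - snd x, fst x) \<in> block_GL \<sigma> UNIV" if "x \<in> unit_square" for x
    using that by (intro m(2)) (auto simp: mem_unit_square)
  have conth: "continuous_on unit_square h"
    unfolding h_def
    by (intro continuous_intros contg continuous_on_compose2[OF m(1)]) (auto simp: unit_square_def)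
  have invh: "invertible (h x)" if "x \<in> unit_square" for x
    unfolding h_def using invg(1)[OF that] mGL[OF that] by (auto simp: block_GL_def intro: invertible_mult)
  have hE: "E (f x) j ** h x = h x ** block_idem \<sigma> j" if x: "x \<in> unit_square" and j: "j < r" for x j
  proof -
    have "E (f x) j ** h x = g x ** (block_idem \<sigma> j ** m (1 - snd x, fst x))"
      using g(1) x j by (simp add: h_def is_lift_def matrix_mul_assoc)
    also have "block_idem \<sigma> j ** m (1 - snd x, fst x) = m (1 - snd x, fst x) ** block_idem \<sigma> j"
      using mGL[OF x] by (simp add: block_GL_def pattern_UNIV_iff)
    finally show ?thesis by (simp add: h_def matrix_mul_assoc)
  qed
  have hb: "h x = g' x" if x: "x \<in> frontier unit_square" for x
  proof -
    obtain s t where st: "x = (s,t)" "s \<in> {0..1}" "t \<in> {0..1}" "s \<in> {0,1} \<or> t \<in> {0,1}"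
      using x by (cases x) (auto simp: mem_frontier)
    have "t = 1 \<or> t = 0 \<or> s \<in> {0,1}" using st(4) by auto
    then show ?thesis
    proof (elim disjE)
      assume "t = 1"
      then show ?thesis using top[OF st(2)] st(1) by (simp add: h_def m(3) \<kappa>_def matrix_mul_assoc matrix_inv_right block_GL_def)
    next
      assume "t = 0"
      then show ?thesis using g(1) g'(1) st by (simp add: h_def m(4) is_lift_def)
    next
      assume "s \<in> {0,1}"
      then show ?thesis using g(1) g'(1) st m(5)[of "1 - t" s] by (auto simp: h_def is_lift_def)
    qed
  qed
  have \<rho>h: "\<rho> (h x) = f x" if "x \<in> unit_square" for x
    using \<rho>_eq[OF spheroid_in[OF f(1) that] invh[OF that] hE[OF that]] .
  have \<rho>g': "\<rho> (g' x) = f' x" if "x \<in> unit_square" for x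
    using g'(1) that by (intro \<rho>_eq[OF spheroid_in[OF f(2) that] invg(2)[OF that]]) (auto simp: is_lift_def)
  define q where "q x = matrix_inv (h x) ** g' x" for x
  have fr: "frontier unit_square \<subseteq> unit_square" by (auto simp: mem_frontier mem_unit_square)
  \<comment> \<open>With a single label the block condition is empty, so the same contraction result
    now applies to all of GL on the square.\<close>
  have triv: "block_GL (\<lambda>_::'n. 0) UNIV = {A. invertible A}" by (auto simp: block_GL_def pattern_def)
  have contq: "continuous_on unit_square q"
    unfolding q_def by (intro continuous_intros conth contg invh)
  have invq: "q x \<in> block_GL (\<lambda>_. 0) UNIV" if "x \<in> unit_square" for x
    unfolding q_def triv using invh[OF that] invg(2)[OF that] by (simp add: invertible_mult invertible_matrix_inv)
  have qb: "q x = mat 1" if "x \<in> frontier unit_square" for x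
    unfolding q_def hb[OF that] using fr that by (intro matrix_inv_left invg) auto
  have "rel_homotopic (frontier unit_square) (mat 1) unit_square (block_GL (\<lambda>_. 0) UNIV) q (\<lambda>_. mat 1)"
  proof (rule block_GL_rel_nullhomotopic)
    show "compact unit_square" unfolding unit_square_def by (intro compact_Times compact_Icc)
    show "convex unit_square" unfolding unit_square_def by (intro convex_Times) auto
    show "rel_log unit_square (frontier unit_square) (\<lambda>x. block_det (\<lambda>_. 0) 0 (q x))"
      by (rule rel_log_square) (auto intro!: continuous_intros contq simp: qb block_det_nonzero invq)
  qed (use contq invq qb fr in auto)
  note hom' = this
  obtain n :: "real \<times> real \<times> real \<Rightarrow> complex^'n^'n" where n: "continuous_on ({0..1} \<times> unit_square) n"
    "\<And>t x. t \<in> {0..1} \<Longrightarrow> x \<in> unit_square \<Longrightarrow> n (t,x) \<in> block_GL (\<lambda>_. 0) UNIV"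
    "\<And>x. n (0,x) = q x" "\<And>x. n (1,x) = mat 1" "\<And>t x. t \<in> {0..1} \<Longrightarrow> x \<in> frontier unit_square \<Longrightarrow> n (t,x) = mat 1"
    by (rule rel_homotopicE[OF hom'], rule that)
  \<comment> \<open>Runs from f' to f, hence the symmetry at the end. The intermediate matrices need
    not lift anything; only the continuity of \<open>\<rho>\<close> is used.\<close>
  define F where "F y = \<rho> (h (snd y) ** n y)" for y :: "real \<times> real \<times> real"
  have "continuous_map (top_of_set ({0..1} \<times> unit_square)) X F"
    unfolding F_def
  proof (rule \<rho>_comp_cont)
    show "continuous_on ({0..1} \<times> unit_square) (\<lambda>y. h (snd y) ** n y)"
      by (intro continuous_intros n continuous_on_compose2[OF conth]) auto
    show "invertible (h (snd y) ** n y)" if "y \<in> {0..1} \<times> unit_square" for y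
      using that n(2)[of "fst y" "snd y"] by (intro invertible_mult invh) (auto simp: triv)
  qed
  then have contF: "continuous_map (prod_topology (top_of_set {0..1}) (top_of_set unit_square)) X F"
    by (simp add: prod_topology_subtopology_eu)
  have F0: "F (0,x) = f' x" if "x \<in> unit_square" for x
    using \<rho>g'[OF that] invh[OF that] by (simp add: F_def n(3) q_def matrix_mul_assoc matrix_inv_right)
  have F1: "F (1,x) = f x" if "x \<in> unit_square" for x
    using \<rho>h[OF that] by (simp add: F_def n(4))
  have Fb: "F (t,x) = p" if "t \<in> {0..1}" "x \<in> frontier unit_square" for t x
    using n(5)[OF that] \<rho>h[of x] fr that f(1) by (auto simp: F_def spheroids_def)
  have "homotopic_with (\<lambda>h. \<forall>s\<in>frontier unit_square. h s = p) (top_of_set unit_square) X f' f"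
  proof (subst homotopic_with)
    show "(\<forall>s\<in>frontier unit_square. h s = p) = (\<forall>s\<in>frontier unit_square. k s = p)"
      if "\<And>x. x \<in> topspace (top_of_set unit_square) \<Longrightarrow> h x = k x" for h k
      using that fr by (metis subsetD topspace_euclidean_subtopology)
  qed (use contF F0 F1 Fb in auto)
  then show ?thesis
    using f homotopic_with_symD by (auto simp: spheroid_rel_def)
qed

lemma has_class_cong: "has_class f d \<Longrightarrow> (\<And>j. j < r \<Longrightarrow> d j = e j) \<Longrightarrow> has_class f e"
  unfolding has_class_def by metis

lemma has_class_last:
  assumes f: "f \<in> spheroids X p" "f' \<in> spheroids X p" and c: "has_class f d" "has_class f' e"
    and eq: "\<And>j. j < r - 1 \<Longrightarrow> d j = e j" and j: "j < r"
  shows "d j = e j"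
proof -
  have "(\<Sum>j<r. d j) = (\<Sum>j<r-1. d j) + d (r-1)" "(\<Sum>j<r. e j) = (\<Sum>j<r-1. e j) + e (r-1)"
    by (metis r_pos Suc_pred' sum.lessThan_Suc)+
  moreover have "(\<Sum>j<r-1. d j) = (\<Sum>j<r-1. e j)" using eq by (intro sum.cong) auto
  ultimately have "d (r-1) = e (r-1)"
    using has_class_sum_zero[OF f(1) c(1)] has_class_sum_zero[OF f(2) c(2)] by simp
  then show ?thesis using eq[of j] j by (cases "j = r - 1") auto
qed

text \<open>\<open>\<phi>\<close> packs the first r - 1 degrees into an element of the target group;
  vanishing of the sum recovers the last one.\<close>

lemma pi2_iso:
  assumes carrier: "\<And>d. \<phi> d \<in> carrier G"
    and surj: "\<And>y. y \<in> carrier G \<Longrightarrow> \<exists>d. \<phi> d = y"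
    and add: "\<And>d e. \<phi> (\<lambda>j. d j + e j) = \<phi> d \<otimes>\<^bsub>G\<^esub> \<phi> e"
    and eq: "\<And>d e :: nat \<Rightarrow> int. \<phi> d = \<phi> e \<longleftrightarrow> (\<forall>j<r-1. d j = e j)"
  shows "pi2 X p \<cong> G"
proof -
  define cl where "cl f = (SOME d. has_class f d)" for f
  have cl: "has_class f (cl f)" if "f \<in> spheroids X p" for f
    unfolding cl_def by (rule someI_ex[OF has_class_exists[OF that]])
  have \<phi>_cl: "\<phi> (cl f) = \<phi> d" if "f \<in> spheroids X p" "has_class f d" for f d
    using has_class_unique[OF that(1) cl[OF that(1)] that(2)] by (auto simp: eq)
  show ?thesis
  proof (rule pi2_iso_invariant[where c = "\<lambda>f. \<phi> (cl f)"])
    show "\<phi> (cl f) \<in> carrier G" for f by (rule carrier)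
    show "\<exists>f\<in>spheroids X p. \<phi> (cl f) = y" if "y \<in> carrier G" for y
    proof -
      obtain d where d: "\<phi> d = y" using surj[OF \<open>y \<in> carrier G\<close>] by blast
      \<comment> \<open>Only the first r - 1 entries of \<open>d\<close> are prescribed; the last is
        chosen to make the sum zero.\<close>
      define e where "e j = (if j < r - 1 then d j else - (\<Sum>i<r-1. d i))" for j
      have "(\<Sum>j<r. e j) = (\<Sum>j<r-1. e j) + e (r-1)" by (metis r_pos Suc_pred' sum.lessThan_Suc)
      also have "\<dots> = 0" by (simp add: e_def)
      finally obtain f where "f \<in> spheroids X p" "has_class f e" using has_class_surj by blast
      moreover have "\<phi> e = \<phi> d" unfolding eq by (simp add: e_def)
      ultimately show ?thesis using \<phi>_cl d by metis
    qed
    show "(f, g) \<in> spheroid_rel X p \<longleftrightarrow> \<phi> (cl f) = \<phi> (cl g)"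
      if f: "f \<in> spheroids X p" and g: "g \<in> spheroids X p" for f g
    proof
      assume "(f, g) \<in> spheroid_rel X p"
      then show "\<phi> (cl f) = \<phi> (cl g)"
        using has_class_homotopic cl[OF f] \<phi>_cl[OF g] by metis
    next
      assume "\<phi> (cl f) = \<phi> (cl g)"
      then have "cl f j = cl g j" if "j < r" for j
        using has_class_last[OF f g cl[OF f] cl[OF g]] that by (auto simp: eq)
      then have "has_class g (cl f)" using has_class_cong[OF cl[OF g]] by metis
      then show "(f, g) \<in> spheroid_rel X p" by (rule has_class_inj[OF f g cl[OF f]])
    qed
    show "\<phi> (cl (spheroid_join f g)) = \<phi> (cl f) \<otimes>\<^bsub>G\<^esub> \<phi> (cl g)"
      if f: "f \<in> spheroids X p" and g: "g \<in> spheroids X p" for f g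
      using \<phi>_cl[OF spheroid_join_in_spheroids[OF f g] has_class_join[OF f g cl[OF f] cl[OF g]]] add by simp
  qed
qed

lemma pi2_three_blocks:
  assumes "r = 3"
  shows "pi2 X p \<cong> integer_group \<times>\<times> integer_group"
proof (rule pi2_iso[where \<phi> = "\<lambda>d. (d 0, d 1)"])
  show "\<exists>d::nat \<Rightarrow> int. (d 0, d 1) = y" for y
    by (intro exI[of _ "\<lambda>j. if j = 0 then fst y else snd y"]) simp
qed (use assms in \<open>auto simp: DirProd_def integer_group_def numeral_2_eq_2 less_Suc_eq\<close>)

lemma pi2_four_blocks:
  assumes "r = 4"
  shows "pi2 X p \<cong> integer_group \<times>\<times> integer_group \<times>\<times> integer_group"
proof (rule pi2_iso[where \<phi> = "\<lambda>d. (d 0, d 1, d 2)"])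
  show "\<exists>d::nat \<Rightarrow> int. (d 0, d 1, d 2) = y" for y
    by (intro exI[of _ "\<lambda>j. if j = 0 then fst y else if j = 1 then fst (snd y) else snd (snd y)"]) simp
qed (use assms in \<open>auto simp: DirProd_def integer_group_def numeral_2_eq_2 numeral_3_eq_3 less_Suc_eq\<close>)

end

section \<open>The idempotents of a pair of subspaces\<close>

definition sum_space :: "(complex^'n) set \<Rightarrow> (complex^'n) set \<Rightarrow> (complex^'n) set" where
  "sum_space H K = {x + y |x y. x \<in> H \<and> y \<in> K}"

lemma subspace_sum_space: "vec.subspace H \<Longrightarrow> vec.subspace K \<Longrightarrow> vec.subspace (sum_space H K)"
  unfolding sum_space_def by (rule vec.subspace_sums)

lemma subset_sum_space:
  assumes "vec.subspace H" "vec.subspace K"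
  shows "H \<subseteq> sum_space H K" "K \<subseteq> sum_space H K"
proof -
  have "x = x + 0" "x = 0 + x" for x :: "complex^'n" by simp_all
  then show "H \<subseteq> sum_space H K" "K \<subseteq> sum_space H K"
    unfolding sum_space_def using vec.subspace_0[OF assms(1)] vec.subspace_0[OF assms(2)] by blast+
qed

lemma sum_space_image: "sum_space ((*v) A ` H) ((*v) A ` K) = (*v) A ` sum_space H K"
proof (intro equalityI subsetI)
  fix z assume "z \<in> sum_space ((*v) A ` H) ((*v) A ` K)"
  then obtain x y where "x \<in> H" "y \<in> K" "z = A *v x + A *v y" by (auto simp: sum_space_def)
  then have "z = A *v (x + y)" "x + y \<in> sum_space H K"
    by (auto simp: sum_space_def matrix_vector_right_distrib)
  then show "z \<in> (*v) A ` sum_space H K" by blast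
next
  fix z assume "z \<in> (*v) A ` sum_space H K"
  then obtain x y where "x \<in> H" "y \<in> K" "z = A *v x + A *v y"
    by (auto simp: sum_space_def matrix_vector_right_distrib)
  then show "z \<in> sum_space ((*v) A ` H) ((*v) A ` K)" unfolding sum_space_def by blast
qed

text \<open>Orthogonal projections onto the intersection, its complements in H and in K, and the
  complement of H + K. The last case also absorbs all indices above 3.\<close>

definition quad :: "(complex^'n) set \<Rightarrow> (complex^'n) set \<Rightarrow> nat \<Rightarrow> complex^'n^'n" where
  "quad H K j = (if j = 0 then proj (H \<inter> K) else if j = 1 then proj H - proj (H \<inter> K)
     else if j = 2 then proj K - proj (H \<inter> K) else mat 1 - proj (sum_space H K))"

definition quad_sum :: "(complex^'n) set \<Rightarrow> (complex^'n) set \<Rightarrow> complex^'n^'n" where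
  "quad_sum H K = (\<Sum>j<4. quad H K j)"

text \<open>The four ranges span the whole space but are not orthogonal in general; composing with the
  inverse of the sum turns the orthogonal projections into the idempotents of the direct sum.\<close>

definition decomp :: "(complex^'n) set \<Rightarrow> (complex^'n) set \<Rightarrow> nat \<Rightarrow> complex^'n^'n" where
  "decomp H K j = quad H K j ** matrix_inv (quad_sum H K)"

lemma sum_4: "(\<Sum>j<4. f j) = f 0 + f 1 + f 2 + f 3" for f :: "nat \<Rightarrow> 'a::comm_monoid_add"
  by (simp add: eval_nat_numeral add.assoc)

lemma less_4_cases: "j < 4 \<Longrightarrow> j = 0 \<or> j = 1 \<or> j = 2 \<or> j = 3" for j :: nat
  by auto

text \<open>Applying the projection onto the intersection isolates the first term, and the one onto
  H + K then splits off the last. The second term is minus the third, so it lies in both H and K and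
  is orthogonal to the intersection: it is 0.\<close>

lemma quad_independent:
  assumes H: "vec.subspace H" and K: "vec.subspace K"
    and sum: "(\<Sum>j<4. quad H K j *v w j) = 0" and j: "j < 4"
  shows "quad H K j *v w j = 0"
proof -
  let ?A = "proj (H \<inter> K)" and ?P = "proj H" and ?Q = "proj K" and ?S = "proj (sum_space H K)"
  have A: "is_proj ?A (H \<inter> K)" and P: "is_proj ?P H" and Q: "is_proj ?Q K" and S: "is_proj ?S (sum_space H K)"
    using H K subspace_sum_space by (auto intro!: is_proj_proj vec.subspace_inter)
  note sub = subset_sum_space[OF H K]
  have sq: "?A ** ?A = ?A" "?P ** ?P = ?P" "?Q ** ?Q = ?Q" "?S ** ?S = ?S"
    using A P Q S by (auto simp: is_proj_def)
  have AP: "?A ** ?P = ?A" "?P ** ?A = ?A" using is_proj_mult_eq[OF P A] by auto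
  have AQ: "?A ** ?Q = ?A" "?Q ** ?A = ?A" using is_proj_mult_eq[OF Q A] by auto
  have SP: "?S ** ?P = ?P" "?P ** ?S = ?P" using is_proj_mult_eq[OF S P sub(1)] by auto
  have SQ: "?S ** ?Q = ?Q" "?Q ** ?S = ?Q" using is_proj_mult_eq[OF S Q sub(2)] by auto
  have SA: "?S ** ?A = ?A" "?A ** ?S = ?A" using is_proj_mult_eq[OF S A] sub by auto
  have sum4: "?A *v w 0 + (?P - ?A) *v w 1 + (?Q - ?A) *v w 2 + (mat 1 - ?S) *v w 3 = 0"
    using sum by (simp add: sum_4 quad_def)
  have "?A *v (?A *v w 0 + (?P - ?A) *v w 1 + (?Q - ?A) *v w 2 + (mat 1 - ?S) *v w 3) = ?A *v w 0"
    by (simp add: matrix_vector_right_distrib matrix_vector_mul_assoc matrix_ring sq AP AQ SA)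
  then have w0: "?A *v w 0 = 0" unfolding sum4 by simp
  have "?S *v (?A *v w 0 + (?P - ?A) *v w 1 + (?Q - ?A) *v w 2 + (mat 1 - ?S) *v w 3) =
      ?A *v w 0 + (?P - ?A) *v w 1 + (?Q - ?A) *v w 2"
    by (simp add: matrix_vector_right_distrib matrix_vector_mul_assoc matrix_ring sq SP SQ SA)
  then have w012: "?A *v w 0 + (?P - ?A) *v w 1 + (?Q - ?A) *v w 2 = 0" unfolding sum4 by simp
  then have w3: "(mat 1 - ?S) *v w 3 = 0" using sum4 by simp
  define y where "y = (?P - ?A) *v w 1"
  have y: "y = - ((?Q - ?A) *v w 2)"
    using w012 w0 by (simp add: y_def eq_neg_iff_add_eq_0)
  have "?P *v y = y" by (simp add: y_def matrix_vector_mul_assoc matrix_ring sq AP)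
  moreover have "?Q *v y = y"
  proof -
    have "?Q *v ((?Q - ?A) *v w 2) = (?Q - ?A) *v w 2" by (simp add: matrix_vector_mul_assoc matrix_ring sq AQ)
    then show ?thesis unfolding y by (simp add: vec.neg)
  qed
  ultimately have "y \<in> H \<inter> K" using is_proj_fixes[OF P] is_proj_fixes[OF Q] by simp
  then have "?A *v y = y" using is_proj_fixes[OF A] by simp
  moreover have "?A *v y = 0" by (simp add: y_def matrix_vector_mul_assoc matrix_ring sq AP)
  ultimately have w1: "(?P - ?A) *v w 1 = 0" by (simp add: y_def)
  then have w2: "(?Q - ?A) *v w 2 = 0" using w012 w0 by simp
  show ?thesis using less_4_cases[OF j] w0 w1 w2 w3 by (auto simp: quad_def)
qed

context
  fixes H K :: "(complex^'n) set"
  assumes H: "vec.subspace H" and K: "vec.subspace K"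
begin

text \<open>By independence, a vector in the kernel is annihilated by all four projections. It then
  lies in H + K and is orthogonal to both H and K, hence to itself.\<close>

lemma quad_sum_invertible: "invertible (quad_sum H K)"
proof -
  have "x = 0" if x: "quad_sum H K *v x = 0" for x
  proof -
    have "(\<Sum>j<4. quad H K j *v x) = 0"
      using x by (simp add: quad_sum_def sum_4 matrix_vector_mult_add_rdistrib)
    from quad_independent[OF H K this]
    have "quad H K 0 *v x = 0" "quad H K 1 *v x = 0" "quad H K 2 *v x = 0" "quad H K 3 *v x = 0" by simp_all
    then have z: "proj H *v x = 0" "proj K *v x = 0" "proj (sum_space H K) *v x = x"
      by (auto simp: quad_def matrix_vector_mult_diff_rdistrib)
    have P: "is_proj (proj H) H" "is_proj (proj K) K" using H K is_proj_proj by auto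
    have "x \<in> sum_space H K"
      using z(3) is_proj_fixes[OF is_proj_proj[OF subspace_sum_space[OF H K]]] by simp
    then obtain u v where uv: "x = u + v" "u \<in> H" "v \<in> K" by (auto simp: sum_space_def)
    have "hip x u = hip x (proj H *v u)" "hip x v = hip x (proj K *v v)"
      using is_proj_fixes[OF P(1)] is_proj_fixes[OF P(2)] uv by simp_all
    then have "hip x u = 0" "hip x v = 0"
      using P z by (simp_all add: hip_adj is_proj_def)
    then have "hip x x = 0" unfolding uv(1) hip_add_right by (simp add: uv(1))
    then show "x = 0" by simp
  qed
  then show ?thesis unfolding invertible_left_inverse matrix_left_invertible_ker by blast
qed

lemma decomp_sum: "(\<Sum>j<4. decomp H K j) = mat 1"
  unfolding decomp_def matrix_sum_rdistrib[symmetric] quad_sum_def[symmetric]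
  by (rule matrix_inv_right[OF quad_sum_invertible])

text \<open>A vector in the j-th range is the sum of its images under all
  \<open>decomp H K i\<close> and also, trivially, its own j-th component; independence forces the
  two expansions to agree.\<close>

lemma decomp_apply_quad:
  assumes "i < 4" "j < 4"
  shows "decomp H K i *v (quad H K j *v x) = (if i = j then quad H K j *v x else 0)"
proof -
  define y where "y = quad H K j *v x"
  define z where "z = matrix_inv (quad_sum H K) *v y"
  have "(\<Sum>i<4. decomp H K i *v y) = y"
    using decomp_sum by (simp add: sum_4 matrix_vector_mult_add_rdistrib[symmetric])
  then have "(\<Sum>i<4. quad H K i *v z) = quad H K j *v x"
    by (simp add: decomp_def z_def y_def flip: matrix_vector_mul_assoc)
  moreover have "quad H K j *v x = (\<Sum>i<4. quad H K i *v (if i = j then x else 0))"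
  proof -
    have "quad H K i *v (if i = j then x else 0) = (if i = j then quad H K j *v x else 0)" for i by simp
    then show ?thesis using assms(2) by simp
  qed
  ultimately have "(\<Sum>i<4. quad H K i *v (z - (if i = j then x else 0))) = 0"
    by (simp add: matrix_vector_mult_diff_distrib sum_subtractf)
  from quad_independent[OF H K this assms(1)]
  have "quad H K i *v z = quad H K i *v (if i = j then x else 0)"
    by (simp add: matrix_vector_mult_diff_distrib)
  then show ?thesis by (simp add: decomp_def z_def y_def flip: matrix_vector_mul_assoc)
qed

lemma decomp_mult: "i < 4 \<Longrightarrow> j < 4 \<Longrightarrow> decomp H K i ** decomp H K j = (if i = j then decomp H K i else 0)"
  unfolding matrix_eq
  using decomp_apply_quad[of i j] by (simp add: decomp_def flip: matrix_vector_mul_assoc)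

text \<open>The pair can be recovered from its idempotents. This is why the orbit map sends every
  lift back to the spheroid.\<close>

lemma decomp_fixes:
  "H = {y. (decomp H K 0 + decomp H K 1) *v y = y}" "K = {y. (decomp H K 0 + decomp H K 2) *v y = y}"
proof -
  have P: "is_proj (proj H) H" "is_proj (proj K) K" "is_proj (proj (H \<inter> K)) (H \<inter> K)"
    using H K by (auto intro!: is_proj_proj vec.subspace_inter)
  have A: "proj (H \<inter> K) *v z \<in> H \<inter> K" for z
    using P(3) by (auto simp: is_proj_def)
  have ran: "proj H *v z \<in> H" "proj K *v z \<in> K" for z
    using P by (auto simp: is_proj_def)
  have H1: "quad H K 0 *v z + quad H K 1 *v z' \<in> H" and K1: "quad H K 0 *v z + quad H K 2 *v z' \<in> K" for z z'
    using A[of z] A[of z'] ran[of z'] H K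
    by (auto simp: quad_def matrix_vector_mult_diff_rdistrib intro!: vec.subspace_add vec.subspace_diff)
  have H2: "(decomp H K 0 + decomp H K 1) *v y = y" if "y \<in> H" for y
  proof -
    have y: "y = quad H K 0 *v y + quad H K 1 *v y"
      using is_proj_fixes[OF P(1)] that by (simp add: quad_def matrix_vector_mult_diff_rdistrib)
    show ?thesis
      apply (subst y, subst (3) y)
      by (simp add: matrix_vector_mult_add_rdistrib matrix_vector_right_distrib decomp_apply_quad)
  qed
  have K2: "(decomp H K 0 + decomp H K 2) *v y = y" if "y \<in> K" for y
  proof -
    have y: "y = quad H K 0 *v y + quad H K 2 *v y"
      using is_proj_fixes[OF P(2)] that by (simp add: quad_def matrix_vector_mult_diff_rdistrib)
    show ?thesis
      apply (subst y, subst (3) y)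
      by (simp add: matrix_vector_mult_add_rdistrib matrix_vector_right_distrib decomp_apply_quad)
  qed
  have "(decomp H K 0 + decomp H K 1) *v y \<in> H" "(decomp H K 0 + decomp H K 2) *v y \<in> K" for y
    using H1 K1 by (simp_all add: matrix_vector_mult_add_rdistrib decomp_def flip: matrix_vector_mul_assoc)
  then show "H = {y. (decomp H K 0 + decomp H K 1) *v y = y}" "K = {y. (decomp H K 0 + decomp H K 2) *v y = y}"
    using H2 K2 by (metis (mono_tags, lifting) Collect_cong Collect_mem_eq)+
qed

lemma decomp_3_eq_0: "sum_space H K = UNIV \<Longrightarrow> decomp H K 3 = 0"
proof -
  assume *: "sum_space H K = UNIV"
  have "is_proj (mat 1) (UNIV :: (complex^'n) set)" by (simp add: is_proj_def)
  then have "proj (sum_space H K) = mat 1" unfolding * by (rule proj_eqI)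
  then show ?thesis by (simp add: decomp_def quad_def)
qed

end

section \<open>Coordinate subspaces\<close>

definition coord_space :: "('n \<Rightarrow> nat) \<Rightarrow> nat set \<Rightarrow> (complex^'n) set" where
  "coord_space \<sigma> J = {v. \<forall>l. \<sigma> l \<notin> J \<longrightarrow> v $ l = 0}"

lemma subspace_coord_space: "vec.subspace (coord_space \<sigma> J)"
  by (auto simp: vec.subspace_def coord_space_def)

lemma adj_block_idem: "adj (block_idem \<sigma> j) = block_idem \<sigma> j"
  by (auto simp: adj_def block_idem_def vec_eq_iff)

lemma is_proj_coord_space: "finite J \<Longrightarrow> is_proj (\<Sum>j\<in>J. block_idem \<sigma> j) (coord_space \<sigma> J)"
proof -
  assume J: "finite J"
  let ?P = "\<Sum>j\<in>J. block_idem \<sigma> j"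
  have nth: "(?P *v v) $ l = (if \<sigma> l \<in> J then v $ l else 0)" for v l
  proof -
    have "?P $ l $ m = (if m = l then if \<sigma> l \<in> J then 1 else 0 else 0)" for m
      using J by (simp add: block_idem_def sum_component)
    then have "?P $ l $ m * v $ m = (if m = l then if \<sigma> l \<in> J then v $ l else 0 else 0)" for m by simp
    then show ?thesis by (simp add: matrix_vector_mult_def)
  qed
  have "adj ?P = ?P"
    using J by (induction J) (simp_all add: adj_block_idem)
  moreover have "?P ** ?P = ?P"
    unfolding matrix_eq matrix_vector_mul_assoc[symmetric] by (simp add: vec_eq_iff nth)
  moreover have "range ((*v) ?P) = coord_space \<sigma> J"
  proof (intro equalityI subsetI)
    fix v assume "v \<in> coord_space \<sigma> J"
    then have "v = ?P *v v" by (simp add: vec_eq_iff nth coord_space_def)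
    then show "v \<in> range ((*v) ?P)" by blast
  qed (auto simp: coord_space_def nth)
  ultimately show "is_proj ?P (coord_space \<sigma> J)" by (simp add: is_proj_def)
qed

lemma is_proj_unitary_image:
  assumes U: "adj g ** g = mat 1" and P: "is_proj P H"
  shows "is_proj (g ** P ** adj g) ((*v) g ` H)"
proof -
  have U': "M ** adj g ** g = M" for M using U by (simp flip: matrix_mul_assoc)
  have "g ** adj g = mat 1" using U matrix_left_right_inverse by blast
  then have surj: "range ((*v) (adj g)) = UNIV"
    by (metis U matrix_left_right_inverse matrix_right_invertible_surjective)
  have "range ((*v) (g ** P ** adj g)) = (*v) g ` (*v) P ` range ((*v) (adj g))"
    by (simp add: image_image flip: matrix_vector_mul_assoc)
  moreover have "(*v) P ` UNIV = H" using P by (simp add: is_proj_def)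
  moreover have "g ** P ** adj g ** (g ** P ** adj g) = g ** P ** adj g"
    using P by (simp add: is_proj_def matrix_mul_assoc U') (metis matrix_mul_assoc)
  ultimately show ?thesis
    using P by (simp add: is_proj_def adj_mult matrix_mul_assoc surj)
qed

text \<open>A unitary matrix preserves orthogonal complements, so all four projections are
  conjugated by g. The coordinate ones sum to the identity, hence \<open>quad_sum\<close> is the
  identity and no correction by its inverse occurs.\<close>

lemma decomp_unitary_image:
  fixes g :: "complex^'n^'n"
  assumes U: "adj g ** g = mat 1" and \<sigma>: "\<And>l. \<sigma> l < 4" and j: "j < 4"
  shows "decomp ((*v) g ` coord_space \<sigma> {0,1}) ((*v) g ` coord_space \<sigma> {0,2}) j ** g = g ** block_idem \<sigma> j"
proof -
  let ?L = "coord_space \<sigma> {0,1}" and ?K = "coord_space \<sigma> {0,2}" and ?D = "block_idem \<sigma>"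
  let ?H1 = "(*v) g ` ?L" and ?H2 = "(*v) g ` ?K"
  have inv: "invertible g" by (rule unitary_invertible[OF U])
  have inj: "inj ((*v) g)" using inv matrix_left_invertible_injective invertible_left_inverse by blast
  have gg: "g ** adj g = mat 1" using U matrix_left_right_inverse by blast
  have L: "proj ?H1 = g ** (?D 0 + ?D 1) ** adj g"
    by (rule proj_eqI[OF is_proj_unitary_image[OF U]]) (use is_proj_coord_space[of "{0,1}" \<sigma>] in simp)
  have K: "proj ?H2 = g ** (?D 0 + ?D 2) ** adj g"
    by (rule proj_eqI[OF is_proj_unitary_image[OF U]]) (use is_proj_coord_space[of "{0,2}" \<sigma>] in simp)
  have I: "?L \<inter> ?K = coord_space \<sigma> {0}" by (auto simp: coord_space_def)
  have "?H1 \<inter> ?H2 = (*v) g ` (?L \<inter> ?K)" using inj by (simp add: image_Int)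
  then have A: "proj (?H1 \<inter> ?H2) = g ** ?D 0 ** adj g"
    unfolding I by (simp only:) (rule proj_eqI[OF is_proj_unitary_image[OF U]], use is_proj_coord_space[of "{0}" \<sigma>] in simp)
  have "sum_space ?L ?K = coord_space \<sigma> {0,1,2}"
  proof (intro equalityI subsetI)
    fix v assume v: "v \<in> coord_space \<sigma> {0,1,2}"
    have "v = (\<chi> l. if \<sigma> l \<in> {0,1} then v $ l else 0) + (\<chi> l. if \<sigma> l \<in> {0,1} then 0 else v $ l)"
      by (simp add: vec_eq_iff)
    moreover have "(\<chi> l. if \<sigma> l \<in> {0,1} then v $ l else 0) \<in> ?L" by (simp add: coord_space_def)
    moreover have "(\<chi> l. if \<sigma> l \<in> {0,1} then 0 else v $ l) \<in> ?K" using v by (auto simp: coord_space_def)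
    ultimately show "v \<in> sum_space ?L ?K" unfolding sum_space_def by blast
  qed (auto simp: sum_space_def coord_space_def)
  moreover have "sum_space ?H1 ?H2 = (*v) g ` sum_space ?L ?K"
    by (rule sum_space_image)
  ultimately have S: "proj (sum_space ?H1 ?H2) = g ** (?D 0 + ?D 1 + ?D 2) ** adj g"
    by (simp only:) (rule proj_eqI[OF is_proj_unitary_image[OF U]], use is_proj_coord_space[of "{0,1,2}" \<sigma>] in \<open>simp add: add.assoc\<close>)
  have D: "?D 0 + ?D 1 + ?D 2 + ?D 3 = mat 1"
  proof -
    have "(?D 0 + ?D 1 + ?D 2 + ?D 3) $ a $ b = (mat 1 :: complex^'n^'n) $ a $ b" for a b
      using less_4_cases[OF \<sigma>[of a]] by (elim disjE) (simp_all add: block_idem_def mat_def)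
    then show ?thesis by (simp only: vec_eq_iff) blast
  qed
  have q3: "mat 1 - proj (sum_space ?H1 ?H2) = g ** ?D 3 ** adj g"
  proof -
    have "mat 1 = g ** (?D 0 + ?D 1 + ?D 2 + ?D 3) ** adj g" unfolding D by (simp add: gg)
    then show ?thesis unfolding S by (simp add: matrix_ring)
  qed
  have q: "quad ?H1 ?H2 j = g ** ?D j ** adj g" if "j < 4" for j
  proof -
    have "quad ?H1 ?H2 0 = g ** ?D 0 ** adj g" unfolding quad_def A by simp
    moreover have "quad ?H1 ?H2 1 = g ** ?D 1 ** adj g" unfolding quad_def A L by (simp add: matrix_ring)
    moreover have "quad ?H1 ?H2 2 = g ** ?D 2 ** adj g" unfolding quad_def A K by (simp add: matrix_ring)
    moreover have "quad ?H1 ?H2 3 = g ** ?D 3 ** adj g" unfolding quad_def using q3 by simp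
    ultimately show ?thesis using less_4_cases[OF that] by metis
  qed
  have "quad_sum ?H1 ?H2 = g ** (?D 0 + ?D 1 + ?D 2 + ?D 3) ** adj g"
    using q[of 0] q[of 1] q[of 2] q[of 3] by (simp add: quad_sum_def sum_4 matrix_ring)
  then have "quad_sum ?H1 ?H2 = mat 1" unfolding D by (simp add: gg)
  then have "decomp ?H1 ?H2 j = g ** ?D j ** adj g"
    using q[OF j] by (simp add: decomp_def)
  then show ?thesis by (simp add: U flip: matrix_mul_assoc)
qed

section \<open>Topology of the space of pairs of subspaces\<close>

lemma invertible_image:
  fixes A :: "complex^'n^'n"
  assumes "invertible A"
  shows inj_invertible: "inj ((*v) A)" and dim_invertible_image: "vec.dim ((*v) A ` H) = vec.dim H"
proof -
  show inj: "inj ((*v) A)" using assms matrix_left_invertible_injective invertible_left_inverse by blast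
  show "vec.dim ((*v) A ` H) = vec.dim H"
    by (rule vec.dim_image_eq) (use inj in \<open>auto intro: inj_on_subset\<close>)
qed

lemma continuous_map_comp_euclidean:
  "continuous_map X euclidean f \<Longrightarrow> continuous_on UNIV g \<Longrightarrow> continuous_map X euclidean (\<lambda>x. g (f x))"
  using continuous_map_compose[of X euclidean f euclidean g] by (simp add: o_def)

lemma continuous_map_matrix_vector:
  "continuous_map X euclidean b \<Longrightarrow> continuous_map X euclidean (\<lambda>x. A *v b x)" for A :: "complex^'n^'n"
  by (rule continuous_map_comp_euclidean) (auto intro!: continuous_intros)

lemma continuous_map_matrix_vector_const:
  "continuous_map X euclidean A \<Longrightarrow> continuous_map X euclidean (\<lambda>x. A x *v y)" for A :: "'x \<Rightarrow> complex^'n^'n"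
  by (rule continuous_map_comp_euclidean) (auto intro!: continuous_intros)

lemma continuous_map_euclidean_mult:
  fixes f g :: "'x \<Rightarrow> complex^'n^'n"
  assumes "continuous_map X euclidean f" "continuous_map X euclidean g"
  shows "continuous_map X euclidean (\<lambda>x. f x ** g x)"
proof -
  have "continuous_map X (prod_topology euclidean euclidean) (\<lambda>x. (f x, g x))"
    by (rule continuous_map_pairedI[OF assms])
  from continuous_map_compose[OF this, of euclidean "\<lambda>p :: (complex^'n^'n) \<times> (complex^'n^'n). fst p ** snd p"]
  show ?thesis
    by (simp add: o_def euclidean_product_topology continuous_on_matrix_mult continuous_on_fst continuous_on_snd)
qed

lemma continuous_map_euclidean_matrix_inv:
  fixes f :: "'x \<Rightarrow> complex^'n^'n"
  assumes "continuous_map X euclidean f" "\<And>x. x \<in> topspace X \<Longrightarrow> invertible (f x)"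
  shows "continuous_map X euclidean (\<lambda>x. matrix_inv (f x))"
proof -
  have 1: "continuous_map X (top_of_set {A. invertible A}) f"
    using assms by (auto simp: continuous_map_in_subtopology)
  have 2: "continuous_map (top_of_set {A :: complex^'n^'n. invertible A}) euclidean matrix_inv"
    using continuous_on_matrix_inv[of "{A. invertible A}" "\<lambda>A. A"] by (simp add: continuous_on_id)
  show ?thesis using continuous_map_compose[OF 1 2] by (simp add: o_def)
qed

text \<open>By the quotient map, continuity may be tested on frames.\<close>

lemma continuous_map_proj_grassmann:
  fixes A :: "complex^'n^'n"
  assumes A: "invertible A"
  shows "continuous_map (grassmann_top k) euclidean (\<lambda>H. proj ((*v) A ` H))"
proof (rule continuous_compose_quotient_map[OF quotient_map_frame_span])
  have "continuous_map (frames k) euclidean (\<lambda>v. proj ((*v) A ` frame_span k v))"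
  proof (rule continuous_map_proj)
    fix v :: "nat \<Rightarrow> complex^'n" assume "v \<in> topspace (frames k)"
    then have "frame_span k v \<in> grassmannian k" using frame_span_image by blast
    then show "vec.subspace ((*v) A ` frame_span k v) \<and> vec.dim ((*v) A ` frame_span k v) = k"
      by (auto simp: grassmannian_def dim_invertible_image[OF A] intro: vec.subspace_image)
  next
    fix v y assume v: "v \<in> topspace (frames k)" and "y \<in> (*v) A ` frame_span k v"
    then obtain u where u: "u \<in> frame_span k v" "y = A *v u" by blast
    have inj: "inj_on v {..<k}" using v by (simp add: frames_def)
    obtain c where "u = (\<Sum>x\<in>v ` {..<k}. c x *s x)"
      using u(1) unfolding frame_span_def by (subst (asm) vec.span_finite) auto
    then have c: "u = (\<Sum>j<k. c (v j) *s v j)" by (simp add: sum.reindex[OF inj] o_def)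
    \<comment> \<open>Extends y to a continuous section by freezing its coefficients and varying the
      frame.\<close>
    define b where "b w = A *v (\<Sum>j<k. c (v j) *s w j)" for w :: "nat \<Rightarrow> complex^'n"
    have "continuous_map (frames k) euclidean b"
      unfolding b_def
    proof (intro continuous_map_matrix_vector continuous_map_sum)
      fix j assume j: "j \<in> {..<k}"
      have "continuous_map (frames k) euclidean (\<lambda>w. w j)"
        unfolding frames_def by (intro continuous_map_from_subtopology continuous_map_product_projection[OF j])
      then show "continuous_map (frames k) euclidean (\<lambda>w. c (v j) *s w j)"
        by (rule continuous_map_comp_euclidean) (auto intro!: continuous_intros)
    qed simp
    moreover have "b v = y" by (simp add: b_def u c)
    moreover have "b w \<in> (*v) A ` frame_span k w" for w
      unfolding b_def frame_span_def
      by (intro imageI vec.span_sum vec.span_scale vec.span_base) auto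
    ultimately show "\<exists>b. continuous_map (frames k) euclidean b \<and> b v = y \<and>
        (\<forall>z\<in>topspace (frames k). b z \<in> (*v) A ` frame_span k z)" by blast
  qed
  then show "continuous_map (frames k) euclidean ((\<lambda>H. proj ((*v) A ` H)) \<circ> frame_span k)" by (simp add: o_def)
qed

text \<open>The action lifts to frames: a fixed frame of L is moved by
  \<open>G ** g\<close>.\<close>

lemma continuous_map_grassmann_action:
  fixes L :: "(complex^'n) set" and G :: "complex^'n^'n"
  assumes L: "L \<in> grassmannian k" and G: "invertible G"
  shows "continuous_map (top_of_set {g. invertible g}) (grassmann_top k) (\<lambda>g. (*v) (G ** g) ` L)"
proof -
  obtain v where v: "v \<in> topspace (frames k)" "L = frame_span k v"
    using L frame_span_image by blast
  define \<phi> where "\<phi> g = (\<lambda>j\<in>{..<k}. (G ** g) *v v j)" for g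
  have im: "\<phi> g ` {..<k} = (*v) (G ** g) ` v ` {..<k}" for g
    by (simp add: \<phi>_def image_image)
  have span: "frame_span k (\<phi> g) = (*v) (G ** g) ` L" for g
    unfolding frame_span_def im v(2) by (rule vec.span_image)
  have "continuous_map (top_of_set {g. invertible g}) (frames k) \<phi>"
    unfolding frames_def continuous_map_in_subtopology continuous_map_componentwise
  proof (intro conjI ballI)
    show "continuous_map (top_of_set {g. invertible g}) euclidean (\<lambda>g. \<phi> g j)" if "j \<in> {..<k}" for j
      using that by (auto simp: \<phi>_def intro!: continuous_intros)
    show "\<phi> \<in> topspace (top_of_set {g. invertible g}) \<rightarrow> {v. inj_on v {..<k} \<and> vec.independent (v ` {..<k})}"
    proof (intro funcsetI CollectI conjI)
      fix g :: "complex^'n^'n" assume "g \<in> topspace (top_of_set {g. invertible g})"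
      then have "inj ((*v) (G ** g))" using G by (simp add: inj_invertible invertible_mult)
      moreover have "inj_on v {..<k}" "vec.independent (v ` {..<k})" using v(1) by (auto simp: frames_def)
      ultimately show "inj_on (\<phi> g) {..<k}" "vec.independent (\<phi> g ` {..<k})"
        unfolding im by (auto simp: \<phi>_def inj_on_def)
          (meson inj_on_subset subset_UNIV vec.independent_injective_image injI)
    qed
  qed (auto simp: \<phi>_def)
  from continuous_map_compose[OF this quotient_imp_continuous_map[OF quotient_map_frame_span]]
  show ?thesis by (simp add: o_def span)
qed

lemma F2_simps: "(H, K) \<in> F2 i k \<longleftrightarrow> vec.subspace H \<and> vec.dim H = k \<and> vec.subspace K \<and> vec.dim K = k \<and>
    H \<noteq> K \<and> vec.dim (sum_space H K) = i"
  by (auto simp: F2_def grassmannian_def sum_space_def)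

lemma F2_invertible_image:
  fixes A :: "complex^'n^'n"
  assumes A: "invertible A" and HK: "(H, K) \<in> F2 i k"
  shows "((*v) A ` H, (*v) A ` K) \<in> F2 i k"
  using HK inj_invertible[OF A]
  by (auto simp: F2_simps dim_invertible_image[OF A] sum_space_image inj_image_eq_iff intro: vec.subspace_image)

text \<open>The intersection is the orthogonal complement of the sum of the complements of H and K.
  Unlike intersections, sums come with continuous sections through each of their vectors.\<close>

lemma is_proj_complement:
  assumes H: "vec.subspace H" and K: "vec.subspace K"
  shows "is_proj (mat 1 - proj (sum_space (range ((*v) (mat 1 - proj H))) (range ((*v) (mat 1 - proj K))))) (H \<inter> K)"
proof -
  have sr: "vec.subspace (range ((*v) M))" for M :: "complex^'n^'n" by (rule vec.subspace_image) simp
  let ?N = "sum_space (range ((*v) (mat 1 - proj H))) (range ((*v) (mat 1 - proj K)))"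
  have N: "is_proj (proj ?N) ?N" by (intro is_proj_proj subspace_sum_space sr)
  have P: "is_proj (proj H) H" "is_proj (proj K) K" using H K is_proj_proj by auto
  note sub = subset_sum_space(1)[OF sr sr, of "mat 1 - proj H" "mat 1 - proj K"]
    subset_sum_space(2)[OF sr sr, of "mat 1 - proj K" "mat 1 - proj H"]
  \<comment> \<open>A vector annihilated by the projection onto the sum is annihilated by those onto
    both complements. Conversely a vector of the intersection is orthogonal to the sum, so its
    projection has length 0.\<close>
  have eq: "proj ?N *v y = 0 \<longleftrightarrow> y \<in> H \<inter> K" for y
  proof
    assume y: "proj ?N *v y = 0"
    have *: "proj M *v y = y" if "range ((*v) (mat 1 - proj M)) \<subseteq> ?N" "is_proj (proj M) M" for M
    proof -
      have "(mat 1 - proj M) *v y \<in> ?N" using that(1) by blast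
      then have "proj ?N *v ((mat 1 - proj M) *v y) = (mat 1 - proj M) *v y" using is_proj_fixes[OF N] by simp
      moreover have "is_proj (mat 1 - proj M) (range ((*v) (mat 1 - proj M)))"
        using that(2) by (simp add: is_proj_def matrix_ring)
      ultimately have "proj ?N ** (mat 1 - proj M) = mat 1 - proj M" "(mat 1 - proj M) ** proj ?N = mat 1 - proj M"
        using is_proj_mult_eq[OF N _ that(1)] by auto
      then have "(mat 1 - proj M) *v y = (mat 1 - proj M) *v (proj ?N *v y)"
        by (simp add: matrix_vector_mul_assoc)
      then have "(mat 1 - proj M) *v y = 0" using y by simp
      then show ?thesis by (simp add: matrix_vector_mult_diff_rdistrib)
    qed
    show "y \<in> H \<inter> K" using *[OF sub(1) P(1)] *[OF sub(2) P(2)] is_proj_fixes[OF P(1)] is_proj_fixes[OF P(2)] by simp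
  next
    assume y: "y \<in> H \<inter> K"
    then have Py: "proj H *v y = y" "proj K *v y = y" using is_proj_fixes[OF P(1)] is_proj_fixes[OF P(2)] by auto
    have "proj ?N *v y \<in> ?N" using N by (auto simp: is_proj_def)
    then obtain u v where uv: "proj ?N *v y = (mat 1 - proj H) *v u + (mat 1 - proj K) *v v"
      by (auto simp: sum_space_def)
    have "hip y ((mat 1 - proj M) *v z) = 0" if "proj M *v y = y" "is_proj (proj M) M" for M z
      using that unfolding hip_adj by (simp add: is_proj_def matrix_vector_mult_diff_rdistrib)
    then have "hip y (proj ?N *v y) = 0" unfolding uv hip_add_right using Py P by simp
    moreover have "hip (proj ?N *v y) (proj ?N *v y) = hip y (proj ?N *v y)"
      using N by (simp add: hip_adj matrix_vector_mul_assoc is_proj_def flip: hip_adj[of y])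
    ultimately show "proj ?N *v y = 0" by simp
  qed
  have sq: "proj ?N ** proj ?N = proj ?N" "adj (proj ?N) = proj ?N" using N by (auto simp: is_proj_def)
  have "range ((*v) (mat 1 - proj ?N)) = H \<inter> K"
  proof (intro equalityI subsetI)
    fix y assume "y \<in> H \<inter> K"
    then have "y = (mat 1 - proj ?N) *v y" using eq by (simp add: matrix_vector_mult_diff_rdistrib)
    then show "y \<in> range ((*v) (mat 1 - proj ?N))" by blast
  next
    fix y assume "y \<in> range ((*v) (mat 1 - proj ?N))"
    then obtain z where "y = (mat 1 - proj ?N) *v z" by blast
    then have "proj ?N *v y = 0" by (simp add: matrix_vector_mul_assoc matrix_ring sq)
    then show "y \<in> H \<inter> K" using eq by blast
  qed
  then show ?thesis by (simp add: is_proj_def matrix_ring sq)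
qed

text \<open>Sum and intersection have constant dimension on the space of pairs, so their projections
  are continuous by lower semicontinuity.\<close>

lemma continuous_map_decomp:
  fixes A :: "complex^'n^'n"
  assumes A: "invertible A"
  shows "continuous_map (F2_top i k) euclidean (\<lambda>x. decomp ((*v) A ` fst x) ((*v) A ` snd x) j)"
proof -
  let ?X = "F2_top i k :: ((complex^'n) set \<times> (complex^'n) set) topology"
  let ?H = "\<lambda>x. (*v) A ` fst x" and ?K = "\<lambda>x. (*v) A ` snd x"
  have top: "x \<in> topspace ?X \<Longrightarrow> (?H x, ?K x) \<in> F2 i k" for x
    using F2_invertible_image[OF A] by (cases x) (simp add: topspace_F2_top)
  then have sub: "vec.subspace (?H x)" "vec.subspace (?K x)" if "x \<in> topspace ?X" for x
    using that by (auto simp: F2_simps)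
  have contH: "continuous_map ?X euclidean (\<lambda>x. proj (?H x))"
    using continuous_map_compose[OF continuous_map_fst continuous_map_proj_grassmann[OF A]]
    by (auto simp: F2_top_def o_def intro!: continuous_map_from_subtopology)
  have contK: "continuous_map ?X euclidean (\<lambda>x. proj (?K x))"
    using continuous_map_compose[OF continuous_map_snd continuous_map_proj_grassmann[OF A]]
    by (auto simp: F2_top_def o_def intro!: continuous_map_from_subtopology)
  have cont_sum: "continuous_map ?X euclidean (\<lambda>x. proj (sum_space (range ((*v) (P x))) (range ((*v) (Q x)))))"
    if P: "continuous_map ?X euclidean P" and Q: "continuous_map ?X euclidean Q"
      and dim: "\<And>x. x \<in> topspace ?X \<Longrightarrow> vec.dim (sum_space (range ((*v) (P x))) (range ((*v) (Q x)))) = m"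
    for P Q :: "_ \<Rightarrow> complex^'n^'n" and m
  proof (rule continuous_map_proj)
    fix x assume x: "x \<in> topspace ?X"
    have "vec.subspace (range ((*v) M))" for M :: "complex^'n^'n" by (rule vec.subspace_image) simp
    then show "vec.subspace (sum_space (range ((*v) (P x))) (range ((*v) (Q x)))) \<and>
        vec.dim (sum_space (range ((*v) (P x))) (range ((*v) (Q x)))) = m"
      using dim[OF x] by (simp add: subspace_sum_space)
    fix y assume "y \<in> sum_space (range ((*v) (P x))) (range ((*v) (Q x)))"
    then obtain u v where uv: "y = P x *v u + Q x *v v" by (auto simp: sum_space_def)
    have "continuous_map ?X euclidean (\<lambda>x. P x *v u + Q x *v v)"
      by (intro continuous_map_add continuous_map_matrix_vector_const P Q)
    then show "\<exists>b. continuous_map ?X euclidean b \<and> b x = y \<and>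
        (\<forall>z\<in>topspace ?X. b z \<in> sum_space (range ((*v) (P z))) (range ((*v) (Q z))))"
      unfolding sum_space_def uv by blast
  qed
  have rng: "range ((*v) (proj (?H x))) = ?H x" "range ((*v) (proj (?K x))) = ?K x" if "x \<in> topspace ?X" for x
    using is_proj_proj sub[OF that] by (auto simp: is_proj_def)
  have "continuous_map ?X euclidean (\<lambda>x. proj (sum_space (range ((*v) (proj (?H x)))) (range ((*v) (proj (?K x))))))"
    by (rule cont_sum[OF contH contK, of i]) (use top in \<open>auto simp: rng F2_simps\<close>)
  then have contS: "continuous_map ?X euclidean (\<lambda>x. proj (sum_space (?H x) (?K x)))"
    by (rule continuous_map_eq) (simp add: rng)
  define N where "N x = sum_space (range ((*v) (mat 1 - proj (?H x)))) (range ((*v) (mat 1 - proj (?K x))))" for x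
  have NI: "proj (?H x \<inter> ?K x) = mat 1 - proj (N x)" if "x \<in> topspace ?X" for x
    unfolding N_def by (rule proj_eqI[OF is_proj_complement[OF sub[OF that]]])
  have "continuous_map ?X euclidean (\<lambda>x. proj (N x))"
    unfolding N_def
  proof (rule cont_sum)
    show "continuous_map ?X euclidean (\<lambda>x. mat 1 - proj (?H x))" "continuous_map ?X euclidean (\<lambda>x. mat 1 - proj (?K x))"
      by (intro continuous_map_diff contH contK; simp)+
    fix x assume x: "x \<in> topspace ?X"
    have "vec.subspace (range ((*v) M))" for M :: "complex^'n^'n" by (rule vec.subspace_image) simp
    then have "of_nat (vec.dim (N x)) = trace (proj (N x))"
      unfolding N_def by (intro trace_proj[symmetric] subspace_sum_space)
    also have "\<dots> = trace (mat 1 - proj (?H x \<inter> ?K x))" unfolding NI[OF x] by simp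
    also have "\<dots> = of_nat CARD('n) - of_nat (vec.dim (?H x \<inter> ?K x))"
      using sub[OF x] by (simp add: trace_sub trace_I trace_proj vec.subspace_inter)
    finally have "(of_nat (vec.dim (N x) + vec.dim (?H x \<inter> ?K x)) :: complex) = of_nat CARD('n)"
      by simp
    then have "vec.dim (N x) + vec.dim (?H x \<inter> ?K x) = CARD('n)" by (simp only: of_nat_eq_iff)
    moreover have "vec.dim (sum_space (?H x) (?K x)) + vec.dim (?H x \<inter> ?K x) = vec.dim (?H x) + vec.dim (?K x)"
      unfolding sum_space_def by (rule vec.dim_sums_Int[OF sub[OF x]])
    \<comment> \<open>The intersection has dimension 2k - i; this is the dimension of its orthogonal
      complement.\<close>
    ultimately show "vec.dim (sum_space (range ((*v) (mat 1 - proj (?H x)))) (range ((*v) (mat 1 - proj (?K x))))) = CARD('n) + i - 2 * k"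
      using top[OF x] by (simp add: F2_simps N_def)
  qed
  then have "continuous_map ?X euclidean (\<lambda>x. mat 1 - proj (N x))"
    by (intro continuous_map_diff) simp_all
  then have contI: "continuous_map ?X euclidean (\<lambda>x. proj (?H x \<inter> ?K x))"
    by (rule continuous_map_eq) (simp add: NI)
  have contq: "continuous_map ?X euclidean (\<lambda>x. quad (?H x) (?K x) j)" for j
    unfolding quad_def
    by (cases "j = 0"; cases "j = 1"; cases "j = 2") (auto intro!: continuous_map_diff contH contK contI contS)
  have "continuous_map ?X euclidean (\<lambda>x. quad_sum (?H x) (?K x))"
    unfolding quad_sum_def by (intro continuous_map_sum contq) simp
  then show ?thesis
    unfolding decomp_def
    by (intro continuous_map_euclidean_mult contq continuous_map_euclidean_matrix_inv quad_sum_invertible sub)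
qed

section \<open>Bases adapted to a pair of subspaces\<close>

lemma image_coord_space:
  fixes G :: "complex^'n^'n"
  shows "(*v) G ` coord_space \<sigma> J = vec.span ((\<lambda>l. column l G) ` {l. \<sigma> l \<in> J})"
proof (intro equalityI subsetI)
  fix y assume "y \<in> (*v) G ` coord_space \<sigma> J"
  then obtain v where v: "v \<in> coord_space \<sigma> J" "y = G *v v" by blast
  have "v $ l *s column l G \<in> vec.span ((\<lambda>l. column l G) ` {l. \<sigma> l \<in> J})" for l
  proof (cases "\<sigma> l \<in> J")
    case True then show ?thesis by (intro vec.span_scale vec.span_base) auto
  next
    case False then show ?thesis using v(1) by (simp add: coord_space_def vec.span_zero)
  qed
  then show "y \<in> vec.span ((\<lambda>l. column l G) ` {l. \<sigma> l \<in> J})"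
    unfolding v(2) matrix_mult_sum by (intro vec.span_sum)
next
  fix y assume y: "y \<in> vec.span ((\<lambda>l. column l G) ` {l. \<sigma> l \<in> J})"
  have col: "column l G = G *v axis l 1" for l
    by (simp add: vec_eq_iff column_def matrix_vector_mult_def axis_def if_distrib cong: if_cong)
  have "axis l 1 \<in> coord_space \<sigma> J" if "\<sigma> l \<in> J" for l
    using that by (auto simp: coord_space_def axis_def)
  then have "(\<lambda>l. column l G) ` {l. \<sigma> l \<in> J} \<subseteq> (*v) G ` coord_space \<sigma> J"
    by (auto simp: col)
  from vec.span_minimal[OF this vec.subspace_image[OF subspace_coord_space]] y
  show "y \<in> (*v) G ` coord_space \<sigma> J" by blast
qed

text \<open>A basis of the intersection is extended to H and to K, and their union to the whole
  space. From i < 2k the label 0 occurs, from k < i the labels 1 and 2, and label 3 occurs exactly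
  when H + K is proper.\<close>

lemma adapted_basis:
  fixes H K :: "(complex^'n) set"
  assumes HK: "(H, K) \<in> F2 i k" and k: "k < i" "i < 2 * k"
  obtains G :: "complex^'n^'n" and \<sigma> :: "'n \<Rightarrow> nat" where "invertible G"
    "range \<sigma> = {..<(if i = CARD('n) then 3 else 4)}"
    "H = (*v) G ` coord_space \<sigma> {0,1}" "K = (*v) G ` coord_space \<sigma> {0,2}"
proof -
  have H: "vec.subspace H" "vec.dim H = k" and K: "vec.subspace K" "vec.dim K = k"
    and S: "vec.dim (sum_space H K) = i"
    using HK by (auto simp: F2_simps)
  have "vec.dim (sum_space H K) + vec.dim (H \<inter> K) = vec.dim H + vec.dim K"
    unfolding sum_space_def by (rule vec.dim_sums_Int[OF H(1) K(1)])
  then have dimI: "vec.dim (H \<inter> K) = 2 * k - i" using H K S by simp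
  obtain A where A: "A \<subseteq> H \<inter> K" "vec.independent A" "H \<inter> K \<subseteq> vec.span A" "card A = 2 * k - i"
    using vec.basis_exists[of "H \<inter> K"] dimI by metis
  obtain B where B: "A \<subseteq> B" "B \<subseteq> H" "vec.independent B" "H \<subseteq> vec.span B"
    using vec.maximal_independent_subset_extend[of A H] A by blast
  obtain C where C: "A \<subseteq> C" "C \<subseteq> K" "vec.independent C" "K \<subseteq> vec.span C"
    using vec.maximal_independent_subset_extend[of A K] A by blast
  have cB: "card B = k" and cC: "card C = k"
    using vec.basis_card_eq_dim B C H K by metis+
  have fin: "finite A" "finite B" "finite C"
    using A B C vec.finiteI_independent by blast+
  have BC: "B \<inter> C = A"
  proof -
    have "vec.independent (B \<inter> C)" using B(3) by (rule vec.independent_mono) simp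
    moreover have "B \<inter> C \<subseteq> H \<inter> K" using B C by blast
    ultimately have "card (B \<inter> C) \<le> card A" using vec.independent_card_le_dim dimI A(4) by metis
    moreover have "A \<subseteq> B \<inter> C" using B C by blast
    ultimately show ?thesis using fin by (metis card_seteq finite_Int)
  qed
  have "card (B \<union> C) + card A = 2 * k"
    using card_Un_Int[OF fin(2,3)] BC cB cC by simp
  then have cBC: "card (B \<union> C) = i" using A(4) k by simp
  \<comment> \<open>The union spans H + K and has exactly i elements, its dimension.\<close>
  have indBC: "vec.independent (B \<union> C)"
  proof (rule vec.card_le_dim_spanning)
    show "B \<union> C \<subseteq> sum_space H K"
      using subset_sum_space[OF H(1) K(1)] B C by blast
    show "sum_space H K \<subseteq> vec.span (B \<union> C)"
    proof
      fix z assume "z \<in> sum_space H K"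
      then obtain x y where "x \<in> H" "y \<in> K" "z = x + y" by (auto simp: sum_space_def)
      then show "z \<in> vec.span (B \<union> C)"
        using B(4) C(4) vec.span_mono[of B "B \<union> C"] vec.span_mono[of C "B \<union> C"]
        by (auto intro!: vec.span_add)
    qed
  qed (use fin S cBC in auto)
  obtain D where D: "B \<union> C \<subseteq> D" "vec.independent D" "UNIV \<subseteq> vec.span D"
    using vec.maximal_independent_subset_extend[OF subset_UNIV indBC] by metis
  have finD: "finite D" using D vec.finiteI_independent by blast
  have "card D = vec.dim (UNIV :: (complex^'n) set)"
    using vec.basis_card_eq_dim[of D UNIV] D by simp
  then have cD: "card D = CARD('n)" by (simp add: card_cart_basis)
  then obtain f :: "'n \<Rightarrow> complex^'n" where f: "bij_betw f UNIV D"
    using finite_same_card_bij[of "UNIV :: 'n set" D] finD by auto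
  define G :: "complex^'n^'n" where "G = (\<chi> a l. f l $ a)"
  have col: "column l G = f l" for l by (simp add: G_def column_def)
  have "columns G = D" using f by (auto simp: columns_def col bij_betw_def)
  then have "invertible G"
    using D(3) unfolding invertible_right_inverse matrix_right_invertible_span_columns by auto
  \<comment> \<open>Labels: 0 for the intersection, 1 for the rest of H, 2 for the rest of K, 3 for
    what lies outside H + K.\<close>
  define \<sigma> :: "'n \<Rightarrow> nat" where "\<sigma> l = (if f l \<in> A then 0 else if f l \<in> B then 1 else if f l \<in> C then 2 else 3)" for l
  have fD: "f ` UNIV = D" using f by (simp add: bij_betw_def)
  have f_ex: "\<exists>l. f l = x" if "x \<in> D" for x using fD that by (metis imageE)
  have im: "f ` {l. P (f l)} = {x \<in> D. P x}" for P using fD by auto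
  have span: "vec.span M = L" if "M \<subseteq> L" "L \<subseteq> vec.span M" "vec.subspace L" for M L :: "(complex^'n) set"
    using that vec.span_minimal by blast
  have "{l. \<sigma> l \<in> {0,1}} = {l. f l \<in> B}" using B(1) by (auto simp: \<sigma>_def)
  moreover have "f ` {l. f l \<in> B} = B" using im[of "\<lambda>x. x \<in> B"] D(1) by auto
  ultimately have H': "H = (*v) G ` coord_space \<sigma> {0,1}"
    unfolding image_coord_space col using span[OF B(2,4) H(1)] by simp
  have "{l. \<sigma> l \<in> {0,2}} = {l. f l \<in> C}" using C(1) BC by (auto simp: \<sigma>_def)
  moreover have "f ` {l. f l \<in> C} = C" using im[of "\<lambda>x. x \<in> C"] D(1) by auto
  ultimately have K': "K = (*v) G ` coord_space \<sigma> {0,2}"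
    unfolding image_coord_space col using span[OF C(2,4) K(1)] by simp
  have "A \<noteq> {}" using A(4) k by auto
  then obtain a where "a \<in> A" by blast
  then have 0: "0 \<in> range \<sigma>" using f_ex[of a] B(1) D(1) by (force simp: \<sigma>_def)
  have "\<not> B \<subseteq> A" using card_mono[OF fin(1), of B] A(4) cB k by auto
  then obtain b where "b \<in> B" "b \<notin> A" by blast
  then have 1: "1 \<in> range \<sigma>" using f_ex[of b] D(1) by (force simp: \<sigma>_def)
  have "\<not> C \<subseteq> A" using card_mono[OF fin(1), of C] A(4) cC k by auto
  then obtain c where "c \<in> C" "c \<notin> A" by blast
  then have 2: "2 \<in> range \<sigma>" using f_ex[of c] D(1) BC by (force simp: \<sigma>_def)
  have 3: "3 \<in> range \<sigma> \<longleftrightarrow> i \<noteq> CARD('n)"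
  proof -
    have "3 \<in> range \<sigma> \<longleftrightarrow> \<not> D \<subseteq> B \<union> C"
    proof -
      have "\<sigma> l = 3 \<longleftrightarrow> f l \<notin> B \<union> C" for l using B(1) by (auto simp: \<sigma>_def)
      then have "3 \<in> range \<sigma> \<longleftrightarrow> (\<exists>l. f l \<notin> B \<union> C)" by (metis rangeE rangeI)
      then show ?thesis unfolding fD[symmetric] by blast
    qed
    also have "\<dots> \<longleftrightarrow> card (B \<union> C) \<noteq> card D"
    proof
      assume "\<not> D \<subseteq> B \<union> C"
      then have "B \<union> C \<subset> D" using D(1) by blast
      then have "card (B \<union> C) < card D" by (rule psubset_card_mono[OF finD])
      then show "card (B \<union> C) \<noteq> card D" by simp
    next
      assume "card (B \<union> C) \<noteq> card D"
      then show "\<not> D \<subseteq> B \<union> C" using D(1) by (metis subset_antisym)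
    qed
    finally show ?thesis by (simp add: cBC cD)
  qed
  have sets: "{..<4::nat} = {0,1,2,3}" "{..<3::nat} = {0,1,2}" by auto
  have "R = {..<(if i = CARD('n) then 3 else 4)}"
    if "R \<subseteq> {0,1,2,3}" "0 \<in> R" "1 \<in> R" "2 \<in> R" "3 \<in> R \<longleftrightarrow> i \<noteq> CARD('n)" for R :: "nat set"
    using that by (cases "i = CARD('n)") (auto simp: sets)
  moreover have "range \<sigma> \<subseteq> {0,1,2,3}" by (auto simp: \<sigma>_def)
  ultimately have "range \<sigma> = {..<(if i = CARD('n) then 3 else 4)}" using 0 1 2 3 by metis
  with \<open>invertible G\<close> H' K' that show thesis by blast
qed

text \<open>An adapted basis \<open>G\<close> puts p in coordinate position: idempotents are formed
  after undoing \<open>G\<close>, and the orbit map reapplies it. In these coordinates p is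
  orthogonally decomposed, so its idempotents are the standard ones.\<close>

lemma decomposition_space_F2:
  fixes p :: "(complex^'n) set \<times> (complex^'n) set"
  assumes p: "p \<in> F2 i k" and k: "k < i" "i < 2 * k"
  shows "\<exists>(\<sigma> :: 'n \<Rightarrow> nat) E \<rho>. decomposition_space (F2_top i k) p \<sigma> (if i = CARD('n) then 3 else 4) E \<rho>"
proof -
  let ?r = "if i = CARD('n) then 3 else 4 :: nat"
  obtain G :: "complex^'n^'n" and \<sigma> where G: "invertible G" and \<sigma>: "range \<sigma> = {..<?r}"
    and p1: "fst p = (*v) G ` coord_space \<sigma> {0,1}" and p2: "snd p = (*v) G ` coord_space \<sigma> {0,2}"
    using adapted_basis[of "fst p" "snd p" i k] p k by (metis prod.collapse)
  define Gi where "Gi = matrix_inv G"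
  have GG: "G ** Gi = mat 1" "Gi ** G = mat 1"
    using G by (simp_all add: Gi_def matrix_inv_left matrix_inv_right)
  have invGi: "invertible Gi" using G by (simp add: Gi_def invertible_matrix_inv)
  define E where "E x j = decomp ((*v) Gi ` fst x) ((*v) Gi ` snd x) j" for x j
  define \<rho> where "\<rho> g = ((*v) (G ** g) ` coord_space \<sigma> {0,1}, (*v) (G ** g) ` coord_space \<sigma> {0,2})" for g
  let ?X = "F2_top i k :: ((complex^'n) set \<times> (complex^'n) set) topology"
  have image_image': "(*v) M ` (*v) N ` L = (*v) (M ** N) ` L" for M N :: "complex^'n^'n" and L
    by (simp add: image_image matrix_vector_mul_assoc)
  have sub: "vec.subspace ((*v) Gi ` fst x)" "vec.subspace ((*v) Gi ` snd x)" if "x \<in> topspace ?X" for x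
    using F2_invertible_image[OF invGi, of "fst x" "snd x" i k] that by (auto simp: topspace_F2_top F2_simps)
  have r4: "?r \<le> 4" by simp
  \<comment> \<open>For i = n the sum fills the space, so the fourth idempotent vanishes and the
    first three already form a decomposition.\<close>
  have E3: "E x 3 = 0" if x: "x \<in> topspace ?X" and i: "i = CARD('n)" for x
  proof -
    have "vec.dim (sum_space ((*v) Gi ` fst x) ((*v) Gi ` snd x)) = CARD('n)"
      using F2_invertible_image[OF invGi, of "fst x" "snd x" i k] x i by (auto simp: topspace_F2_top F2_simps)
    moreover have "vec.dim (UNIV :: (complex^'n) set) = CARD('n)" by (simp add: card_cart_basis)
    ultimately have "sum_space ((*v) Gi ` fst x) ((*v) Gi ` snd x) = UNIV"
      using vec.subspace_dim_equal[OF subspace_sum_space[OF sub[OF x]] vec.subspace_UNIV] by simp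
    then show ?thesis unfolding E_def by (rule decomp_3_eq_0[OF sub[OF x]])
  qed
  have \<sigma>4: "\<sigma> l < 4" for l
  proof -
    have "\<sigma> l \<in> {..<?r}" unfolding \<sigma>[symmetric] by simp
    then show ?thesis using r4 by (simp split: if_splits)
  qed
  have \<rho>p: "\<rho> (mat 1) = p" using p1 p2 by (simp add: \<rho>_def prod_eq_iff)
  have \<rho>_unitary: "E (\<rho> g) j ** g = g ** block_idem \<sigma> j" if "adj g ** g = mat 1" "j < ?r" for g j
  proof -
    have "(*v) Gi ` fst (\<rho> g) = (*v) g ` coord_space \<sigma> {0,1}" "(*v) Gi ` snd (\<rho> g) = (*v) g ` coord_space \<sigma> {0,2}"
      by (simp_all only: \<rho>_def fst_conv snd_conv image_image' matrix_mul_assoc GG matrix_mul_lid)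
    then show ?thesis using decomp_unitary_image[OF that(1) \<sigma>4, of j] that(2) r4 by (simp add: E_def)
  qed
  have "decomposition_space ?X p \<sigma> ?r E \<rho>"
  proof
    show "range \<sigma> = {..<?r}" by (rule \<sigma>)
    show "p \<in> topspace ?X" using p by (simp add: topspace_F2_top)
    show "continuous_map ?X euclidean (\<lambda>x. E x j)" for j
      unfolding E_def by (rule continuous_map_decomp[OF invGi])
    show "(\<Sum>j<?r. E x j) = mat 1" if x: "x \<in> topspace ?X" for x
    proof -
      have s: "(\<Sum>j<4. E x j) = mat 1" unfolding E_def by (rule decomp_sum[OF sub[OF x]])
      show ?thesis
      proof (cases "i = CARD('n)")
        case True
        have "(\<Sum>j<4. E x j) = (\<Sum>j<3. E x j) + E x 3" by (simp add: eval_nat_numeral)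
        then show ?thesis using E3[OF x True] s True by simp
      qed (use s in simp)
    qed
    show "E x a ** E x b = (if a = b then E x a else 0)" if "x \<in> topspace ?X" "a < ?r" "b < ?r" for x a b
      unfolding E_def by (rule decomp_mult[OF sub[OF that(1)]]) (use that(2,3) r4 in linarith)+
    \<comment> \<open>The base point is the image of the identity matrix, which is unitary.\<close>
    show "E p j = block_idem \<sigma> j" if "j < ?r" for j
      using \<rho>_unitary[of "mat 1" j] that by (simp add: \<rho>p)
    show "continuous_map (top_of_set {g. invertible g}) ?X \<rho>"
    proof -
      have L: "coord_space \<sigma> {0,1} \<in> grassmannian k" "coord_space \<sigma> {0,2} \<in> grassmannian k"
        using p p1 p2 dim_invertible_image[OF G]
        by (auto simp: F2_def grassmannian_def subspace_coord_space)
      have "\<rho> g \<in> F2 i k" if g: "invertible g" for g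
      proof -
        have "((*v) (G ** g ** Gi) ` fst p, (*v) (G ** g ** Gi) ` snd p) \<in> F2 i k"
          by (rule F2_invertible_image) (use p g G invGi in \<open>auto intro!: invertible_mult\<close>)
        moreover have "G ** g ** Gi ** G = G ** g" by (simp add: GG flip: matrix_mul_assoc)
        ultimately show ?thesis by (simp only: p1 p2 image_image' \<rho>_def)
      qed
      moreover have "continuous_map (top_of_set {g. invertible g}) (prod_topology (grassmann_top k) (grassmann_top k)) \<rho>"
        unfolding \<rho>_def by (intro continuous_map_pairedI continuous_map_grassmann_action L G)
      ultimately show ?thesis by (auto simp: F2_top_def continuous_map_in_subtopology)
    qed
    show "\<rho> g = x" if x: "x \<in> topspace ?X" and g: "invertible g"
      and E: "\<And>j. j < ?r \<Longrightarrow> E x j ** g = g ** block_idem \<sigma> j" for x g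
    proof -
      \<comment> \<open>Applied with j = 1 and j = 2: in the coordinates of \<open>G\<close> each
        subspace is the fixed space of a sum of two idempotents, which g carries over from the
        corresponding coordinate subspace.\<close>
      have *: "L = (*v) (G ** g) ` coord_space \<sigma> {0,j}"
        if j: "j < ?r" "j \<noteq> 0" and L: "(*v) Gi ` L = {y. (E x 0 + E x j) *v y = y}" for L j
      proof -
        have Eg: "(E x 0 + E x j) ** g = g ** (block_idem \<sigma> 0 + block_idem \<sigma> j)"
          using E[of 0] E[OF j(1)] j by (simp add: matrix_ring)
        have bi: "(block_idem \<sigma> 0 + block_idem \<sigma> j) *v v = v \<longleftrightarrow> v \<in> coord_space \<sigma> {0,j}" for v
          using is_proj_fixes[OF is_proj_coord_space[of "{0,j}" \<sigma>], of v] j(2) by simp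
        have "{y. (E x 0 + E x j) *v y = y} = (*v) g ` coord_space \<sigma> {0,j}"
        proof (intro equalityI subsetI)
          fix y assume y: "y \<in> {y. (E x 0 + E x j) *v y = y}"
          define v where "v = matrix_inv g *v y"
          have yv: "y = g *v v" using g by (simp add: v_def matrix_vector_mul_assoc matrix_inv_right)
          have "g *v ((block_idem \<sigma> 0 + block_idem \<sigma> j) *v v) = g *v v"
            using y Eg unfolding yv by (simp add: matrix_vector_mul_assoc)
          then have "(block_idem \<sigma> 0 + block_idem \<sigma> j) *v v = v"
            using inj_invertible[OF g] by (simp add: inj_eq)
          then show "y \<in> (*v) g ` coord_space \<sigma> {0,j}" unfolding bi yv by blast
        next
          fix y assume "y \<in> (*v) g ` coord_space \<sigma> {0,j}"
          then obtain v where "v \<in> coord_space \<sigma> {0,j}" and v2: "y = g *v v" by blast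
          then have v1: "(block_idem \<sigma> 0 + block_idem \<sigma> j) *v v = v" by (simp only: bi)
          have "(E x 0 + E x j) *v y = g *v ((block_idem \<sigma> 0 + block_idem \<sigma> j) *v v)"
            using Eg by (simp add: v2 matrix_vector_mul_assoc)
          then show "y \<in> {y. (E x 0 + E x j) *v y = y}" using v1 v2 by simp
        qed
        then have "(*v) G ` (*v) Gi ` L = (*v) G ` (*v) g ` coord_space \<sigma> {0,j}" using L by simp
        then show ?thesis by (simp only: image_image' GG) simp
      qed
      have "fst x = (*v) (G ** g) ` coord_space \<sigma> {0,1}"
        by (rule *) (use decomp_fixes(1)[OF sub[OF x]] in \<open>auto simp: E_def\<close>)
      moreover have "snd x = (*v) (G ** g) ` coord_space \<sigma> {0,2}"
        by (rule *) (use decomp_fixes(2)[OF sub[OF x]] in \<open>auto simp: E_def\<close>)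
      ultimately show ?thesis by (simp add: \<rho>_def prod_eq_iff)
    qed
    show "E (\<rho> g) j ** g = g ** block_idem \<sigma> j" if "adj g ** g = mat 1" "j < ?r" for g j
      by (rule \<rho>_unitary[OF that])
  qed
  then show ?thesis by blast
qed

theorem mainTheorem4:
  fixes k i n :: nat
    and p :: "(complex ^ 'n) set \<times> (complex ^ 'n) set"
  assumes "CARD('n) = n"
    and "1 < k" "k < n"
    and "k < i" "i < 2 * k" "i \<le> n"
    and "p \<in> F2 i k"
  shows "(i = n \<longrightarrow> pi2 (F2_top i k) p \<cong> integer_group \<times>\<times> integer_group) \<and>
         (i < n \<longrightarrow> pi2 (F2_top i k) p \<cong> integer_group \<times>\<times> integer_group \<times>\<times> integer_group)"
proof -
  obtain \<sigma> :: "'n \<Rightarrow> nat" and E \<rho>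
    where "decomposition_space (F2_top i k) p \<sigma> (if i = n then 3 else 4) E \<rho>"
    using decomposition_space_F2[OF assms(7,4,5)] assms(1) by auto
  then interpret decomposition_space "F2_top i k" p \<sigma> "if i = n then 3 else 4" E \<rho> .
  show ?thesis using pi2_three_blocks pi2_four_blocks by auto
qed

end
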